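(* Let $\lambda$ be a fixed positive number, let $g_\lambda(x):=e^{-\lambda x^2}$, and let $(x_j)_{j\in\mathbb{Z}}$ be a Riesz-basis sequence. The following hold. (i) Given $f\in PW_\pi$, there exists a unique square-summable sequence $(a(j,\lambda))_{j\in\mathbb{Z}}$ such that $\sum_{j\in\mathbb{Z}}a(j,\lambda)g_\lambda(x_k-x_j)=f(x_k)$ for all $k\in\mathbb{Z}$. (ii) Let $f$ and $(a(j,\lambda))_{j\in\mathbb{Z}}$ be as in (i). The Gaussian interpolant to $f$ at the points $(x_j)_{j\in\mathbb{Z}}$, namely $I_\lambda(f)(x)=\sum_{j\in\mathbb{Z}}a(j,\lambda)g_\lambda(x-x_j)$, $x\in\mathbb{R}$, belongs to $C(\mathbb{R})\cap L_2(\mathbb{R})$. (iii) With $f$ and $I_\lambda(f)$ as in (i) and (ii), the Fourier transform of $I_\lambda(f)$ is given by $$\mathcal{F}[I_\lambda(f)](u)=\sqrt{\tfrac{\pi}{\lambda}}\,e^{-u^2/(4\lambda)}\sum_{j\in\mathbb{Z}}a(j,\lambda)e^{-ix_ju}$$ for almost every real number $u$. Moreover, $\mathcal{F}[I_\lambda(f)]\in L_2(\mathbb{R})\cap L_1(\mathbb{R})$. (iv) With $f$ and $I_\lambda(f)$ as in (i) and (ii), $$I_\lambda(f)(x)=\frac1{2\pi}\int_{-\infty}^{\infty}\mathcal{F}[I_\lambda(f)](u)e^{ixu}\,du,\qquad x\in\mathbb{R}.$$ In particular, $I_\lambda(f)\in C_0(\mathbb{R}):=\{g\in C(\mathbb{R}):\lim_{|x|\to\infty}g(x)=0\}$.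 (v) The Gaussian interpolation operator $I_\lambda$ is a bounded linear operator from $PW_\pi$ to $L_2(\mathbb{R})$. That is, the map $PW_\pi\ni f\mapsto I_\lambda(f)$ is linear, and there exists a positive constant $D$, depending only on $\lambda$ and $(x_j)_{j\in\mathbb{Z}}$, such that $\|I_\lambda(f)\|_{L_2(\mathbb{R})}\le D\|f\|_{L_2(\mathbb{R})}$ for every $f\in PW_\pi$.
   Context: $C(\mathbb{R})$ is the space of continuous functions on $\mathbb{R}$. For $g\in L_1(\mathbb{R})$, $\widehat g(x)=\int_{-\infty}^{\infty} g(t)e^{-ixt}\,dt$; $\mathcal{F}$ denotes the Fourier transform on $L_2(\mathbb{R})$, i.e. the bounded linear operator on $L_2(\mathbb{R})$ with $\mathcal{F}[g]=\widehat g$ for $g\in L_1(\mathbb{R})\cap L_2(\mathbb{R})$. $PW_\pi:=\{g\in L_2(\mathbb{R}):\mathcal{F}[g]=0 \text{ a.e. outside } [-\pi,\pi]\}$, with the $L_2(\mathbb{R})$ norm. Every $g\in PW_\pi$ is taken to be its continuous representative, so that $g(t)=\frac1{2\pi}\int_{-\pi}^{\pi}\mathcal{F}[g](x)e^{ixt}\,dx$ for every $t\in\mathbb{R}$. A real sequence $(x_j)_{j\in\mathbb{Z}}$ is a Riesz-basis sequence if $x_j<x_{j+1}$ for all $j\in\mathbb{Z}$ and the functions $e_j(t):=e^{-ix_jt}$, $j\in\mathbb{Z}$, form a Riesz basis for $L_2[-\pi,\pi]$; i.e. every $h\in L_2[-\pi,\pi]$ has a unique representation $h=\sum_j a_je_j$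 with $\sum_j|a_j|^2<\infty$, and there is a constant $B$ such that $B^{-1}(\sum|c_j|^2)^{1/2}\le\|\sum c_je_j\|_{L_2[-\pi,\pi]}\le B(\sum|c_j|^2)^{1/2}$ for every square-summable $(c_j)$. For square-summable $(a_j)$ the series $\sum_{j\in\mathbb{Z}}a_je^{-ix_ju}$ is understood as the limit of its partial sums $\sum_{|j|\le N}a_je^{-ix_ju}$ in $L_2[(2l-1)\pi,(2l+1)\pi]$ for every $l\in\mathbb{Z}$, giving a locally square-integrable function defined almost everywhere on $\mathbb{R}$. *)

theory Defs
  imports "HOL-Analysis.Analysis"
begin

text \<open>Elements of \<open>L\<^sub>2\<close> are represented by functions, and their equality by equality almost
  everywhere.  The measures are \<^const>\<open>lborel\<close> and its restrictions: every Lebesgue measurable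
  function agrees almost everywhere with a Borel function, so the spaces of classes are the usual ones.\<close>

definition L2 :: "'a measure \<Rightarrow> ('a \<Rightarrow> complex) set" where
  "L2 M = {f \<in> borel_measurable M. integrable M (\<lambda>t. (cmod (f t))\<^sup>2)}"

definition L2norm :: "'a measure \<Rightarrow> ('a \<Rightarrow> complex) \<Rightarrow> real" where
  "L2norm M f = sqrt (\<integral>t. (cmod (f t))\<^sup>2 \<partial>M)"

definition fourier_L1 :: "(real \<Rightarrow> complex) \<Rightarrow> real \<Rightarrow> complex" where
  "fourier_L1 g x = (\<integral>t. g t * cis (- (x * t)) \<partial>lborel)"

definition is_fourier_L2 :: "((real \<Rightarrow> complex) \<Rightarrow> real \<Rightarrow> complex) \<Rightarrow> bool" where
  "is_fourier_L2 T \<longleftrightarrow>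
     (\<forall>g \<in> L2 lborel. T g \<in> L2 lborel) \<and>
     (\<forall>g \<in> L2 lborel. \<forall>h \<in> L2 lborel. \<forall>c d.
        AE u in lborel. T (\<lambda>t. c * g t + d * h t) u = c * T g u + d * T h u) \<and>
     (\<exists>C. \<forall>g \<in> L2 lborel. L2norm lborel (T g) \<le> C * L2norm lborel g) \<and>
     (\<forall>g \<in> L2 lborel. integrable lborel g \<longrightarrow> (AE u in lborel. T g u = fourier_L1 g u))"

text \<open>The conditions above determine \<open>T g\<close> up to a null set for each \<open>g\<close> in \<open>L\<^sub>2(\<real>)\<close>, because
  \<open>L\<^sub>1 \<inter> L\<^sub>2\<close> is dense in \<open>L\<^sub>2\<close>; the choice below only selects representatives.\<close>

definition fourier_L2 :: "(real \<Rightarrow> complex) \<Rightarrow> real \<Rightarrow> complex" where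
  "fourier_L2 = (SOME T. is_fourier_L2 T)"

text \<open>Requiring continuity selects the continuous representative of each class.\<close>

definition PW_pi :: "(real \<Rightarrow> complex) set" where
  "PW_pi = {g \<in> L2 lborel. continuous_on UNIV g \<and>
              (AE u in lborel. u \<notin> {-pi..pi} \<longrightarrow> fourier_L2 g u = 0)}"

definition square_summable :: "(int \<Rightarrow> complex) \<Rightarrow> bool" where
  "square_summable a \<longleftrightarrow> (\<lambda>j. (cmod (a j))\<^sup>2) summable_on UNIV"

text \<open>Series in \<open>L\<^sub>2\<close> indexed by the integers are limits in norm of their symmetric partial sums.\<close>

definition has_L2_sum :: "'a measure \<Rightarrow> (int \<Rightarrow> 'a \<Rightarrow> complex) \<Rightarrow> ('a \<Rightarrow> complex) \<Rightarrow> bool" where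
  "has_L2_sum M f s \<longleftrightarrow> (\<forall>j. f j \<in> L2 M) \<and> s \<in> L2 M \<and>
     (\<lambda>N::nat. L2norm M (\<lambda>t. s t - (\<Sum>j\<in>{- int N..int N}. f j t))) \<longlonglongrightarrow> 0"

definition riesz_basis :: "'a measure \<Rightarrow> (int \<Rightarrow> 'a \<Rightarrow> complex) \<Rightarrow> bool" where
  "riesz_basis M e \<longleftrightarrow>
     (\<forall>j. e j \<in> L2 M) \<and>
     (\<forall>h \<in> L2 M. \<exists>!a. square_summable a \<and> has_L2_sum M (\<lambda>j t. a j * e j t) h) \<and>
     (\<exists>B>0. \<forall>c. square_summable c \<longrightarrow>
        (\<exists>s. has_L2_sum M (\<lambda>j t. c j * e j t) s \<and>
             inverse B * sqrt (infsum (\<lambda>j. (cmod (c j))\<^sup>2) UNIV) \<le> L2norm M s \<and>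
             L2norm M s \<le> B * sqrt (infsum (\<lambda>j. (cmod (c j))\<^sup>2) UNIV)))"

definition riesz_basis_sequence :: "(int \<Rightarrow> real) \<Rightarrow> bool" where
  "riesz_basis_sequence x \<longleftrightarrow> (\<forall>j. x j < x (j + 1)) \<and>
     riesz_basis (restrict_space lborel {-pi..pi}) (\<lambda>j t. cis (- (x j * t)))"

text \<open>\<open>S\<close> is a version of \<open>\<Sum>\<^sub>j a\<^sub>j exp (-i x\<^sub>j u)\<close>; it is determined up to a null set.\<close>

definition has_exponential_sum ::
    "(int \<Rightarrow> real) \<Rightarrow> (int \<Rightarrow> complex) \<Rightarrow> (real \<Rightarrow> complex) \<Rightarrow> bool" where
  "has_exponential_sum x a S \<longleftrightarrow>
     (\<forall>l::int. has_L2_sum (restrict_space lborel {(2 * of_int l - 1) * pi..(2 * of_int l + 1) * pi})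
        (\<lambda>j u. a j * cis (- (x j * u))) S)"

definition gauss :: "real \<Rightarrow> real \<Rightarrow> real" where
  "gauss lam t = exp (- lam * t\<^sup>2)"

definition interpolates ::
    "real \<Rightarrow> (int \<Rightarrow> real) \<Rightarrow> (real \<Rightarrow> complex) \<Rightarrow> (int \<Rightarrow> complex) \<Rightarrow> bool" where
  "interpolates lam x f a \<longleftrightarrow>
     (\<forall>k. ((\<lambda>j. a j * of_real (gauss lam (x k - x j))) has_sum f (x k)) UNIV)"

definition gauss_coeff :: "real \<Rightarrow> (int \<Rightarrow> real) \<Rightarrow> (real \<Rightarrow> complex) \<Rightarrow> int \<Rightarrow> complex" where
  "gauss_coeff lam x f = (THE a. square_summable a \<and> interpolates lam x f a)"

definition gauss_interpolant :: "real \<Rightarrow> (int \<Rightarrow> real) \<Rightarrow> (real \<Rightarrow> complex) \<Rightarrow> real \<Rightarrow> complex" where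
  "gauss_interpolant lam x f t =
     infsum (\<lambda>j. gauss_coeff lam x f j * of_real (gauss lam (t - x j))) UNIV"

end

theory Submission
  imports Defs "HOL-Probability.Characteristic_Functions" "HOL-Real_Asymp.Real_Asymp"
begin

text \<open>The matrix \<open>(gauss lam (x k - x j))\<close> acts on square-summable sequences as a bounded operator: the
  points of a Riesz-basis sequence are separated, so its row and column sums are bounded and Schur's
  test applies.  It is coercive, because its quadratic form is a Gaussian-weighted integral of
  \<open>\<bar>\<Sum>\<^sub>j a\<^sub>j exp (- i x\<^sub>j u)\<bar>\<^sup>2\<close> over the line, which dominates a multiple of the integral over
  \<open>[-\<pi>, \<pi>]\<close> and hence of \<open>\<Sum>\<^sub>j \<bar>a\<^sub>j\<bar>\<^sup>2\<close> by the lower Riesz bound.  So it is invertible, and the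
  samples of a band-limited function are square-summable by the dual (Bessel) form of the upper Riesz
  bound.  The remaining assertions follow by approximating the interpolant with its partial sums.  The
  \<open>L\<^sub>2\<close> Fourier transform exists because \<open>\<integral> \<bar>fourier_L1 g u\<bar>\<^sup>2 exp (- e u\<^sup>2) du \<le> 2 \<pi> \<integral> \<bar>g\<bar>\<^sup>2\<close> for every \<open>e > 0\<close>, again by
  Schur's test, applied to the Gaussian convolution kernel.\<close>

section \<open>Square-integrable functions\<close>

text \<open>\<open>fourier_L2\<close> is an arbitrary choice among the maps satisfying
  \<open>is_fourier_L2\<close>, so only the properties listed there are available; every further
  fact about it is carried over by continuity from functions that are also integrable.
  \<open>PW_pi\<close> likewise comes without a pointwise formula: the values of its members are
  recovered by an inversion theorem for continuous square-integrable functions with integrable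
  transform, which also gives the formula for the interpolant. The Riesz hypothesis speaks of
  [-pi, pi] alone, whereas the exponential series must converge on every translate of that interval.
  Its convergence is read off from the Gaussian series: the partial sums converge in L2 of the line,
  hence so do their transforms, which are exponential sums times a positive weight. Beyond
  separation of the points, the Riesz bounds enter only through the invertibility of the matrix and
  the samples of \<open>f\<close>. Coefficient sequences are elements of L2 for counting measure, so
  that one Schur test and one completeness theorem serve the line and the integers alike.\<close>

lemma L2I:
  assumes "f \<in> borel_measurable M" "integrable M (\<lambda>t. (cmod (f t))\<^sup>2)"
  shows "f \<in> L2 M"
  using assms by (simp add: L2_def)

lemma L2_measurable: "f \<in> L2 M \<Longrightarrow> f \<in> borel_measurable M"
  by (simp add: L2_def)

lemma L2_integrable: "f \<in> L2 M \<Longrightarrow> integrable M (\<lambda>t. (cmod (f t))\<^sup>2)"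
  by (simp add: L2_def)

lemma L2norm_nonneg [simp]: "L2norm M f \<ge> 0"
  by (simp add: L2norm_def)

lemma L2norm_power2: "(L2norm M f)\<^sup>2 = (\<integral>t. (cmod (f t))\<^sup>2 \<partial>M)"
  by (simp add: L2norm_def)

lemma L2norm_cong_AE:
  assumes "f \<in> borel_measurable M" "g \<in> borel_measurable M" "AE t in M. f t = g t"
  shows "L2norm M f = L2norm M g"
  unfolding L2norm_def using assms by (intro arg_cong[where f = sqrt] integral_cong_AE) auto

lemma L2_bound:
  assumes [measurable]: "f \<in> borel_measurable M" and g: "g \<in> L2 M" and "C \<ge> 0"
    and le: "AE t in M. cmod (f t) \<le> C * cmod (g t)"
  shows "f \<in> L2 M" "L2norm M f \<le> C * L2norm M g"
proof -
  note [measurable] = L2_measurable[OF g]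
  have sq: "AE t in M. (cmod (f t))\<^sup>2 \<le> C\<^sup>2 * (cmod (g t))\<^sup>2"
    using le by eventually_elim (metis norm_ge_zero power_mono power_mult_distrib)
  have ig: "integrable M (\<lambda>t. C\<^sup>2 * (cmod (g t))\<^sup>2)"
    using L2_integrable[OF g] by simp
  have "integrable M (\<lambda>t. (cmod (f t))\<^sup>2)"
    by (rule Bochner_Integration.integrable_bound[OF ig]) (use sq in auto)
  then show f: "f \<in> L2 M" by (intro L2I) auto
  have "(\<integral>t. (cmod (f t))\<^sup>2 \<partial>M) \<le> (\<integral>t. C\<^sup>2 * (cmod (g t))\<^sup>2 \<partial>M)"
    using L2_integrable[OF f] ig sq by (intro integral_mono_AE) auto
  also have "\<dots> = C\<^sup>2 * (\<integral>t. (cmod (g t))\<^sup>2 \<partial>M)" by simp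
  finally have "L2norm M f \<le> sqrt (C\<^sup>2 * (\<integral>t. (cmod (g t))\<^sup>2 \<partial>M))"
    unfolding L2norm_def by simp
  then show "L2norm M f \<le> C * L2norm M g"
    using \<open>C \<ge> 0\<close> by (simp add: real_sqrt_mult L2norm_def)
qed

lemma L2_mult_integrable:
  assumes f: "f \<in> L2 M" and g: "g \<in> L2 M"
  shows "integrable M (\<lambda>t. f t * g t)" "integrable M (\<lambda>t. cmod (f t) * cmod (g t))"
proof -
  note [measurable] = L2_measurable[OF f] L2_measurable[OF g]
  have i: "integrable M (\<lambda>t. (cmod (f t))\<^sup>2 + (cmod (g t))\<^sup>2)"
    using L2_integrable[OF f] L2_integrable[OF g] by simp
  have *: "a * b \<le> a\<^sup>2 + b\<^sup>2" for a b :: real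
    using zero_le_power2[of "a - b"] zero_le_power2[of "a + b"] unfolding power2_diff power2_sum by linarith
  show "integrable M (\<lambda>t. f t * g t)" "integrable M (\<lambda>t. cmod (f t) * cmod (g t))"
    by (rule Bochner_Integration.integrable_bound[OF i]; simp add: norm_mult *)+
qed

lemma L2_Cauchy_Schwarz:
  assumes f: "f \<in> L2 M" and g: "g \<in> L2 M"
  shows "(\<integral>t. cmod (f t) * cmod (g t) \<partial>M) \<le> L2norm M f * L2norm M g"
    and "cmod (\<integral>t. f t * g t \<partial>M) \<le> L2norm M f * L2norm M g"
proof -
  define A B I where "A = (\<integral>t. (cmod (f t))\<^sup>2 \<partial>M)" and "B = (\<integral>t. (cmod (g t))\<^sup>2 \<partial>M)"
    and "I = (\<integral>t. cmod (f t) * cmod (g t) \<partial>M)"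
  note int = L2_integrable[OF f] L2_integrable[OF g] L2_mult_integrable(2)[OF f g]
  have AB: "A \<ge> 0" "B \<ge> 0" "I \<ge> 0" by (auto simp: A_def B_def I_def)
  \<comment> \<open>A quadratic polynomial in \<open>s\<close>, nonnegative as an integral of
    squares; minimising it over \<open>s\<close> gives the inequality.\<close>
  have q: "0 \<le> A - 2 * s * I + s\<^sup>2 * B" for s
  proof -
    have "0 \<le> (\<integral>t. (cmod (f t) - s * cmod (g t))\<^sup>2 \<partial>M)" by simp
    also have "\<dots> = (\<integral>t. (cmod (f t))\<^sup>2 - 2 * s * (cmod (f t) * cmod (g t)) + s\<^sup>2 * (cmod (g t))\<^sup>2 \<partial>M)"
      by (intro Bochner_Integration.integral_cong) (auto simp: power2_eq_square algebra_simps)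
    also have "\<dots> = A - 2 * s * I + s\<^sup>2 * B" using int by (simp add: A_def B_def I_def)
    finally show ?thesis .
  qed
  have "I\<^sup>2 \<le> A * B"
  proof (cases "B = 0")
    case True
    have "I = 0"
    proof (rule ccontr)
      assume "I \<noteq> 0"
      \<comment> \<open>With \<open>B = 0\<close> the polynomial is affine in \<open>s\<close>, and
        at this point it equals -1.\<close>
      then show False using q[of "(A + 1) / (2 * I)"] AB True by simp
    qed
    then show ?thesis using AB by simp
  next
    case False
    then show ?thesis using q[of "I / B"] AB by (simp add: field_simps power2_eq_square)
  qed
  then have "I \<le> sqrt (A * B)" using AB by (simp add: real_le_rsqrt)
  then show *: "(\<integral>t. cmod (f t) * cmod (g t) \<partial>M) \<le> L2norm M f * L2norm M g"
    by (simp add: L2norm_def A_def B_def I_def real_sqrt_mult)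
  have "cmod (\<integral>t. f t * g t \<partial>M) \<le> (\<integral>t. cmod (f t * g t) \<partial>M)" by (rule integral_norm_bound)
  with * show "cmod (\<integral>t. f t * g t \<partial>M) \<le> L2norm M f * L2norm M g" by (simp add: norm_mult)
qed

lemma L2_zero [simp]: "(\<lambda>t. 0) \<in> L2 M"
  by (intro L2I) auto

lemma L2_cmult:
  assumes f: "f \<in> L2 M" shows "(\<lambda>t. c * f t) \<in> L2 M" "L2norm M (\<lambda>t. c * f t) = cmod c * L2norm M f"
proof -
  note [measurable] = L2_measurable[OF f]
  show "(\<lambda>t. c * f t) \<in> L2 M" by (rule L2_bound(1)[OF _ f, of _ "cmod c"]) (auto simp: norm_mult)
  show "L2norm M (\<lambda>t. c * f t) = cmod c * L2norm M f"
    by (simp add: L2norm_def norm_mult power_mult_distrib real_sqrt_mult)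
qed

lemma L2_cnj: "f \<in> L2 M \<Longrightarrow> (\<lambda>t. cnj (f t)) \<in> L2 M" "L2norm M (\<lambda>t. cnj (f t)) = L2norm M f"
  using borel_measurable_continuous_on[of cnj f M] continuous_on_cnj[OF continuous_on_id]
  unfolding L2_def L2norm_def by auto

lemma L2_add:
  assumes f: "f \<in> L2 M" and g: "g \<in> L2 M"
  shows "(\<lambda>t. f t + g t) \<in> L2 M" "L2norm M (\<lambda>t. f t + g t) \<le> L2norm M f + L2norm M g"
proof -
  note [measurable] = L2_measurable[OF f] L2_measurable[OF g]
  note int = L2_integrable[OF f] L2_integrable[OF g] L2_mult_integrable(2)[OF f g]
  have i: "integrable M (\<lambda>t. (cmod (f t))\<^sup>2 + (cmod (g t))\<^sup>2 + 2 * (cmod (f t) * cmod (g t)))"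
    using int by simp
  have le: "(cmod (f t + g t))\<^sup>2 \<le> (cmod (f t))\<^sup>2 + (cmod (g t))\<^sup>2 + 2 * (cmod (f t) * cmod (g t))" for t
    using power_mono[OF norm_triangle_ineq[of "f t" "g t"], of 2] by (simp add: power2_sum)
  show fg: "(\<lambda>t. f t + g t) \<in> L2 M"
    by (intro L2I Bochner_Integration.integrable_bound[OF i] AE_I2) (auto intro: order_trans[OF le])
  have "(L2norm M (\<lambda>t. f t + g t))\<^sup>2
     \<le> (\<integral>t. (cmod (f t))\<^sup>2 + (cmod (g t))\<^sup>2 + 2 * (cmod (f t) * cmod (g t)) \<partial>M)"
    unfolding L2norm_power2 using L2_integrable[OF fg] i le by (intro integral_mono) auto
  also have "\<dots> = (L2norm M f)\<^sup>2 + (L2norm M g)\<^sup>2 + 2 * (\<integral>t. cmod (f t) * cmod (g t) \<partial>M)"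
    using int by (simp add: L2norm_power2)
  also have "\<dots> \<le> (L2norm M f + L2norm M g)\<^sup>2"
    using L2_Cauchy_Schwarz(1)[OF f g] by (simp add: power2_sum)
  finally show "L2norm M (\<lambda>t. f t + g t) \<le> L2norm M f + L2norm M g"
    by (rule power2_le_imp_le) simp
qed

lemma L2_diff:
  assumes f: "f \<in> L2 M" and g: "g \<in> L2 M"
  shows "(\<lambda>t. f t - g t) \<in> L2 M" "L2norm M (\<lambda>t. f t - g t) \<le> L2norm M f + L2norm M g"
  using L2_add[OF f L2_cmult(1)[OF g, of "-1"]] L2_cmult(2)[OF g, of "-1"] by auto

lemma L2_sum: "(\<And>i. i \<in> I \<Longrightarrow> f i \<in> L2 M) \<Longrightarrow> (\<lambda>t. \<Sum>i\<in>I. f i t) \<in> L2 M"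
  by (induction I rule: infinite_finite_induct) (auto intro: L2_add)

lemma L2norm_minus_commute: "L2norm M (\<lambda>t. f t - g t) = L2norm M (\<lambda>t. g t - f t)"
  by (simp add: L2norm_def norm_minus_commute)

lemma L2norm_triangle:
  assumes "f \<in> L2 M" "g \<in> L2 M" "h \<in> L2 M"
  shows "L2norm M (\<lambda>t. f t - h t) \<le> L2norm M (\<lambda>t. f t - g t) + L2norm M (\<lambda>t. g t - h t)"
  using L2_add(2)[OF L2_diff(1)[OF assms(1,2)] L2_diff(1)[OF assms(2,3)]] by simp

lemma L2norm_reverse_triangle:
  assumes "f \<in> L2 M" "g \<in> L2 M"
  shows "\<bar>L2norm M f - L2norm M g\<bar> \<le> L2norm M (\<lambda>t. f t - g t)"
  using L2norm_triangle[OF assms L2_zero] L2norm_triangle[OF assms(2,1) L2_zero]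
    L2norm_minus_commute[of M f g] by simp

lemma L2norm_eq_0:
  assumes f: "f \<in> L2 M" and "L2norm M f = 0" shows "AE t in M. f t = 0"
proof -
  have "(\<integral>t. (cmod (f t))\<^sup>2 \<partial>M) = 0" using assms(2) by (simp add: L2norm_def)
  then show ?thesis
    using integral_nonneg_eq_0_iff_AE[OF L2_integrable[OF f]] by simp
qed

text \<open>The source of the almost-everywhere identities for transforms: both sides are shown to
  be limits in norm of one and the same sequence.\<close>

lemma L2_limit_unique:
  assumes f: "f \<in> L2 M" and g: "g \<in> L2 M" and h: "\<And>n. h n \<in> L2 M"
    and lf: "(\<lambda>n. L2norm M (\<lambda>t. h n t - f t)) \<longlonglongrightarrow> 0" and lg: "(\<lambda>n. L2norm M (\<lambda>t. h n t - g t)) \<longlonglongrightarrow> 0"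
  shows "AE t in M. f t = g t"
proof -
  have "(\<lambda>n. L2norm M (\<lambda>t. h n t - f t) + L2norm M (\<lambda>t. h n t - g t)) \<longlonglongrightarrow> 0"
    using tendsto_add[OF lf lg] by simp
  moreover have "L2norm M (\<lambda>t. f t - g t) \<le> L2norm M (\<lambda>t. h n t - f t) + L2norm M (\<lambda>t. h n t - g t)" for n
    using L2norm_triangle[OF f h g, of n] L2norm_minus_commute[of M f "h n"] by simp
  ultimately have "L2norm M (\<lambda>t. f t - g t) \<le> 0"
    by (intro LIMSEQ_le_const[of _ 0]) auto
  then have "L2norm M (\<lambda>t. f t - g t) = 0" using L2norm_nonneg by (simp add: order_antisym)
  from L2norm_eq_0[OF L2_diff(1)[OF f g] this] show ?thesis by simp
qed

lemma L2_tendsto_norm: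
  assumes f: "f \<in> L2 M" and h: "\<And>n. h n \<in> L2 M"
    and lf: "(\<lambda>n. L2norm M (\<lambda>t. h n t - f t)) \<longlonglongrightarrow> 0"
  shows "(\<lambda>n. L2norm M (h n)) \<longlonglongrightarrow> L2norm M f"
  by (rule LIM_zero_cancel, rule tendsto_rabs_zero_cancel, rule tendsto_sandwich[OF _ _ tendsto_const lf])
     (use L2norm_reverse_triangle[OF h f] in auto)

lemma L2_tendsto_integral:
  assumes f: "f \<in> L2 M" and h: "\<And>n. h n \<in> L2 M" and g: "g \<in> L2 M" and k: "\<And>n. k n \<in> L2 M"
    and lf: "(\<lambda>n. L2norm M (\<lambda>t. h n t - f t)) \<longlonglongrightarrow> 0" and lg: "(\<lambda>n. L2norm M (\<lambda>t. k n t - g t)) \<longlonglongrightarrow> 0"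
  shows "(\<lambda>n. \<integral>t. h n t * k n t \<partial>M) \<longlonglongrightarrow> (\<integral>t. f t * g t \<partial>M)"
proof (rule LIM_zero_cancel, rule Lim_null_comparison)
  show "\<forall>\<^sub>F n in sequentially. cmod ((\<integral>t. h n t * k n t \<partial>M) - (\<integral>t. f t * g t \<partial>M))
     \<le> L2norm M (\<lambda>t. h n t - f t) * L2norm M (k n) + L2norm M f * L2norm M (\<lambda>t. k n t - g t)"
  proof (intro always_eventually allI)
    fix n
    note d = L2_diff(1)[OF h[of n] f] L2_diff(1)[OF k[of n] g]
    have "(\<integral>t. h n t * k n t \<partial>M) - (\<integral>t. f t * g t \<partial>M) = (\<integral>t. h n t * k n t - f t * g t \<partial>M)"
      by (intro Bochner_Integration.integral_diff[symmetric] L2_mult_integrable(1) f g h k)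
    also have "\<dots> = (\<integral>t. (h n t - f t) * k n t + f t * (k n t - g t) \<partial>M)"
      by (simp add: algebra_simps)
    also have "\<dots> = (\<integral>t. (h n t - f t) * k n t \<partial>M) + (\<integral>t. f t * (k n t - g t) \<partial>M)"
      by (intro Bochner_Integration.integral_add L2_mult_integrable(1) d f k)
    finally show "cmod ((\<integral>t. h n t * k n t \<partial>M) - (\<integral>t. f t * g t \<partial>M))
     \<le> L2norm M (\<lambda>t. h n t - f t) * L2norm M (k n) + L2norm M f * L2norm M (\<lambda>t. k n t - g t)"
      using L2_Cauchy_Schwarz(2)[OF d(1) k[of n]] L2_Cauchy_Schwarz(2)[OF f d(2)]
      by (metis (mono_tags, lifting) add_mono norm_triangle_le)
  qed
  show "(\<lambda>n. L2norm M (\<lambda>t. h n t - f t) * L2norm M (k n) + L2norm M f * L2norm M (\<lambda>t. k n t - g t)) \<longlonglongrightarrow> 0"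
    by (rule tendsto_eq_intros lf lg L2_tendsto_norm[OF g k lg] refl)+ simp
qed

text \<open>Dominated convergence with the squared modulus of \<open>f\<close> as majorant. The
  exhausting sets are left general because both intervals of the line and windows of integers are
  needed.\<close>

lemma L2_truncation:
  fixes A :: "nat \<Rightarrow> 'a set"
  assumes f: "f \<in> L2 M" and A [measurable]: "\<And>n. A n \<in> sets M"
    and ev: "\<And>t. t \<in> space M \<Longrightarrow> \<forall>\<^sub>F n in sequentially. t \<in> A n"
  shows "(\<lambda>t. f t * indicator (A n) t) \<in> L2 M"
    and "(\<lambda>n. L2norm M (\<lambda>t. f t * indicator (A n) t - f t)) \<longlonglongrightarrow> 0"
proof -
  note [measurable] = L2_measurable[OF f]
  show "(\<lambda>t. f t * indicator (A n) t) \<in> L2 M" for n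
    by (rule L2_bound(1)[OF _ f, of _ 1]) (auto simp: indicator_def)
  have "(\<lambda>n. \<integral>t. (cmod (f t * indicator (A n) t - f t))\<^sup>2 \<partial>M) \<longlonglongrightarrow> (\<integral>t. 0 \<partial>M)"
  proof (rule integral_dominated_convergence[OF _ _ L2_integrable[OF f]])
    show "AE t in M. (\<lambda>n. (cmod (f t * indicator (A n) t - f t))\<^sup>2) \<longlonglongrightarrow> 0"
    proof (rule AE_I2)
      fix t assume "t \<in> space M"
      from ev[OF this] have "\<forall>\<^sub>F n in sequentially. (cmod (f t * indicator (A n) t - f t))\<^sup>2 = 0"
        by (rule eventually_mono) simp
      then show "(\<lambda>n. (cmod (f t * indicator (A n) t - f t))\<^sup>2) \<longlonglongrightarrow> 0"
        by (rule tendsto_eventually)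
    qed
  qed (auto simp: indicator_def)
  then have "(\<lambda>n. sqrt (\<integral>t. (cmod (f t * indicator (A n) t - f t))\<^sup>2 \<partial>M)) \<longlonglongrightarrow> sqrt 0"
    by (intro tendsto_real_sqrt) simp
  then show "(\<lambda>n. L2norm M (\<lambda>t. f t * indicator (A n) t - f t)) \<longlonglongrightarrow> 0"
    by (simp add: L2norm_def)
qed

text \<open>Phrased with the nonnegative integral, so that a bound obtained from Fatou or Tonelli
  yields membership and the norm estimate together, with no integrability known beforehand.\<close>

lemma L2_nn_integral:
  assumes "f \<in> borel_measurable M" "(\<integral>\<^sup>+t. ennreal ((cmod (f t))\<^sup>2) \<partial>M) \<le> ennreal (C\<^sup>2)" "C \<ge> 0"
  shows "f \<in> L2 M" "L2norm M f \<le> C"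
proof -
  note [measurable] = assms(1)
  show f: "f \<in> L2 M"
    using assms(2) by (intro L2I integrableI_bounded) (auto simp: le_less_trans)
  have "ennreal ((L2norm M f)\<^sup>2) \<le> ennreal (C\<^sup>2)"
    unfolding L2norm_power2 using assms(2) nn_integral_eq_integral[OF L2_integrable[OF f]] by simp
  then have "(L2norm M f)\<^sup>2 \<le> C\<^sup>2" by (simp add: ennreal_le_iff)
  then show "L2norm M f \<le> C" using \<open>C \<ge> 0\<close> by (rule power2_le_imp_le)
qed

text \<open>Reduces to the almost-everywhere Cauchy subsequence known for L1. Multiplication by a
  nowhere vanishing \<open>w\<close> in L2 makes the sequence Cauchy in L1, by Cauchy-Schwarz;
  dividing by \<open>w\<close> again gives pointwise convergence along a subsequence.\<close>

theorem L2_complete: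
  fixes h :: "nat \<Rightarrow> 'a \<Rightarrow> complex"
  assumes sf: "sigma_finite_measure M" and h: "\<And>n. h n \<in> L2 M"
    and cauchy: "\<And>e. e > 0 \<Longrightarrow> \<exists>N. \<forall>m\<ge>N. \<forall>n\<ge>N. L2norm M (\<lambda>t. h m t - h n t) < e"
  shows "\<exists>f\<in>L2 M. (\<lambda>n. L2norm M (\<lambda>t. h n t - f t)) \<longlonglongrightarrow> 0"
proof -
  note [measurable] = L2_measurable[OF h]
  obtain v where [measurable]: "v \<in> borel_measurable M" and v: "integral\<^sup>N M v \<noteq> \<infinity>"
      "\<And>t. t \<in> space M \<Longrightarrow> 0 < v t \<and> v t < \<infinity>"
    using sigma_finite_measure.Ex_finite_integrable_function[OF sf] by blast
  \<comment> \<open>The square root of a strictly positive, finite function with finite integral,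
    which sigma-finiteness supplies.\<close>
  define w where "w = (\<lambda>t. complex_of_real (sqrt (enn2real (v t))))"
  have [measurable]: "w \<in> borel_measurable M" by (simp add: w_def)
  have "(\<integral>\<^sup>+t. ennreal ((cmod (w t))\<^sup>2) \<partial>M) = integral\<^sup>N M v"
    by (intro nn_integral_cong) (use v in \<open>auto simp: w_def less_top\<close>)
  then have w: "w \<in> L2 M"
    using v(1) by (intro L2I integrableI_bounded) (auto simp: less_top)
  have w0: "w t \<noteq> 0" if "t \<in> space M" for t
    using v(2)[OF that] by (auto simp: w_def enn2real_eq_0_iff)
  have "\<exists>N. \<forall>i\<ge>N. \<forall>j\<ge>N. (\<integral>t. cmod (h i t * w t - h j t * w t) \<partial>M) < e" if e: "e > 0" for e
  proof -
    have pos: "L2norm M w + 1 > 0" using L2norm_nonneg[of M w] by linarith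
    then obtain N where N: "\<And>m n. m \<ge> N \<Longrightarrow> n \<ge> N \<Longrightarrow> L2norm M (\<lambda>t. h m t - h n t) < e / (L2norm M w + 1)"
      using cauchy[of "e / (L2norm M w + 1)"] e by auto
    show ?thesis
    proof (intro exI allI impI)
      fix i j assume "N \<le> i" "N \<le> j"
      have "(\<integral>t. cmod (h i t * w t - h j t * w t) \<partial>M) = (\<integral>t. cmod (h i t - h j t) * cmod (w t) \<partial>M)"
        by (simp flip: norm_mult left_diff_distrib)
      also have "\<dots> \<le> L2norm M (\<lambda>t. h i t - h j t) * L2norm M w"
        by (intro L2_Cauchy_Schwarz(1) L2_diff h w)
      also have "\<dots> \<le> L2norm M (\<lambda>t. h i t - h j t) * (L2norm M w + 1)"
        by (intro mult_left_mono) auto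
      also have "\<dots> < e"
        using N[OF \<open>N \<le> i\<close> \<open>N \<le> j\<close>] pos by (simp add: field_simps)
      finally show "(\<integral>t. cmod (h i t * w t - h j t * w t) \<partial>M) < e" .
    qed
  qed
  then obtain r where r: "strict_mono r" and rc: "AE t in M. Cauchy (\<lambda>i. h (r i) t * w t)"
    by (rule cauchy_L1_AE_cauchy_subseq[of M "\<lambda>n t. h n t * w t", OF L2_mult_integrable(1)[OF h w]])
  from rc have conv: "AE t in M. convergent (\<lambda>i. h (r i) t)"
  proof (rule AE_mp, intro AE_I2 impI)
    fix t assume elim: "t \<in> space M" "Cauchy (\<lambda>i. h (r i) t * w t)"
    then obtain y where "(\<lambda>i. h (r i) t * w t) \<longlonglongrightarrow> y"
      using Cauchy_convergent_iff convergent_def by metis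
    then have "(\<lambda>i. h (r i) t * w t / w t) \<longlonglongrightarrow> y / w t"
      using w0 elim by (intro tendsto_divide tendsto_const) auto
    then show "convergent (\<lambda>i. h (r i) t)" using w0 elim by (auto simp: convergent_def)
  qed
  define f where "f = (\<lambda>t. lim (\<lambda>i. h (r i) t))"
  have [measurable]: "f \<in> borel_measurable M"
    unfolding f_def by (rule borel_measurable_lim_metric) measurable
  have lim: "AE t in M. (\<lambda>i. h (r i) t) \<longlonglongrightarrow> f t"
    using conv by eventually_elim (simp add: f_def convergent_LIMSEQ_iff)
  \<comment> \<open>Fatou along the subsequence: the distance from \<open>h n\<close> to the limit
    inherits the bound on the distances to later terms. The difference is thereby in L2 before
    \<open>f\<close> itself is known to be.\<close>
  have *: "(\<lambda>t. h n t - f t) \<in> L2 M \<and> L2norm M (\<lambda>t. h n t - f t) \<le> e"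
    if e: "e > 0" and n: "\<And>m. m \<ge> N \<Longrightarrow> L2norm M (\<lambda>t. h n t - h m t) < e" for e n N
  proof -
    have "(\<integral>\<^sup>+t. ennreal ((cmod (h n t - f t))\<^sup>2) \<partial>M)
        = (\<integral>\<^sup>+t. liminf (\<lambda>i. ennreal ((cmod (h n t - h (r i) t))\<^sup>2)) \<partial>M)"
    proof (intro nn_integral_cong_AE)
      show "AE t in M. ennreal ((cmod (h n t - f t))\<^sup>2) = liminf (\<lambda>i. ennreal ((cmod (h n t - h (r i) t))\<^sup>2))"
        using lim
      proof eventually_elim
        case (elim t)
        have "(\<lambda>i. ennreal ((cmod (h n t - h (r i) t))\<^sup>2)) \<longlonglongrightarrow> ennreal ((cmod (h n t - f t))\<^sup>2)"
          by (intro tendsto_intros elim)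
        from lim_imp_Liminf[OF _ this] show ?case by simp
      qed
    qed
    also have "\<dots> \<le> liminf (\<lambda>i. \<integral>\<^sup>+t. ennreal ((cmod (h n t - h (r i) t))\<^sup>2) \<partial>M)"
      by (rule nn_integral_liminf) measurable
    also have "\<dots> \<le> ennreal (e\<^sup>2)"
    proof (rule Liminf_le)
      have "(\<integral>\<^sup>+t. ennreal ((cmod (h n t - h (r i) t))\<^sup>2) \<partial>M) \<le> ennreal (e\<^sup>2)" if "i \<ge> N" for i
      proof -
        have "L2norm M (\<lambda>t. h n t - h (r i) t) < e"
          using n[of "r i"] seq_suble[OF r, of i] that by simp
        then have "(L2norm M (\<lambda>t. h n t - h (r i) t))\<^sup>2 \<le> e\<^sup>2"
          by (intro power_mono) auto
        then show ?thesis
          unfolding L2norm_power2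
          by (subst nn_integral_eq_integral[OF L2_integrable[OF L2_diff(1)[OF h h]]]) (auto intro: ennreal_leI)
      qed
      then show "\<forall>\<^sub>F i in sequentially. (\<integral>\<^sup>+t. ennreal ((cmod (h n t - h (r i) t))\<^sup>2) \<partial>M) \<le> ennreal (e\<^sup>2)"
        by (auto simp: eventually_sequentially)
    qed simp
    finally show ?thesis
      using e by (auto intro!: L2_nn_integral)
  qed
  obtain N where N: "\<And>m n. m \<ge> N \<Longrightarrow> n \<ge> N \<Longrightarrow> L2norm M (\<lambda>t. h m t - h n t) < 1"
    using cauchy[of 1] by auto
  have "(\<lambda>t. h N t - f t) \<in> L2 M"
    using *[of 1 N N] N by auto
  from L2_diff(1)[OF h[of N] this] have f: "f \<in> L2 M" by simp
  moreover have "(\<lambda>n. L2norm M (\<lambda>t. h n t - f t)) \<longlonglongrightarrow> 0"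
  proof (rule LIMSEQ_I)
    fix e :: real assume "e > 0"
    then obtain N where N: "\<And>m n. m \<ge> N \<Longrightarrow> n \<ge> N \<Longrightarrow> L2norm M (\<lambda>t. h m t - h n t) < e / 2"
      using cauchy[of "e / 2"] by auto
    have "L2norm M (\<lambda>t. h n t - f t) < e" if "n \<ge> N" for n
      using *[of "e / 2" N n] N that \<open>e > 0\<close> by fastforce
    then show "\<exists>N. \<forall>n\<ge>N. norm (L2norm M (\<lambda>t. h n t - f t) - 0) < e" by auto
  qed
  ultimately show ?thesis by blast
qed

section \<open>Gaussians and the Schur test\<close>

lemma borel_measurable_cis [measurable (raw)]:
  "f \<in> borel_measurable M \<Longrightarrow> (\<lambda>t. cis (f t)) \<in> borel_measurable M"
  using borel_measurable_continuous_on[of cis f M] continuous_on_cis[OF continuous_on_id] by simp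

lemma borel_measurable_gauss [measurable (raw)]:
  "f \<in> borel_measurable M \<Longrightarrow> (\<lambda>t. gauss mu (f t)) \<in> borel_measurable M"
  unfolding gauss_def by measurable

lemma gauss_pos [simp]: "gauss mu t > 0" and gauss_nonneg [simp]: "gauss mu t \<ge> 0"
  by (auto simp: gauss_def)

lemma gauss_le_1: "mu > 0 \<Longrightarrow> gauss mu t \<le> 1"
  by (simp add: gauss_def)

lemma gauss_minus_commute: "gauss mu (s - t) = gauss mu (t - s)"
  by (simp add: gauss_def power2_commute)

text \<open>A rescaling of the characteristic function of the standard normal distribution.\<close>

lemma gauss_fourier_scaled:
  assumes mu: "mu > 0"
  shows "integrable lborel (gauss mu)"
    and "(\<integral>t. complex_of_real (gauss mu t) * cis (- (u * t)) \<partial>lborel)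
      = of_real (sqrt (pi / mu) * exp (- u\<^sup>2 / (4 * mu)))"
proof -
  \<comment> \<open>With this scaling the exponent \<open>- (c * t)\<^sup>2 / 2\<close> of the
    normal density becomes \<open>- mu * t\<^sup>2\<close>.\<close>
  define c where "c = sqrt (2 * mu)"
  have c: "c > 0" "c\<^sup>2 = 2 * mu" using mu by (auto simp: c_def)
  have dens: "std_normal_density (0 + c * t) = gauss mu t / sqrt (2 * pi)" for t
    using c by (simp add: std_normal_density_def gauss_def power_mult_distrib)
  have "integrable lborel (\<lambda>t. std_normal_density (0 + c * t))"
    using lborel_integrable_real_affine[OF integrable_normal_density[of 1 0], of c 0] c by simp
  then have "integrable lborel (\<lambda>t. sqrt (2 * pi) * (gauss mu t / sqrt (2 * pi)))"
    unfolding dens by (rule integrable_mult_right)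
  then show "integrable lborel (gauss mu)" by simp
  \<comment> \<open>Undoes the scaling in the phase; the sign accounts for the characteristic
    function using the opposite sign in the exponential.\<close>
  define s where "s = - u / c"
  have "of_real (exp (- s\<^sup>2 / 2)) = (\<integral>t. iexp (s * t) \<partial>std_normal_distribution)"
    using fun_cong[OF char_std_normal_distribution, of s] by (simp add: char_def)
  also have "\<dots> = (\<integral>t. std_normal_density t *\<^sub>R iexp (s * t) \<partial>lborel)"
    by (subst integral_density) auto
  also have "\<dots> = c *\<^sub>R (\<integral>t. std_normal_density (0 + c * t) *\<^sub>R iexp (s * (0 + c * t)) \<partial>lborel)"
    using c by (subst lborel_integral_real_affine[where c = c and t = 0]) auto
  also have "\<dots> = c *\<^sub>R (\<integral>t. complex_of_real (1 / sqrt (2 * pi)) * (complex_of_real (gauss mu t) * cis (- (u * t))) \<partial>lborel)"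
    unfolding dens using c
    by (intro arg_cong[where f = "\<lambda>z. c *\<^sub>R z"] Bochner_Integration.integral_cong)
       (auto simp: s_def cis_conv_exp scaleR_conv_of_real)
  also have "\<dots> = of_real (c / sqrt (2 * pi)) * (\<integral>t. complex_of_real (gauss mu t) * cis (- (u * t)) \<partial>lborel)"
    by (simp add: scaleR_conv_of_real)
  finally have *: "of_real (exp (- s\<^sup>2 / 2))
    = complex_of_real (c / sqrt (2 * pi)) * (\<integral>t. complex_of_real (gauss mu t) * cis (- (u * t)) \<partial>lborel)" .
  have s: "s\<^sup>2 / 2 = u\<^sup>2 / (4 * mu)" using c by (simp add: s_def power_divide)
  have cc: "sqrt (pi / mu) * (c / sqrt (2 * pi)) = 1"
    using mu by (simp add: c_def real_sqrt_divide real_sqrt_mult)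
  have "(\<integral>t. complex_of_real (gauss mu t) * cis (- (u * t)) \<partial>lborel)
      = of_real (sqrt (pi / mu) * (c / sqrt (2 * pi))) * (\<integral>t. complex_of_real (gauss mu t) * cis (- (u * t)) \<partial>lborel)"
    by (simp only: cc) simp
  also have "\<dots> = of_real (sqrt (pi / mu)) * (of_real (c / sqrt (2 * pi)) * (\<integral>t. complex_of_real (gauss mu t) * cis (- (u * t)) \<partial>lborel))"
    by (simp only: of_real_mult mult.assoc)
  also have "\<dots> = of_real (sqrt (pi / mu) * exp (- u\<^sup>2 / (4 * mu)))"
    unfolding *[symmetric] using s by simp
  finally show "(\<integral>t. complex_of_real (gauss mu t) * cis (- (u * t)) \<partial>lborel)
      = of_real (sqrt (pi / mu) * exp (- u\<^sup>2 / (4 * mu)))" .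
qed

lemma gauss_integral:
  assumes "mu > 0"
  shows "(\<integral>t. gauss mu t \<partial>lborel) = sqrt (pi / mu)"
proof -
  have "complex_of_real (\<integral>t. gauss mu t \<partial>lborel) = of_real (sqrt (pi / mu))"
    using gauss_fourier_scaled(2)[OF assms, of 0] by simp
  then show ?thesis by (simp only: of_real_eq_iff)
qed

lemma gauss_shift:
  assumes "mu > 0"
  shows "integrable lborel (\<lambda>t. gauss mu (t - s))" "(\<integral>t. gauss mu (t - s) \<partial>lborel) = sqrt (pi / mu)"
    "(\<integral>\<^sup>+t. ennreal (gauss mu (t - s)) \<partial>lborel) = ennreal (sqrt (pi / mu))"
proof -
  show i: "integrable lborel (\<lambda>t. gauss mu (t - s))"
    using lborel_integrable_real_affine[OF gauss_fourier_scaled(1)[OF assms], of 1 "-s"] by simp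
  show v: "(\<integral>t. gauss mu (t - s) \<partial>lborel) = sqrt (pi / mu)"
    using lborel_integral_real_affine[of 1 "gauss mu" "-s"] gauss_integral[OF assms] by simp
  show "(\<integral>\<^sup>+t. ennreal (gauss mu (t - s)) \<partial>lborel) = ennreal (sqrt (pi / mu))"
    using nn_integral_eq_integral[OF i] v by simp
qed

lemma gauss_power2: "(gauss mu t)\<^sup>2 = gauss (2 * mu) t"
  by (simp add: gauss_def power2_eq_square flip: exp_add)

lemma gauss_L2: "mu > 0 \<Longrightarrow> (\<lambda>t. complex_of_real (gauss mu (t - s))) \<in> L2 lborel"
  by (intro L2I) (auto simp: gauss_power2 intro: gauss_shift)

text \<open>The right-hand side has total mass \<open>2 * pi\<close> for every \<open>mu\<close> and
  concentrates at \<open>x\<close> as \<open>mu\<close> tends to 0. It serves as the kernel both in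
  the norm bound for the transform and in the inversion theorem.\<close>

lemma gauss_cis_fourier:
  assumes mu: "mu > 0"
  shows "fourier_L1 (\<lambda>u. complex_of_real (gauss mu u) * cis (x * u)) t
     = of_real (sqrt (pi / mu) * gauss (1 / (4 * mu)) (t - x))"
proof -
  have "fourier_L1 (\<lambda>u. complex_of_real (gauss mu u) * cis (x * u)) t
      = (\<integral>u. complex_of_real (gauss mu u) * cis (- ((t - x) * u)) \<partial>lborel)"
    unfolding fourier_L1_def
    by (intro Bochner_Integration.integral_cong) (auto simp: cis_mult algebra_simps)
  then show ?thesis using gauss_fourier_scaled(2)[OF mu, of "t - x"] by (simp add: gauss_def)
qed

lemma gauss_shift_fourier:
  assumes mu: "mu > 0"
  shows "fourier_L1 (\<lambda>t. complex_of_real (gauss mu (t - s))) u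
     = of_real (sqrt (pi / mu) * exp (- u\<^sup>2 / (4 * mu))) * cis (- (s * u))"
proof -
  have "fourier_L1 (\<lambda>t. complex_of_real (gauss mu (t - s))) u
      = (\<integral>t. complex_of_real (gauss mu t) * cis (- (u * (s + t))) \<partial>lborel)"
    unfolding fourier_L1_def
    by (subst lborel_integral_real_affine[where c = 1 and t = s]) auto
  also have "\<dots> = (\<integral>t. complex_of_real (gauss mu t) * cis (- (u * t)) * cis (- (s * u)) \<partial>lborel)"
    by (intro Bochner_Integration.integral_cong) (auto simp: cis_mult algebra_simps)
  also have "\<dots> = (\<integral>t. complex_of_real (gauss mu t) * cis (- (u * t)) \<partial>lborel) * cis (- (s * u))"
    by simp
  finally show ?thesis using gauss_fourier_scaled(2)[OF mu, of u] by simp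
qed

text \<open>Write the kernel as a product of two square roots and apply Cauchy-Schwarz in
  \<open>t\<close>: one factor is bounded by \<open>K1\<close>, and Tonelli turns the other into a
  bound by \<open>K2\<close>. Two measures are allowed because the kernel is used from line to line,
  from integers to line and from integers to integers.\<close>

theorem Schur_test:
  fixes k :: "'a \<Rightarrow> 'b \<Rightarrow> real"
  assumes M: "sigma_finite_measure M" and N: "sigma_finite_measure N"
    and [measurable]: "case_prod k \<in> borel_measurable (M \<Otimes>\<^sub>M N)"
    and k0: "\<And>s t. k s t \<ge> 0" and K: "K1 > 0" "K2 \<ge> 0"
    and K1: "\<And>s. s \<in> space M \<Longrightarrow> (\<integral>\<^sup>+t. ennreal (k s t) \<partial>N) \<le> ennreal K1"
    and K2: "\<And>t. t \<in> space N \<Longrightarrow> (\<integral>\<^sup>+s. ennreal (k s t) \<partial>M) \<le> ennreal K2"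
    and a: "a \<in> L2 N"
  shows "(\<lambda>s. \<integral>t. of_real (k s t) * a t \<partial>N) \<in> L2 M"
    and "L2norm M (\<lambda>s. \<integral>t. of_real (k s t) * a t \<partial>N) \<le> sqrt (K1 * K2) * L2norm N a"
proof -
  interpret M: sigma_finite_measure M by fact
  interpret N: sigma_finite_measure N by fact
  interpret P: pair_sigma_finite N M by unfold_locales
  note [measurable] = L2_measurable[OF a]
  have [measurable]: "(\<lambda>s. \<integral>t. of_real (k s t) * a t \<partial>N) \<in> borel_measurable M"
    by measurable
  have pt: "ennreal ((cmod (\<integral>t. of_real (k s t) * a t \<partial>N))\<^sup>2)
      \<le> ennreal K1 * (\<integral>\<^sup>+t. ennreal (k s t * (cmod (a t))\<^sup>2) \<partial>N)" if s: "s \<in> space M" for s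
  proof (cases "(\<integral>\<^sup>+t. ennreal (k s t * (cmod (a t))\<^sup>2) \<partial>N) < \<infinity>")
    \<comment> \<open>Here the right-hand side is infinite, as \<open>K1\<close> is
      positive.\<close>
    case False
    then show ?thesis using K by (simp add: ennreal_mult_top not_less top_unique)
  next
    case True
    have [measurable]: "k s \<in> borel_measurable N" using s by measurable
    have ik: "integrable N (k s)"
      using K1[OF s] k0 by (intro integrableI_bounded) (auto simp: le_less_trans)
    have i: "integrable N (\<lambda>t. k s t * (cmod (a t))\<^sup>2)"
      using True k0 by (intro integrableI_bounded) (auto simp: abs_mult)
    define f g where "f = (\<lambda>t. complex_of_real (sqrt (k s t)))"
      and "g = (\<lambda>t. of_real (sqrt (k s t)) * a t)"
    have f: "f \<in> L2 N" unfolding f_def using ik k0 by (intro L2I) auto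
    have g: "g \<in> L2 N" unfolding g_def using i k0 by (intro L2I) (auto simp: norm_mult power_mult_distrib)
    have "(\<integral>t. of_real (k s t) * a t \<partial>N) = (\<integral>t. f t * g t \<partial>N)"
      using k0 by (simp add: f_def g_def mult.assoc[symmetric] flip: of_real_mult)
    then have "cmod (\<integral>t. of_real (k s t) * a t \<partial>N) \<le> L2norm N f * L2norm N g"
      using L2_Cauchy_Schwarz(2)[OF f g] by simp
    then have "(cmod (\<integral>t. of_real (k s t) * a t \<partial>N))\<^sup>2 \<le> (L2norm N f)\<^sup>2 * (L2norm N g)\<^sup>2"
      by (metis norm_ge_zero power_mono power_mult_distrib)
    also have "\<dots> = (\<integral>t. k s t \<partial>N) * (\<integral>t. k s t * (cmod (a t))\<^sup>2 \<partial>N)"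
      using k0 by (simp add: L2norm_power2 f_def g_def norm_mult power_mult_distrib)
    finally have "ennreal ((cmod (\<integral>t. of_real (k s t) * a t \<partial>N))\<^sup>2)
        \<le> ennreal (\<integral>t. k s t \<partial>N) * ennreal (\<integral>t. k s t * (cmod (a t))\<^sup>2 \<partial>N)"
      using k0 by (simp add: ennreal_leI flip: ennreal_mult)
    also have "\<dots> = (\<integral>\<^sup>+t. ennreal (k s t) \<partial>N) * (\<integral>\<^sup>+t. ennreal (k s t * (cmod (a t))\<^sup>2) \<partial>N)"
      using nn_integral_eq_integral[OF ik] nn_integral_eq_integral[OF i] k0 by simp
    finally show ?thesis using K1[OF s] by (meson mult_right_mono order_trans zero_le)
  qed
  have "(\<integral>\<^sup>+s. ennreal ((cmod (\<integral>t. of_real (k s t) * a t \<partial>N))\<^sup>2) \<partial>M)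
     \<le> (\<integral>\<^sup>+s. ennreal K1 * (\<integral>\<^sup>+t. ennreal (k s t * (cmod (a t))\<^sup>2) \<partial>N) \<partial>M)"
    by (intro nn_integral_mono pt)
  also have "\<dots> = ennreal K1 * (\<integral>\<^sup>+s. (\<integral>\<^sup>+t. ennreal (k s t * (cmod (a t))\<^sup>2) \<partial>N) \<partial>M)"
    by (intro nn_integral_cmult) measurable
  also have "(\<integral>\<^sup>+s. (\<integral>\<^sup>+t. ennreal (k s t * (cmod (a t))\<^sup>2) \<partial>N) \<partial>M)
      = (\<integral>\<^sup>+t. (\<integral>\<^sup>+s. ennreal (k s t * (cmod (a t))\<^sup>2) \<partial>M) \<partial>N)"
    by (rule P.Fubini') measurable
  also have "\<dots> = (\<integral>\<^sup>+t. (\<integral>\<^sup>+s. ennreal (k s t) \<partial>M) * ennreal ((cmod (a t))\<^sup>2) \<partial>N)"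
    using k0 by (intro nn_integral_cong) (simp add: ennreal_mult nn_integral_multc)
  also have "\<dots> \<le> (\<integral>\<^sup>+t. ennreal K2 * ennreal ((cmod (a t))\<^sup>2) \<partial>N)"
    by (intro nn_integral_mono mult_right_mono K2) auto
  also have "\<dots> = ennreal K2 * ennreal ((L2norm N a)\<^sup>2)"
    unfolding L2norm_power2 using nn_integral_eq_integral[OF L2_integrable[OF a]]
    by (subst nn_integral_cmult) auto
  also have "ennreal K1 * (ennreal K2 * ennreal ((L2norm N a)\<^sup>2)) = ennreal ((sqrt (K1 * K2) * L2norm N a)\<^sup>2)"
    using K by (simp add: power_mult_distrib ennreal_mult mult.assoc)
  finally have *: "(\<integral>\<^sup>+s. ennreal ((cmod (\<integral>t. of_real (k s t) * a t \<partial>N))\<^sup>2) \<partial>M)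
      \<le> ennreal ((sqrt (K1 * K2) * L2norm N a)\<^sup>2)"
    by (simp add: mult_left_mono)
  show "(\<lambda>s. \<integral>t. of_real (k s t) * a t \<partial>N) \<in> L2 M"
    "L2norm M (\<lambda>s. \<integral>t. of_real (k s t) * a t \<partial>N) \<le> sqrt (K1 * K2) * L2norm N a"
    using K by (intro L2_nn_integral[OF _ *]; simp)+
qed

section \<open>The Fourier integral and its norm bound\<close>

lemma borel_measurable_fourier_L1 [measurable]:
  assumes [measurable]: "g \<in> borel_measurable lborel"
  shows "fourier_L1 g \<in> borel_measurable lborel"
  unfolding fourier_L1_def[abs_def] by measurable

lemma fourier_L1_integrable: "integrable lborel g \<Longrightarrow> integrable lborel (\<lambda>t. g t * cis (- (x * t)))"
  by (rule Bochner_Integration.integrable_bound[of _ g]) (auto simp: norm_mult)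

lemma fourier_L1_bound:
  assumes "integrable lborel g"
  shows "cmod (fourier_L1 g x) \<le> (\<integral>t. cmod (g t) \<partial>lborel)"
  unfolding fourier_L1_def
  using integral_norm_bound[of lborel "\<lambda>t. g t * cis (- (x * t))"] by (simp add: norm_mult)

lemma fourier_L1_linear:
  assumes "integrable lborel f" "integrable lborel g"
  shows "fourier_L1 (\<lambda>t. c * f t + d * g t) x = c * fourier_L1 f x + d * fourier_L1 g x"
proof -
  have "fourier_L1 (\<lambda>t. c * f t + d * g t) x
      = (\<integral>t. c * (f t * cis (- (x * t))) + d * (g t * cis (- (x * t))) \<partial>lborel)"
    unfolding fourier_L1_def by (simp add: algebra_simps)
  then show ?thesis
    using assms[THEN fourier_L1_integrable] by (simp add: fourier_L1_def)
qed

text \<open>Fubini for the integrable function \<open>f t * g u\<close> times a unimodular phase.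
  This is the only duality between a function and its transform on which the norm bound and the
  inversion theorem rest.\<close>

lemma fourier_L1_mult_formula:
  assumes f: "integrable lborel f" and g: "integrable lborel g"
  shows "(\<integral>u. fourier_L1 f u * g u \<partial>lborel) = (\<integral>t. f t * fourier_L1 g t \<partial>lborel)"
proof -
  note [measurable] = borel_measurable_integrable[OF f] borel_measurable_integrable[OF g]
  have int: "integrable (lborel \<Otimes>\<^sub>M lborel) (\<lambda>(u, t). f t * g u * cis (- (u * t)))"
  proof (rule lborel_pair.Fubini_integrable)
    show "integrable lborel (\<lambda>u. \<integral>t. norm (case (u, t) of (u, t) \<Rightarrow> f t * g u * cis (- (u * t))) \<partial>lborel)"
      using g by (simp add: norm_mult)
    show "AE u in lborel. integrable lborel (\<lambda>t. case (u, t) of (u, t) \<Rightarrow> f t * g u * cis (- (u * t)))"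
    proof (intro AE_I2)
      fix u :: real
      show "integrable lborel (\<lambda>t. case (u, t) of (u, t) \<Rightarrow> f t * g u * cis (- (u * t)))"
        by (rule Bochner_Integration.integrable_bound[of _ "\<lambda>t. f t * g u"]) (use f in \<open>auto simp: norm_mult\<close>)
    qed
  qed measurable
  have "(\<integral>u. fourier_L1 f u * g u \<partial>lborel) = (\<integral>u. (\<integral>t. f t * g u * cis (- (u * t)) \<partial>lborel) \<partial>lborel)"
    unfolding fourier_L1_def integral_mult_left_zero[symmetric]
    by (intro Bochner_Integration.integral_cong refl) (simp only: mult.assoc mult.commute[of "cis _"])
  also have "\<dots> = (\<integral>t. (\<integral>u. f t * g u * cis (- (u * t)) \<partial>lborel) \<partial>lborel)"
    using lborel_pair.Fubini_integral[OF int] by simp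
  also have "\<dots> = (\<integral>t. f t * fourier_L1 g t \<partial>lborel)"
    unfolding fourier_L1_def integral_mult_right_zero[symmetric]
    by (intro Bochner_Integration.integral_cong refl) (simp only: mult.assoc mult.commute[of "_ :: real"])
  finally show ?thesis .
qed

text \<open>The inequality half of Plancherel. As the transform of an integrable function is
  bounded, a Gaussian factor makes the integral of its squared modulus finite in advance. The
  multiplication formula rewrites that integral as a pairing of \<open>g\<close> with a Gaussian
  mean of \<open>g\<close>, and Fatou removes the factor as \<open>e\<close> tends to 0.\<close>

theorem fourier_L1_L2:
  assumes g1: "integrable lborel g" and g2: "g \<in> L2 lborel"
  shows "fourier_L1 g \<in> L2 lborel" "L2norm lborel (fourier_L1 g) \<le> sqrt (2 * pi) * L2norm lborel g"
proof -
  note [measurable] = L2_measurable[OF g2]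
  define I where "I e = (\<integral>\<^sup>+u. ennreal (gauss e u * (cmod (fourier_L1 g u))\<^sup>2) \<partial>lborel)" for e
  have I: "I e \<le> ennreal ((sqrt (2 * pi) * L2norm lborel g)\<^sup>2)" if e: "e > 0" for e
  proof -
    \<comment> \<open>The transform of the modulated Gaussian, read as a kernel. Its mass does not
      depend on \<open>e\<close>, so the resulting bound is uniform in \<open>e\<close>.\<close>
    define K where "K s t = sqrt (pi / e) * gauss (1 / (4 * e)) (t - s)" for s t
    have K0: "K s t \<ge> 0" for s t using e by (simp add: K_def)
    have Ksym: "K s t = K t s" for s t by (simp add: K_def gauss_minus_commute)
    have Kint: "(\<integral>\<^sup>+t. ennreal (K s t) \<partial>lborel) = ennreal (2 * pi)" for s
    proof -
      have "(\<integral>\<^sup>+t. ennreal (K s t) \<partial>lborel) = ennreal (sqrt (pi / e)) * ennreal (sqrt (pi / (1 / (4 * e))))"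
        unfolding K_def using e gauss_shift(3)[of "1 / (4 * e)" s]
        by (simp add: ennreal_mult nn_integral_cmult)
      also have "\<dots> = ennreal (sqrt (pi / e) * sqrt (pi / (1 / (4 * e))))"
        using e by (simp add: ennreal_mult)
      also have "sqrt (pi / e) * sqrt (pi / (1 / (4 * e))) = 2 * pi"
        using e by (simp add: real_sqrt_mult real_sqrt_divide)
      finally show ?thesis .
    qed
    define H where "H s = (\<integral>t. of_real (K s t) * g t \<partial>lborel)" for s
    have Kint': "(\<integral>\<^sup>+s. ennreal (K s t) \<partial>lborel) = ennreal (2 * pi)" for t
      using Kint[of t] by (simp add: Ksym)
    have "H \<in> L2 lborel \<and> L2norm lborel H \<le> sqrt (2 * pi * (2 * pi)) * L2norm lborel g"
      using Schur_test[of lborel lborel K "2 * pi" "2 * pi" g] K0 Kint Kint' g2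
      unfolding H_def[abs_def]
      by (auto simp: sigma_finite_lborel K_def[abs_def] case_prod_beta')
    moreover have "sqrt (2 * pi * (2 * pi)) = 2 * pi"
      unfolding real_sqrt_abs2 by simp
    ultimately have H: "H \<in> L2 lborel" "L2norm lborel H \<le> 2 * pi * L2norm lborel g" by auto
    \<comment> \<open>Chosen so that \<open>fourier_L1 g u * psi u\<close> is the weighted squared
      modulus, while the transform of \<open>psi\<close> is the conjugate of
      \<open>H\<close>.\<close>
    define psi where "psi u = of_real (gauss e u) * cnj (fourier_L1 g u)" for u
    have bd: "cmod (fourier_L1 g u) \<le> (\<integral>t. cmod (g t) \<partial>lborel)" for u
      using fourier_L1_bound[OF g1] .
    have [measurable]: "(\<lambda>u. cnj (fourier_L1 g u)) \<in> borel_measurable lborel"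
      using borel_measurable_continuous_on[of cnj "fourier_L1 g" lborel] continuous_on_cnj[OF continuous_on_id] by simp
    have psi: "integrable lborel psi"
      unfolding psi_def[abs_def]
      by (rule Bochner_Integration.integrable_bound[of _ "\<lambda>u. gauss e u * (\<integral>t. cmod (g t) \<partial>lborel)"])
         (auto simp: norm_mult gauss_fourier_scaled(1)[OF e] bd intro!: mult_left_mono order_trans[OF bd abs_ge_self])
    have psihat: "fourier_L1 psi s = cnj (H s)" for s
    proof -
      have gi: "integrable lborel (\<lambda>u. complex_of_real (gauss e u) * cis (s * u))"
        by (rule Bochner_Integration.integrable_bound[of _ "gauss e"])
           (auto simp: norm_mult gauss_fourier_scaled(1)[OF e])
      have "fourier_L1 psi s = cnj (\<integral>u. fourier_L1 g u * (complex_of_real (gauss e u) * cis (s * u)) \<partial>lborel)"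
        unfolding fourier_L1_def[of psi] psi_def Bochner_Integration.integral_cnj[symmetric]
        by (intro Bochner_Integration.integral_cong) (auto simp: cis_cnj mult_ac)
      also have "\<dots> = cnj (H s)"
        unfolding fourier_L1_mult_formula[OF g1 gi] gauss_cis_fourier[OF e] H_def K_def
        by (simp add: mult_ac)
      finally show ?thesis .
    qed
    have ii: "integrable lborel (\<lambda>u. gauss e u * (cmod (fourier_L1 g u))\<^sup>2)"
      by (rule Bochner_Integration.integrable_bound[of _ "\<lambda>u. gauss e u * (\<integral>t. cmod (g t) \<partial>lborel)\<^sup>2"])
         (auto simp: abs_mult gauss_fourier_scaled(1)[OF e] bd intro!: mult_left_mono power_mono)
    have "complex_of_real (\<integral>u. gauss e u * (cmod (fourier_L1 g u))\<^sup>2 \<partial>lborel) = (\<integral>u. fourier_L1 g u * psi u \<partial>lborel)"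
      unfolding integral_complex_of_real[symmetric] psi_def
      by (intro Bochner_Integration.integral_cong) (auto simp: complex_norm_square mult_ac simp del: of_real_power)
    also have "\<dots> = (\<integral>t. g t * cnj (H t) \<partial>lborel)"
      unfolding fourier_L1_mult_formula[OF g1 psi] psihat ..
    finally have eq: "complex_of_real (\<integral>u. gauss e u * (cmod (fourier_L1 g u))\<^sup>2 \<partial>lborel) = (\<integral>t. g t * cnj (H t) \<partial>lborel)" .
    have "(\<integral>u. gauss e u * (cmod (fourier_L1 g u))\<^sup>2 \<partial>lborel) \<le> cmod (\<integral>t. g t * cnj (H t) \<partial>lborel)"
      unfolding eq[symmetric] norm_of_real by simp
    also have "\<dots> \<le> L2norm lborel g * L2norm lborel H"
      using L2_Cauchy_Schwarz(2)[OF g2 L2_cnj(1)[OF H(1)]] by (simp add: L2_cnj)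
    also have "\<dots> \<le> L2norm lborel g * (2 * pi * L2norm lborel g)"
      by (intro mult_left_mono H(2)) simp
    also have "\<dots> = (sqrt (2 * pi) * L2norm lborel g)\<^sup>2"
      by (simp add: power_mult_distrib power2_eq_square)
    finally show ?thesis
      unfolding I_def using nn_integral_eq_integral[OF ii] by (simp add: ennreal_leI)
  qed
  have "(\<integral>\<^sup>+u. ennreal ((cmod (fourier_L1 g u))\<^sup>2) \<partial>lborel)
     = (\<integral>\<^sup>+u. liminf (\<lambda>n. ennreal (gauss (1 / real (Suc n)) u * (cmod (fourier_L1 g u))\<^sup>2)) \<partial>lborel)"
  proof (intro nn_integral_cong)
    fix u :: real
    have "(\<lambda>n. 1 / real (Suc n)) \<longlonglongrightarrow> 0"
      using LIMSEQ_inverse_real_of_nat by (simp add: inverse_eq_divide)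
    then have "(\<lambda>n. ennreal (gauss (1 / real (Suc n)) u * (cmod (fourier_L1 g u))\<^sup>2))
        \<longlonglongrightarrow> ennreal (exp (- 0 * u\<^sup>2) * (cmod (fourier_L1 g u))\<^sup>2)"
      unfolding gauss_def by (intro tendsto_intros)
    from lim_imp_Liminf[OF _ this]
    show "ennreal ((cmod (fourier_L1 g u))\<^sup>2) = liminf (\<lambda>n. ennreal (gauss (1 / real (Suc n)) u * (cmod (fourier_L1 g u))\<^sup>2))"
      by simp
  qed
  also have "\<dots> \<le> liminf (\<lambda>n. I (1 / real (Suc n)))"
    unfolding I_def by (rule nn_integral_liminf) measurable
  also have "\<dots> \<le> ennreal ((sqrt (2 * pi) * L2norm lborel g)\<^sup>2)"
    by (intro Liminf_le always_eventually allI I) auto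
  finally have *: "(\<integral>\<^sup>+u. ennreal ((cmod (fourier_L1 g u))\<^sup>2) \<partial>lborel) \<le> ennreal ((sqrt (2 * pi) * L2norm lborel g)\<^sup>2)" .
  show "fourier_L1 g \<in> L2 lborel" "L2norm lborel (fourier_L1 g) \<le> sqrt (2 * pi) * L2norm lborel g"
    by (intro L2_nn_integral[OF _ *]; simp)+
qed

section \<open>The Fourier transform on square-integrable functions\<close>

lemma L2norm_tendsto_0:
  assumes "\<And>n. L2norm M (h n) \<le> b n" "b \<longlonglongrightarrow> (0::real)"
  shows "(\<lambda>n. L2norm M (h n)) \<longlonglongrightarrow> 0"
  by (rule Lim_null_comparison[OF _ assms(2)]) (simp add: assms(1))

text \<open>Cutting off to a bounded interval puts a square-integrable function into L1 as well, and
  it commutes exactly with linear combinations, from which the linearity of the extended transform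
  follows.\<close>

definition trunc :: "nat \<Rightarrow> (real \<Rightarrow> complex) \<Rightarrow> real \<Rightarrow> complex" where
  "trunc n g t = g t * indicator {- real n..real n} t"

lemma trunc_L2:
  assumes g: "g \<in> L2 lborel"
  shows "trunc n g \<in> L2 lborel" "integrable lborel (trunc n g)"
    "(\<lambda>n. L2norm lborel (\<lambda>t. trunc n g t - g t)) \<longlonglongrightarrow> 0"
proof -
  have ev: "\<forall>\<^sub>F n in sequentially. t \<in> {- real n..real n}" for t :: real
  proof -
    obtain N where "\<bar>t\<bar> \<le> real N" using real_arch_simple by blast
    then have "t \<in> {- real n..real n}" if "n \<ge> N" for n using that by auto
    then show ?thesis by (auto simp: eventually_sequentially)
  qed
  show "trunc n g \<in> L2 lborel" "(\<lambda>n. L2norm lborel (\<lambda>t. trunc n g t - g t)) \<longlonglongrightarrow> 0"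
    unfolding trunc_def[abs_def] using L2_truncation[OF g, of "\<lambda>n. {- real n..real n}"] ev by auto
  have "(\<lambda>t. indicator {- real n..real n} t :: complex) \<in> L2 lborel"
  proof (intro L2I)
    have "(\<lambda>t. (cmod (indicator {- real n..real n} t))\<^sup>2) = (indicator {- real n..real n} :: real \<Rightarrow> real)"
      by (auto simp: indicator_def)
    then show "integrable lborel (\<lambda>t. (cmod (indicator {- real n..real n} t))\<^sup>2)" by simp
  qed simp
  from L2_mult_integrable(1)[OF g this] show "integrable lborel (trunc n g)"
    unfolding trunc_def[abs_def] .
qed

lemma fourier_trunc_converges:
  assumes g: "g \<in> L2 lborel"
  shows "\<exists>F\<in>L2 lborel. (\<lambda>n. L2norm lborel (\<lambda>u. fourier_L1 (trunc n g) u - F u)) \<longlonglongrightarrow> 0"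
proof (rule L2_complete[OF sigma_finite_lborel])
  note tr = trunc_L2[OF g]
  show "fourier_L1 (trunc n g) \<in> L2 lborel" for n by (rule fourier_L1_L2(1)[OF tr(2,1)])
  have diff: "L2norm lborel (\<lambda>t. fourier_L1 (trunc m g) t - fourier_L1 (trunc n g) t)
     \<le> sqrt (2 * pi) * (L2norm lborel (\<lambda>t. trunc m g t - g t) + L2norm lborel (\<lambda>t. trunc n g t - g t))" for m n
  proof -
    have "(\<lambda>t. fourier_L1 (trunc m g) t - fourier_L1 (trunc n g) t) = fourier_L1 (\<lambda>t. trunc m g t - trunc n g t)"
      using fourier_L1_linear[OF tr(2,2), of 1 m "-1" n] by auto
    then have "L2norm lborel (\<lambda>t. fourier_L1 (trunc m g) t - fourier_L1 (trunc n g) t)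
        \<le> sqrt (2 * pi) * L2norm lborel (\<lambda>t. trunc m g t - trunc n g t)"
      using fourier_L1_L2(2)[of "\<lambda>t. trunc m g t - trunc n g t"] tr L2_diff(1)[OF tr(1,1)] by simp
    also have "L2norm lborel (\<lambda>t. trunc m g t - trunc n g t)
        \<le> L2norm lborel (\<lambda>t. trunc m g t - g t) + L2norm lborel (\<lambda>t. trunc n g t - g t)"
      using L2norm_triangle[OF tr(1) g tr(1)] L2norm_minus_commute[of lborel g] by simp
    finally show ?thesis by (simp add: mult_left_mono)
  qed
  fix e :: real assume e: "e > 0"
  \<comment> \<open>Each of the two truncation errors may be \<open>d\<close>, after multiplication
    by the norm bound \<open>sqrt (2 * pi)\<close>.\<close>
  define d where "d = e / (2 * sqrt (2 * pi))"
  have d: "d > 0" "sqrt (2 * pi) * (d + d) = e" using e by (auto simp: d_def)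
  obtain N where N: "\<And>n. n \<ge> N \<Longrightarrow> L2norm lborel (\<lambda>t. trunc n g t - g t) < d"
    using LIMSEQ_D[OF tr(3) d(1)] by auto
  show "\<exists>N. \<forall>m\<ge>N. \<forall>n\<ge>N. L2norm lborel (\<lambda>t. fourier_L1 (trunc m g) t - fourier_L1 (trunc n g) t) < e"
  proof (intro exI allI impI)
    fix m n assume "m \<ge> N" "n \<ge> N"
    then have "L2norm lborel (\<lambda>t. trunc m g t - g t) + L2norm lborel (\<lambda>t. trunc n g t - g t) < d + d"
      by (intro add_strict_mono N)
    then have "sqrt (2 * pi) * (L2norm lborel (\<lambda>t. trunc m g t - g t) + L2norm lborel (\<lambda>t. trunc n g t - g t))
        < sqrt (2 * pi) * (d + d)"
      by (intro mult_strict_left_mono) auto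
    with diff[of m n] d show "L2norm lborel (\<lambda>t. fourier_L1 (trunc m g) t - fourier_L1 (trunc n g) t) < e"
      by linarith
  qed
qed

text \<open>Since \<open>fourier_L2\<close> is selected by \<open>SOME\<close>, its properties are
  accessible only through a witness. The witness is the limit of the transforms of truncations;
  linearity and agreement with the integral follow from uniqueness of limits.\<close>

theorem is_fourier_L2_exists: "\<exists>T. is_fourier_L2 T"
proof -
  \<comment> \<open>Outside L2 this choice is arbitrary, and \<open>is_fourier_L2\<close> asserts
    nothing there.\<close>
  define T where "T g = (SOME F. F \<in> L2 lborel \<and>
    (\<lambda>n. L2norm lborel (\<lambda>u. fourier_L1 (trunc n g) u - F u)) \<longlonglongrightarrow> 0)" for g
  have T: "T g \<in> L2 lborel" "(\<lambda>n. L2norm lborel (\<lambda>u. fourier_L1 (trunc n g) u - T g u)) \<longlonglongrightarrow> 0"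
    if "g \<in> L2 lborel" for g
    using someI_ex[of "\<lambda>F. F \<in> L2 lborel \<and> (\<lambda>n. L2norm lborel (\<lambda>u. fourier_L1 (trunc n g) u - F u)) \<longlonglongrightarrow> 0"]
      fourier_trunc_converges[OF that] unfolding T_def by blast+
  have F: "fourier_L1 (trunc n g) \<in> L2 lborel" if "g \<in> L2 lborel" for n g
    by (rule fourier_L1_L2(1)[OF trunc_L2(2,1)[OF that]])
  have "is_fourier_L2 T"
    unfolding is_fourier_L2_def
  proof (intro conjI ballI allI exI[of _ "sqrt (2 * pi)"] impI)
    fix g h :: "real \<Rightarrow> complex" and c d assume g: "g \<in> L2 lborel" and h: "h \<in> L2 lborel"
    have gh: "(\<lambda>t. c * g t + d * h t) \<in> L2 lborel" by (intro L2_add L2_cmult g h)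
    have eq: "fourier_L1 (trunc n (\<lambda>t. c * g t + d * h t))
      = (\<lambda>u. c * fourier_L1 (trunc n g) u + d * fourier_L1 (trunc n h) u)" for n
      using fourier_L1_linear[OF trunc_L2(2)[OF g] trunc_L2(2)[OF h]]
      by (auto simp: trunc_def[abs_def] algebra_simps)
    show "AE u in lborel. T (\<lambda>t. c * g t + d * h t) u = c * T g u + d * T h u"
    proof (rule L2_limit_unique[OF T(1)[OF gh] _ F[OF gh] T(2)[OF gh]])
      show cdT: "(\<lambda>u. c * T g u + d * T h u) \<in> L2 lborel" by (intro L2_add L2_cmult T g h)
      show "(\<lambda>n. L2norm lborel (\<lambda>t. fourier_L1 (trunc n (\<lambda>t. c * g t + d * h t)) t - (c * T g t + d * T h t))) \<longlonglongrightarrow> 0"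
      proof (rule L2norm_tendsto_0)
        fix n
          note dg = L2_diff(1)[OF F[OF g, of n] T(1)[OF g]] and dh = L2_diff(1)[OF F[OF h, of n] T(1)[OF h]]
          show "L2norm lborel (\<lambda>t. fourier_L1 (trunc n (\<lambda>t. c * g t + d * h t)) t - (c * T g t + d * T h t))
          \<le> cmod c * L2norm lborel (\<lambda>u. fourier_L1 (trunc n g) u - T g u)
            + cmod d * L2norm lborel (\<lambda>u. fourier_L1 (trunc n h) u - T h u)"
            using L2_add(2)[OF L2_cmult(1)[OF dg, of c] L2_cmult(1)[OF dh, of d]]
            unfolding eq L2_cmult(2)[OF dg] L2_cmult(2)[OF dh] by (simp add: algebra_simps)
        show "(\<lambda>n. cmod c * L2norm lborel (\<lambda>u. fourier_L1 (trunc n g) u - T g u)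
            + cmod d * L2norm lborel (\<lambda>u. fourier_L1 (trunc n h) u - T h u)) \<longlonglongrightarrow> 0"
          by (intro tendsto_add_zero tendsto_mult_right_zero T(2) g h)
      qed
    qed
  next
    fix g :: "real \<Rightarrow> complex" assume g: "g \<in> L2 lborel"
    show "T g \<in> L2 lborel" by (rule T(1)[OF g])
    note tr = trunc_L2[OF g]
    have "(\<lambda>n. L2norm lborel (fourier_L1 (trunc n g))) \<longlonglongrightarrow> L2norm lborel (T g)"
      by (rule L2_tendsto_norm[OF T(1) F T(2)]) (rule g)+
    moreover have "(\<lambda>n. sqrt (2 * pi) * L2norm lborel (trunc n g)) \<longlonglongrightarrow> sqrt (2 * pi) * L2norm lborel g"
      by (intro tendsto_mult tendsto_const L2_tendsto_norm g tr)
    ultimately show "L2norm lborel (T g) \<le> sqrt (2 * pi) * L2norm lborel g"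
      by (rule LIMSEQ_le) (use fourier_L1_L2(2)[OF tr(2,1)] in auto)
    assume g1: "integrable lborel g"
    show "AE u in lborel. T g u = fourier_L1 g u"
    proof (rule L2_limit_unique[OF T(1)[OF g] fourier_L1_L2(1)[OF g1 g] F[OF g] T(2)[OF g]])
      have "L2norm lborel (\<lambda>t. fourier_L1 (trunc n g) t - fourier_L1 g t)
          \<le> sqrt (2 * pi) * L2norm lborel (\<lambda>t. trunc n g t - g t)" for n
      proof -
        have "(\<lambda>t. fourier_L1 (trunc n g) t - fourier_L1 g t) = fourier_L1 (\<lambda>t. trunc n g t - g t)"
          using fourier_L1_linear[OF tr(2) g1, of 1 n "-1"] by auto
        then show ?thesis
          using fourier_L1_L2(2)[of "\<lambda>t. trunc n g t - g t"] tr g1 L2_diff(1)[OF tr(1) g] by simp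
      qed
      moreover have "(\<lambda>n. sqrt (2 * pi) * L2norm lborel (\<lambda>t. trunc n g t - g t)) \<longlonglongrightarrow> 0"
        using tendsto_mult_right_zero[OF tr(3)] .
      ultimately show "(\<lambda>n. L2norm lborel (\<lambda>t. fourier_L1 (trunc n g) t - fourier_L1 g t)) \<longlonglongrightarrow> 0"
        by (rule L2norm_tendsto_0)
    qed
  qed
  then show "\<exists>T. is_fourier_L2 T" by (rule exI[of is_fourier_L2 T])
qed

lemma is_fourier_L2: "is_fourier_L2 fourier_L2"
  unfolding fourier_L2_def using someI_ex[OF is_fourier_L2_exists] .

lemma fourier_L2_in_L2: "g \<in> L2 lborel \<Longrightarrow> fourier_L2 g \<in> L2 lborel"
  using is_fourier_L2 by (simp add: is_fourier_L2_def)

lemma fourier_L2_eq_L1: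
  "g \<in> L2 lborel \<Longrightarrow> integrable lborel g \<Longrightarrow> AE u in lborel. fourier_L2 g u = fourier_L1 g u"
  using is_fourier_L2 by (simp add: is_fourier_L2_def)

lemma fourier_L2_linear:
  "g \<in> L2 lborel \<Longrightarrow> h \<in> L2 lborel \<Longrightarrow>
    AE u in lborel. fourier_L2 (\<lambda>t. c * g t + d * h t) u = c * fourier_L2 g u + d * fourier_L2 h u"
  using is_fourier_L2 unfolding is_fourier_L2_def by blast

lemma fourier_L2_bounded:
  "\<exists>C\<ge>0. \<forall>g\<in>L2 lborel. L2norm lborel (fourier_L2 g) \<le> C * L2norm lborel g"
proof -
  obtain C where C: "\<And>g. g \<in> L2 lborel \<Longrightarrow> L2norm lborel (fourier_L2 g) \<le> C * L2norm lborel g"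
    using is_fourier_L2 unfolding is_fourier_L2_def by blast
  have "L2norm lborel (fourier_L2 g) \<le> max C 0 * L2norm lborel g" if "g \<in> L2 lborel" for g
    using C[OF that] by (rule order_trans) (intro mult_right_mono, auto)
  then show ?thesis by (intro exI[of _ "max C 0"]) auto
qed

lemma fourier_L2_tendsto:
  assumes h: "\<And>n. h n \<in> L2 lborel" and g: "g \<in> L2 lborel"
    and lim: "(\<lambda>n. L2norm lborel (\<lambda>t. h n t - g t)) \<longlonglongrightarrow> 0"
  shows "(\<lambda>n. L2norm lborel (\<lambda>u. fourier_L2 (h n) u - fourier_L2 g u)) \<longlonglongrightarrow> 0"
proof -
  obtain C where C: "C \<ge> 0" "\<And>g. g \<in> L2 lborel \<Longrightarrow> L2norm lborel (fourier_L2 g) \<le> C * L2norm lborel g"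
    using fourier_L2_bounded by blast
  have "L2norm lborel (\<lambda>u. fourier_L2 (h n) u - fourier_L2 g u) \<le> C * L2norm lborel (\<lambda>t. h n t - g t)" for n
  proof -
    note d = L2_diff(1)[OF h[of n] g]
    have "AE u in lborel. fourier_L2 (h n) u - fourier_L2 g u = fourier_L2 (\<lambda>t. h n t - g t) u"
      using fourier_L2_linear[OF h[of n] g, of 1 "-1"] by eventually_elim simp
    then have "L2norm lborel (\<lambda>u. fourier_L2 (h n) u - fourier_L2 g u) = L2norm lborel (fourier_L2 (\<lambda>t. h n t - g t))"
      by (intro L2norm_cong_AE L2_measurable L2_diff fourier_L2_in_L2 h g d)
    with C(2)[OF d] show ?thesis by simp
  qed
  moreover have "(\<lambda>n. C * L2norm lborel (\<lambda>t. h n t - g t)) \<longlonglongrightarrow> 0"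
    using tendsto_mult_right_zero[OF lim] .
  ultimately show ?thesis by (rule L2norm_tendsto_0)
qed

text \<open>Truncate \<open>f\<close> and pass to the limit on both sides. The second function stays
  integrable: in the application it is a modulated Gaussian, whose transform is explicit.\<close>

lemma fourier_L2_mult_formula:
  assumes f: "f \<in> L2 lborel" and g1: "integrable lborel g" and g2: "g \<in> L2 lborel"
  shows "(\<integral>u. fourier_L2 f u * g u \<partial>lborel) = (\<integral>t. f t * fourier_L1 g t \<partial>lborel)"
proof (rule LIMSEQ_unique)
  note tr = trunc_L2[OF f]
  have c: "(\<lambda>n. L2norm lborel (\<lambda>t. h t - h t)) \<longlonglongrightarrow> 0" for h :: "real \<Rightarrow> complex"
    by (simp add: L2norm_def)
  show "(\<lambda>n. \<integral>u. fourier_L2 (trunc n f) u * g u \<partial>lborel) \<longlonglongrightarrow> (\<integral>u. fourier_L2 f u * g u \<partial>lborel)"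
    by (rule L2_tendsto_integral[OF fourier_L2_in_L2[OF f] fourier_L2_in_L2[OF tr(1)] g2 g2
          fourier_L2_tendsto[OF tr(1) f tr(3)] c])
  have "(\<integral>u. fourier_L2 (trunc n f) u * g u \<partial>lborel) = (\<integral>t. trunc n f t * fourier_L1 g t \<partial>lborel)" for n
  proof -
    have "(\<integral>u. fourier_L2 (trunc n f) u * g u \<partial>lborel) = (\<integral>u. fourier_L1 (trunc n f) u * g u \<partial>lborel)"
    proof (rule integral_cong_AE)
      show "AE u in lborel. fourier_L2 (trunc n f) u * g u = fourier_L1 (trunc n f) u * g u"
        using fourier_L2_eq_L1[OF tr(1)[of n] tr(2)[of n]] by eventually_elim simp
    qed (use L2_measurable[OF tr(1)] L2_measurable[OF g2] L2_measurable[OF fourier_L2_in_L2[OF tr(1)]] in measurable)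
    then show ?thesis using fourier_L1_mult_formula[OF tr(2) g1] by simp
  qed
  moreover have "(\<lambda>n. \<integral>t. trunc n f t * fourier_L1 g t \<partial>lborel) \<longlonglongrightarrow> (\<integral>t. f t * fourier_L1 g t \<partial>lborel)"
    by (rule L2_tendsto_integral[OF f tr(1) fourier_L1_L2(1)[OF g1 g2] fourier_L1_L2(1)[OF g1 g2] tr(3) c])
  ultimately show "(\<lambda>n. \<integral>u. fourier_L2 (trunc n f) u * g u \<partial>lborel) \<longlonglongrightarrow> (\<integral>t. f t * fourier_L1 g t \<partial>lborel)"
    by simp
qed

text \<open>A continuous square-integrable \<open>f\<close> may be unbounded, so the integral is
  split at distance 1 from \<open>x\<close>. Near \<open>x\<close> the function is bounded and
  dominated convergence applies after rescaling; far from \<open>x\<close> the kernel is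
  exponentially small relative to a fixed Gaussian, which pairs with \<open>f\<close> in L2.\<close>

lemma gauss_approximate_identity:
  fixes f :: "real \<Rightarrow> complex"
  assumes f: "f \<in> L2 lborel" and cont: "continuous_on UNIV f"
  shows "(\<lambda>n. \<integral>t. f t * of_real (sqrt (pi * Suc n) * gauss (Suc n / 4) (t - x)) \<partial>lborel) \<longlonglongrightarrow> 2 * pi * f x"
proof -
  note [measurable] = L2_measurable[OF f]
  define K where "K n t = complex_of_real (sqrt (pi * Suc n) * gauss (Suc n / 4) (t - x))" for n t
  define f1 f2 where "f1 t = f t * indicator {x-1..x+1} t" and "f2 t = f t * indicator (- {x-1..x+1}) t" for t
  have f12 [measurable]: "f1 \<in> borel_measurable lborel" "f2 \<in> borel_measurable lborel"
    by (auto simp: f1_def[abs_def] f2_def[abs_def])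
  have K2: "K n \<in> L2 lborel" for n
    unfolding K_def[abs_def] of_real_mult by (intro L2_cmult gauss_L2) auto
  have L1: "f1 \<in> L2 lborel" "f2 \<in> L2 lborel"
    using f by (auto intro!: L2_bound(1)[OF _ f, of _ 1] AE_I2 simp: f1_def f2_def indicator_def)
  have split: "(\<integral>t. f t * K n t \<partial>lborel) = (\<integral>t. f1 t * K n t \<partial>lborel) + (\<integral>t. f2 t * K n t \<partial>lborel)" for n
  proof -
    have "(\<integral>t. f t * K n t \<partial>lborel) = (\<integral>t. f1 t * K n t + f2 t * K n t \<partial>lborel)"
      by (intro Bochner_Integration.integral_cong) (auto simp: f1_def f2_def indicator_def)
    also have "\<dots> = (\<integral>t. f1 t * K n t \<partial>lborel) + (\<integral>t. f2 t * K n t \<partial>lborel)"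
      by (intro Bochner_Integration.integral_add L2_mult_integrable(1) L1 K2)
    finally show ?thesis .
  qed
  \<comment> \<open>The substitution \<open>t = x + s / sqrt (Suc n)\<close> makes the kernel
    independent of \<open>n\<close> and moves the dependence into the argument of
    \<open>f1\<close>.\<close>
  have p1: "(\<integral>t. f1 t * K n t \<partial>lborel)
      = (\<integral>s. f1 (x + s / sqrt (Suc n)) * of_real (sqrt pi * gauss (1/4) s) \<partial>lborel)" for n
  proof -
    have "(\<integral>t. f1 t * K n t \<partial>lborel)
       = (1 / sqrt (Suc n)) *\<^sub>R (\<integral>s. f1 (x + 1 / sqrt (Suc n) * s) * K n (x + 1 / sqrt (Suc n) * s) \<partial>lborel)"
      by (subst lborel_integral_real_affine[where c = "1 / sqrt (Suc n)" and t = x]) auto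
    also have "\<dots> = (\<integral>s. (1 / sqrt (Suc n)) *\<^sub>R (f1 (x + 1 / sqrt (Suc n) * s) * K n (x + 1 / sqrt (Suc n) * s)) \<partial>lborel)"
      by simp
    also have "\<dots> = (\<integral>s. f1 (x + s / sqrt (Suc n)) * of_real (sqrt pi * gauss (1/4) s) \<partial>lborel)"
    proof (intro Bochner_Integration.integral_cong refl)
      fix s
      have n2: "(sqrt (real (Suc n)))\<^sup>2 = real (Suc n)" by simp
      have "K n (x + 1 / sqrt (Suc n) * s) = of_real (sqrt (Suc n)) * of_real (sqrt pi * gauss (1/4) s)"
        using n2 by (simp add: K_def gauss_def power_divide real_sqrt_mult mult_ac del: of_nat_Suc)
      then show "(1 / sqrt (Suc n)) *\<^sub>R (f1 (x + 1 / sqrt (Suc n) * s) * K n (x + 1 / sqrt (Suc n) * s))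
        = f1 (x + s / sqrt (Suc n)) * of_real (sqrt pi * gauss (1/4) s)"
        by (simp add: scaleR_conv_of_real field_simps)
    qed
    finally show ?thesis .
  qed
  have "compact (f ` {x-1..x+1})"
    using cont by (intro compact_continuous_image compact_Icc continuous_on_subset[OF cont]) auto
  then obtain B where B: "\<And>t. t \<in> {x-1..x+1} \<Longrightarrow> cmod (f t) \<le> B"
    by (meson bounded_iff compact_imp_bounded imageI)
  have B0: "B \<ge> 0" using order_trans[OF norm_ge_zero B[of x]] by simp
  have f1B: "cmod (f1 t) \<le> B" for t using B B0 by (auto simp: f1_def indicator_def)
  have small: "(\<lambda>n. s / sqrt (Suc n)) \<longlonglongrightarrow> 0" for s :: real
    by real_asymp
  have "(\<lambda>n. \<integral>s. f1 (x + s / sqrt (Suc n)) * of_real (sqrt pi * gauss (1/4) s) \<partial>lborel)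
     \<longlonglongrightarrow> (\<integral>s. f x * of_real (sqrt pi * gauss (1/4) s) \<partial>lborel)"
  proof (rule integral_dominated_convergence[where w = "\<lambda>s. B * (sqrt pi * gauss (1/4) s)"])
    show "AE s in lborel. (\<lambda>n. f1 (x + s / sqrt (Suc n)) * of_real (sqrt pi * gauss (1/4) s))
       \<longlonglongrightarrow> f x * of_real (sqrt pi * gauss (1/4) s)"
    proof (intro AE_I2 tendsto_mult tendsto_const)
      fix s :: real
      have l: "(\<lambda>n. x + s / sqrt (Suc n)) \<longlonglongrightarrow> x" using tendsto_add[OF tendsto_const small] by simp
      have "(\<lambda>n. f (x + s / sqrt (Suc n))) \<longlonglongrightarrow> f x"
        using cont l by (intro isCont_tendsto_compose[of x f]) (auto simp: continuous_on_eq_continuous_at)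
      moreover have "\<forall>\<^sub>F n in sequentially. f (x + s / sqrt (Suc n)) = f1 (x + s / sqrt (Suc n))"
      proof -
        have "\<forall>\<^sub>F n in sequentially. x - 1 < x + s / sqrt (Suc n)" "\<forall>\<^sub>F n in sequentially. x + s / sqrt (Suc n) < x + 1"
          using order_tendstoD(1)[OF l, of "x - 1"] order_tendstoD(2)[OF l, of "x + 1"] by simp_all
        then show ?thesis by eventually_elim (auto simp: f1_def)
      qed
      ultimately show "(\<lambda>n. f1 (x + s / sqrt (Suc n))) \<longlonglongrightarrow> f x"
        by (rule Lim_transform_eventually)
    qed
    show "AE s in lborel. cmod (f1 (x + s / sqrt (Suc n)) * of_real (sqrt pi * gauss (1/4) s))
        \<le> B * (sqrt pi * gauss (1/4) s)" for n
      by (auto simp: norm_mult abs_mult intro!: mult_right_mono f1B AE_I2)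
  qed (use gauss_fourier_scaled(1)[of "1/4"] in auto)
  moreover have "(\<integral>s. f x * of_real (sqrt pi * gauss (1/4) s) \<partial>lborel) = 2 * pi * f x"
  proof -
    have "(\<integral>s. f x * of_real (sqrt pi * gauss (1/4) s) \<partial>lborel) = f x * of_real (sqrt pi * (\<integral>s. gauss (1/4) s \<partial>lborel))"
      by simp
    also have "sqrt pi * (\<integral>s. gauss (1/4) s \<partial>lborel) = 2 * pi"
      using gauss_integral[of "1/4"] by (simp add: real_sqrt_mult)
    finally show ?thesis by simp
  qed
  ultimately have part1: "(\<lambda>n. \<integral>t. f1 t * K n t \<partial>lborel) \<longlonglongrightarrow> 2 * pi * f x"
    by (simp only: p1)
  \<comment> \<open>For \<open>\<bar>t - x\<bar> \<ge> 1\<close> the exponent is split into halves: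
    one half, estimated at distance 1, gives the decaying factor in \<open>c n\<close>, and the
    other is at least the exponent of the Gaussian in \<open>G\<close>, which does not depend on
    \<open>n\<close>.\<close>
  define c where "c n = sqrt (pi * Suc n) * exp (- real (Suc n) / 8)" for n
  define G where "G t = cmod (f t) * cmod (complex_of_real (gauss (1/8) (t - x)))" for t
  have G: "integrable lborel G"
    unfolding G_def[abs_def] by (intro L2_mult_integrable(2) f gauss_L2) simp
  have bound: "cmod (\<integral>t. f2 t * K n t \<partial>lborel) \<le> c n * (\<integral>t. G t \<partial>lborel)" for n
  proof -
    have "cmod (\<integral>t. f2 t * K n t \<partial>lborel) \<le> (\<integral>t. cmod (f2 t * K n t) \<partial>lborel)"
      by (rule integral_norm_bound)
    also have "\<dots> \<le> (\<integral>t. c n * G t \<partial>lborel)"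
    proof (rule integral_mono)
      show "integrable lborel (\<lambda>t. cmod (f2 t * K n t))"
        using L2_mult_integrable(1)[OF L1(2) K2] by (rule integrable_norm)
      show "integrable lborel (\<lambda>t. c n * G t)" using G by simp
      fix t
      show "cmod (f2 t * K n t) \<le> c n * G t"
      proof (cases "t \<in> {x-1..x+1}")
        case True
        then show ?thesis by (auto simp: f2_def c_def G_def)
      next
        case False
        then have "\<bar>t - x\<bar> \<ge> 1" by auto
        then have y: "(t - x)\<^sup>2 \<ge> 1" using abs_le_square_iff[of 1 "t - x"] by simp
        define y where "y = (t - x)\<^sup>2"
        have "real (Suc n) / 4 * y = real (Suc n) * y / 8 + real (Suc n) * y / 8" by simp
        also have "\<dots> \<ge> real (Suc n) * 1 / 8 + 1 * y / 8"
          using y by (intro add_mono divide_right_mono mult_left_mono mult_right_mono) (auto simp: y_def)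
        finally have "- (real (Suc n) / 4 * y) \<le> - real (Suc n) / 8 + - (y / 8)"
          by linarith
        then have "exp (- (real (Suc n) / 4 * y)) \<le> exp (- real (Suc n) / 8 + - (y / 8))"
          by (simp only: exp_le_cancel_iff)
        then have "gauss (Suc n / 4) (t - x) \<le> exp (- real (Suc n) / 8) * gauss (1/8) (t - x)"
          unfolding exp_add by (simp add: gauss_def y_def)
        then have "cmod (K n t) \<le> c n * gauss (1/8) (t - x)"
          unfolding K_def c_def norm_of_real
          by (simp add: abs_mult mult.assoc mult_left_mono)
        then have "cmod (f t) * cmod (K n t) \<le> cmod (f t) * (c n * gauss (1/8) (t - x))"
          by (intro mult_left_mono) auto
        then show ?thesis using False by (simp add: f2_def G_def norm_mult mult_ac)
      qed
    qed
    finally show ?thesis by simp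
  qed
  have "(\<lambda>n. c n) \<longlonglongrightarrow> 0" unfolding c_def by real_asymp
  then have "(\<lambda>n. c n * (\<integral>t. G t \<partial>lborel)) \<longlonglongrightarrow> 0" by (rule tendsto_mult_left_zero)
  with bound have part2: "(\<lambda>n. \<integral>t. f2 t * K n t \<partial>lborel) \<longlonglongrightarrow> 0"
    by (intro Lim_null_comparison[of "\<lambda>n. \<integral>t. f2 t * K n t \<partial>lborel"]) auto
  show ?thesis
    using tendsto_add[OF part1 part2] unfolding split[symmetric] by (simp add: K_def)
qed

text \<open>Insert the factor \<open>gauss (1 / Suc n) u\<close>. The multiplication formula turns
  the integral into a Gaussian mean of \<open>f\<close>, which tends to \<open>2 * pi * f x\<close>
  by continuity; integrability of the transform allows the factor to be removed by dominated
  convergence.\<close>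

theorem fourier_L2_inversion:
  assumes f: "f \<in> L2 lborel" and cont: "continuous_on UNIV f" and int: "integrable lborel (fourier_L2 f)"
  shows "f x = 1 / (2 * pi) * (\<integral>u. fourier_L2 f u * cis (x * u) \<partial>lborel)"
proof -
  note [measurable] = borel_measurable_integrable[OF int]
  have "(\<lambda>n. \<integral>u. fourier_L2 f u * (of_real (gauss (1 / Suc n) u) * cis (x * u)) \<partial>lborel) \<longlonglongrightarrow> 2 * pi * f x"
  proof -
    have "(\<integral>u. fourier_L2 f u * (of_real (gauss (1 / Suc n) u) * cis (x * u)) \<partial>lborel)
       = (\<integral>t. f t * of_real (sqrt (pi * Suc n) * gauss (Suc n / 4) (t - x)) \<partial>lborel)" for n
    proof -
      have n: "1 / real (Suc n) > 0" by simp
      have i1: "integrable lborel (\<lambda>u. complex_of_real (gauss (1 / Suc n) u) * cis (x * u))"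
        by (rule Bochner_Integration.integrable_bound[OF gauss_fourier_scaled(1)[OF n]]) (auto simp: norm_mult)
      have i2: "(\<lambda>u. complex_of_real (gauss (1 / Suc n) u) * cis (x * u)) \<in> L2 lborel"
        by (rule L2_bound(1)[OF _ gauss_L2[OF n, of 0], of _ 1]) (auto simp: norm_mult)
      show ?thesis
        unfolding fourier_L2_mult_formula[OF f i1 i2] gauss_cis_fourier[OF n] by simp
    qed
    then show ?thesis using gauss_approximate_identity[OF f cont, of x] by simp
  qed
  moreover have "(\<lambda>n. \<integral>u. fourier_L2 f u * (of_real (gauss (1 / Suc n) u) * cis (x * u)) \<partial>lborel)
      \<longlonglongrightarrow> (\<integral>u. fourier_L2 f u * cis (x * u) \<partial>lborel)"
  proof (rule integral_dominated_convergence[OF _ _ integrable_norm[OF int]])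
    show "AE u in lborel. cmod (fourier_L2 f u * (of_real (gauss (1 / Suc n) u) * cis (x * u))) \<le> cmod (fourier_L2 f u)" for n
      using mult_left_mono[OF gauss_le_1[of "1 / Suc n"]] by (auto simp: norm_mult)
    show "AE u in lborel. (\<lambda>n. fourier_L2 f u * (of_real (gauss (1 / Suc n) u) * cis (x * u))) \<longlonglongrightarrow> fourier_L2 f u * cis (x * u)"
    proof (intro AE_I2)
      fix u :: real
      have "(\<lambda>n. 1 / real (Suc n)) \<longlonglongrightarrow> 0"
        using LIMSEQ_inverse_real_of_nat by (simp add: inverse_eq_divide)
      then have "(\<lambda>n. fourier_L2 f u * (complex_of_real (gauss (1 / Suc n) u) * cis (x * u)))
          \<longlonglongrightarrow> fourier_L2 f u * (of_real (exp (- 0 * u\<^sup>2)) * cis (x * u))"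
        unfolding gauss_def by (intro tendsto_intros)
      then show "(\<lambda>n. fourier_L2 f u * (complex_of_real (gauss (1 / Suc n) u) * cis (x * u))) \<longlonglongrightarrow> fourier_L2 f u * cis (x * u)"
        by simp
    qed
  qed measurable
  ultimately have "2 * pi * f x = (\<integral>u. fourier_L2 f u * cis (x * u) \<partial>lborel)"
    by (rule LIMSEQ_unique)
  then show ?thesis by (simp add: field_simps)
qed

section \<open>Coercive operators and Riesz bases\<close>

text \<open>The Lax-Milgram argument as a damped iteration: each correction is \<open>tau\<close>
  times the residual, so residuals are mapped by the identity minus \<open>tau\<close> times
  \<open>A\<close>, which coercivity makes a strict contraction for a suitable
  \<open>tau\<close>.\<close>

theorem coercive_surj:
  fixes A :: "('a \<Rightarrow> complex) \<Rightarrow> 'a \<Rightarrow> complex"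
  assumes sf: "sigma_finite_measure M" and "m > 0"
    and A: "\<And>f. f \<in> L2 M \<Longrightarrow> A f \<in> L2 M" and bd: "\<And>f. f \<in> L2 M \<Longrightarrow> L2norm M (A f) \<le> K * L2norm M f"
    and lin: "\<And>f g c d t. f \<in> L2 M \<Longrightarrow> g \<in> L2 M \<Longrightarrow> A (\<lambda>t. c * f t + d * g t) t = c * A f t + d * A g t"
    and coercive: "\<And>f. f \<in> L2 M \<Longrightarrow> m * (L2norm M f)\<^sup>2 \<le> Re (\<integral>t. A f t * cnj (f t) \<partial>M)"
    and b: "b \<in> L2 M"
  shows "\<exists>a\<in>L2 M. AE t in M. A a t = b t"
proof -
  \<comment> \<open>Enlarging the norm bound to at least \<open>m\<close> makes it positive and
    keeps the radicand in \<open>rho\<close> between 0 and 1.\<close>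
  define L where "L = max K m"
  have bd: "L2norm M (A f) \<le> L * L2norm M f" if "f \<in> L2 M" for f
    using bd[OF that] mult_right_mono[of K L "L2norm M f"] by (auto simp: L_def)
  have L: "L \<ge> m" "L > 0" using \<open>m > 0\<close> by (auto simp: L_def)
  \<comment> \<open>The minimiser of \<open>1 - 2 * tau * m + tau\<^sup>2 * L\<^sup>2\<close>, which
    bounds the squared contraction factor; the minimum is
    \<open>1 - m\<^sup>2 / L\<^sup>2\<close>.\<close>
  define tau where "tau = m / L\<^sup>2"
  define rho where "rho = sqrt (1 - m\<^sup>2 / L\<^sup>2)"
  have tau: "tau > 0" using L \<open>m > 0\<close> by (simp add: tau_def)
  have "0 < m\<^sup>2 / L\<^sup>2" "m\<^sup>2 / L\<^sup>2 \<le> 1"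
    using L \<open>m > 0\<close> by (auto simp: power_mono)
  then have rho: "0 \<le> rho" "rho < 1" "rho\<^sup>2 = 1 - m\<^sup>2 / L\<^sup>2" by (auto simp: rho_def)
  define a where "a = rec_nat (\<lambda>t. 0) (\<lambda>_ a t. a t + of_real tau * (b t - A a t))"
  define r where "r n t = b t - A (a n) t" for n t
  have a0: "a 0 = (\<lambda>t. 0)" and aS: "a (Suc n) = (\<lambda>t. a n t + of_real tau * r n t)" for n
    by (auto simp: a_def r_def)
  have a2: "a n \<in> L2 M" for n
    by (induction n) (auto simp: a0 aS r_def intro!: L2_add L2_cmult L2_diff A b)
  have r2: "r n \<in> L2 M" for n
    unfolding r_def[abs_def] by (intro L2_diff A a2 b)
  have rS: "r (Suc n) = (\<lambda>t. r n t - of_real tau * A (r n) t)" for n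
    using lin[OF a2 r2, of 1 n "of_real tau" n] by (auto simp: r_def aS[of n])
  have step: "L2norm M (r (Suc n)) \<le> rho * L2norm M (r n)" for n
  proof -
    note R = r2[of n] and S = A[OF r2[of n]]
    have eq: "(cmod (z - of_real tau * w))\<^sup>2 = (cmod z)\<^sup>2 - 2 * tau * Re (w * cnj z) + tau\<^sup>2 * (cmod w)\<^sup>2" for z w
      unfolding cmod_power2 by (simp add: power2_eq_square algebra_simps)
    have ip: "integrable M (\<lambda>t. A (r n) t * cnj (r n t))"
      by (rule L2_mult_integrable(1)[OF S L2_cnj(1)[OF R]])
    have "(L2norm M (r (Suc n)))\<^sup>2 = (\<integral>t. (cmod (r n t))\<^sup>2 - 2 * tau * Re (A (r n) t * cnj (r n t)) + tau\<^sup>2 * (cmod (A (r n) t))\<^sup>2 \<partial>M)"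
      unfolding rS L2norm_power2 eq ..
    also have "\<dots> = (L2norm M (r n))\<^sup>2 - 2 * tau * Re (\<integral>t. A (r n) t * cnj (r n t) \<partial>M) + tau\<^sup>2 * (L2norm M (A (r n)))\<^sup>2"
      unfolding L2norm_power2 integral_Re[OF ip, symmetric]
      using L2_integrable[OF R] L2_integrable[OF S] integrable_Re[OF ip] by simp
    also have "\<dots> \<le> (L2norm M (r n))\<^sup>2 - 2 * tau * (m * (L2norm M (r n))\<^sup>2) + tau\<^sup>2 * (L * L2norm M (r n))\<^sup>2"
      using tau by (intro add_mono diff_mono mult_left_mono coercive r2 power_mono bd order_refl) auto
    also have "\<dots> = (1 - m\<^sup>2 / L\<^sup>2) * (L2norm M (r n))\<^sup>2"
      using L by (simp add: tau_def field_simps power2_eq_square)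
    also have "\<dots> = (rho * L2norm M (r n))\<^sup>2"
      by (simp add: rho power_mult_distrib)
    finally show ?thesis by (rule power2_le_imp_le) (simp add: rho)
  qed
  define b0 where "b0 = L2norm M (r 0)"
  have rn: "L2norm M (r n) \<le> b0 * rho ^ n" for n
  proof (induction n)
    case (Suc n)
    have "L2norm M (r (Suc n)) \<le> rho * (b0 * rho ^ n)"
      using step[of n] mult_left_mono[OF Suc rho(1)] by linarith
    then show ?case by (simp add: mult_ac)
  qed (simp add: b0_def)
  \<comment> \<open>With this constant the bound \<open>tau * b0 * rho ^ n\<close> on a single step
    equals \<open>C * (rho ^ n - rho ^ Suc n)\<close>, so the steps telescope.\<close>
  define C where "C = tau * b0 / (1 - rho)"
  have b0: "b0 \<ge> 0" by (simp add: b0_def)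
  have C: "C \<ge> 0" using tau rho b0 by (simp add: C_def)
  have diff: "L2norm M (\<lambda>t. a (n + k) t - a n t) \<le> C * (rho ^ n - rho ^ (n + k))" for n k
  proof (induction k)
    case 0
    then show ?case by (simp add: L2norm_def)
  next
    case (Suc k)
    have "L2norm M (\<lambda>t. a (n + Suc k) t - a (n + k) t) = tau * L2norm M (r (n + k))"
      using L2_cmult(2)[OF r2[of "n + k"], of "of_real tau"] tau by (simp add: aS)
    also have "\<dots> \<le> tau * (b0 * rho ^ (n + k))" using tau rn by (simp add: mult_left_mono)
    also have "\<dots> = C * (rho ^ (n + k) - rho ^ (n + Suc k))"
      using rho by (simp add: C_def field_simps)
    finally show ?case
      using L2norm_triangle[OF a2[of "n + Suc k"] a2[of "n + k"] a2[of n]] Suc by (simp add: algebra_simps)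
  qed
  have diff': "L2norm M (\<lambda>t. a i t - a j t) \<le> C * rho ^ N" if "i \<ge> N" "j \<ge> N" for i j N
  proof -
    have *: "L2norm M (\<lambda>t. a i t - a j t) \<le> C * rho ^ N" if "N \<le> j" "j \<le> i" for i j
    proof -
      have "C * (rho ^ j - rho ^ i) \<le> C * rho ^ j" using C rho by (intro mult_left_mono) auto
      also have "\<dots> \<le> C * rho ^ N" using C rho that by (intro mult_left_mono power_decreasing) auto
      finally show ?thesis using diff[of j "i - j"] that by simp
    qed
    show ?thesis
    proof (cases "j \<le> i")
      case False
      then show ?thesis using *[of i j] that by (subst L2norm_minus_commute) simp
    qed (use * that in auto)
  qed
  have geo: "(\<lambda>N. C * rho ^ N) \<longlonglongrightarrow> 0"
    by (intro tendsto_mult_right_zero LIMSEQ_realpow_zero rho)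
  have "\<exists>f\<in>L2 M. (\<lambda>n. L2norm M (\<lambda>t. a n t - f t)) \<longlonglongrightarrow> 0"
  proof (rule L2_complete[OF sf a2])
    fix e :: real assume "e > 0"
    then have "\<forall>\<^sub>F N in sequentially. C * rho ^ N < e" using order_tendstoD(2)[OF geo] by simp
    then obtain N where "C * rho ^ N < e" by (auto simp: eventually_sequentially)
    then show "\<exists>N. \<forall>m\<ge>N. \<forall>n\<ge>N. L2norm M (\<lambda>t. a m t - a n t) < e"
      using diff' by (intro exI[of _ N]) (auto intro: le_less_trans)
  qed
  then obtain f where f: "f \<in> L2 M" and lim: "(\<lambda>n. L2norm M (\<lambda>t. a n t - f t)) \<longlonglongrightarrow> 0" by blast
  have "AE t in M. A f t = b t"
  proof (rule L2_limit_unique[OF A[OF f] b A[OF a2]])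
    have "L2norm M (\<lambda>t. A (a n) t - A f t) \<le> L * L2norm M (\<lambda>t. a n t - f t)" for n
    proof -
      have "(\<lambda>t. A (a n) t - A f t) = A (\<lambda>t. a n t - f t)"
        using lin[OF a2[of n] f, of 1 "-1"] by auto
      then show ?thesis using bd[OF L2_diff(1)[OF a2[of n] f]] by simp
    qed
    then show "(\<lambda>n. L2norm M (\<lambda>t. A (a n) t - A f t)) \<longlonglongrightarrow> 0"
      by (rule L2norm_tendsto_0) (intro tendsto_mult_right_zero lim)
    have "L2norm M (\<lambda>t. A (a n) t - b t) \<le> b0 * rho ^ n" for n
      using rn[of n] L2norm_minus_commute[of M "A (a n)" b] by (simp add: r_def[abs_def])
    then show "(\<lambda>n. L2norm M (\<lambda>t. A (a n) t - b t)) \<longlonglongrightarrow> 0"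
      by (rule L2norm_tendsto_0) (intro tendsto_mult_right_zero LIMSEQ_realpow_zero rho)
  qed
  with f show ?thesis by blast
qed

section \<open>Square-summable sequences, Riesz bounds and separation\<close>

abbreviation CZ :: "int measure" where "CZ \<equiv> count_space UNIV"

lemma sigma_finite_CZ: "sigma_finite_measure CZ"
  by (rule sigma_finite_measure_count_space)

lemma CZ_has_sum:
  fixes f :: "int \<Rightarrow> complex"
  assumes "integrable CZ f"
  shows "(f has_sum (\<integral>j. f j \<partial>CZ)) UNIV"
proof -
  have s: "Infinite_Set_Sum.abs_summable_on f UNIV"
    using assms by (simp add: Infinite_Set_Sum.abs_summable_on_def)
  then have "f summable_on UNIV"
    using abs_summable_equivalent[of f UNIV] abs_summable_summable by blast
  moreover have "infsum f UNIV = (\<integral>j. f j \<partial>CZ)"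
    using infsetsum_infsum[OF s] by (simp add: infsetsum_def)
  ultimately show ?thesis by (metis has_sum_infsum)
qed

text \<open>Makes the results on L2 of a general measure, among them truncation, the Schur test and
  coercive surjectivity, applicable to coefficient sequences.\<close>

lemma square_summable_iff: "square_summable a \<longleftrightarrow> a \<in> L2 CZ"
proof -
  have "square_summable a \<longleftrightarrow> Infinite_Sum.abs_summable_on (\<lambda>j. (cmod (a j))\<^sup>2) UNIV"
    by (simp add: square_summable_def)
  also have "\<dots> \<longleftrightarrow> a \<in> L2 CZ"
    unfolding abs_summable_equivalent Infinite_Set_Sum.abs_summable_on_def by (auto simp: L2_def)
  finally show ?thesis .
qed

lemma infsum_square: "a \<in> L2 CZ \<Longrightarrow> infsum (\<lambda>j. (cmod (a j))\<^sup>2) UNIV = (L2norm CZ a)\<^sup>2"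
  using infsetsum_infsum[of "\<lambda>j. (cmod (a j))\<^sup>2" UNIV]
  by (simp add: L2_def L2norm_power2 infsetsum_def Infinite_Set_Sum.abs_summable_on_def)

lemma L2_CZ_eq_0:
  assumes "a \<in> L2 CZ" "L2norm CZ a = 0" shows "a j = 0"
  using L2norm_eq_0[OF assms] by (simp add: AE_count_space)

lemma L2_CZ_bounded_sums:
  assumes "\<And>J. finite J \<Longrightarrow> (\<Sum>j\<in>J. (cmod (a j))\<^sup>2) \<le> C\<^sup>2" "C \<ge> 0"
  shows "a \<in> L2 CZ" "L2norm CZ a \<le> C"
proof -
  have s: "(\<lambda>j. (cmod (a j))\<^sup>2) summable_on UNIV"
    by (rule nonneg_bdd_above_summable_on) (auto simp: bdd_above_def intro!: exI[of _ "C\<^sup>2"] assms)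
  then show a: "a \<in> L2 CZ" using square_summable_iff square_summable_def by blast
  have "(L2norm CZ a)\<^sup>2 \<le> C\<^sup>2"
    unfolding infsum_square[OF a, symmetric] by (rule infsum_le_finite_sums[OF s]) (use assms in auto)
  then show "L2norm CZ a \<le> C" using \<open>C \<ge> 0\<close> by (rule power2_le_imp_le)
qed

text \<open>The symmetric window matches the partial sums prescribed by
  \<open>has_L2_sum\<close>.\<close>

definition cut :: "nat \<Rightarrow> (int \<Rightarrow> complex) \<Rightarrow> int \<Rightarrow> complex" where
  "cut N a j = a j * indicator {- int N..int N} j"

lemma cut_L2:
  assumes a: "a \<in> L2 CZ"
  shows "cut N a \<in> L2 CZ" "(\<lambda>N. L2norm CZ (\<lambda>j. cut N a j - a j)) \<longlonglongrightarrow> 0"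
proof -
  have ev: "\<forall>\<^sub>F N in sequentially. j \<in> {- int N..int N}" for j
    unfolding eventually_sequentially by (intro exI[of _ "nat \<bar>j\<bar>"]) auto
  show "cut N a \<in> L2 CZ" "(\<lambda>N. L2norm CZ (\<lambda>j. cut N a j - a j)) \<longlonglongrightarrow> 0"
    unfolding cut_def[abs_def] using L2_truncation[OF a, of "\<lambda>N. {- int N..int N}"] ev by auto
qed

lemma integral_CZ_finite:
  fixes f :: "int \<Rightarrow> complex"
  assumes "finite J" "\<And>j. j \<notin> J \<Longrightarrow> f j = 0"
  shows "integrable CZ f" "(\<integral>j. f j \<partial>CZ) = (\<Sum>j\<in>J. f j)"
proof -
  have s: "{j. f j \<noteq> 0} \<subseteq> J" using assms by auto
  then have fin: "finite {j. f j \<noteq> 0}" using assms finite_subset by blast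
  have "Infinite_Set_Sum.abs_summable_on f UNIV"
    using abs_summable_on_cong_neutral[of J UNIV f f] assms by (auto intro: abs_summable_on_finite)
  then show "integrable CZ f" by (simp add: Infinite_Set_Sum.abs_summable_on_def)
  have "(\<integral>j. f j \<partial>CZ) = (\<Sum>j | f j \<noteq> 0. f j)"
    using lebesgue_integral_count_space_finite_support[of UNIV f] fin by simp
  also have "\<dots> = (\<Sum>j\<in>J. f j)" using s assms by (intro sum.mono_neutral_left) auto
  finally show "(\<integral>j. f j \<partial>CZ) = (\<Sum>j\<in>J. f j)" .
qed

lemma L2_CZ_finite:
  assumes "finite J" "\<And>j. j \<notin> J \<Longrightarrow> a j = 0"
  shows "a \<in> L2 CZ" "(L2norm CZ a)\<^sup>2 = (\<Sum>j\<in>J. (cmod (a j))\<^sup>2)"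
proof -
  have i: "integrable CZ (\<lambda>j. complex_of_real ((cmod (a j))\<^sup>2))"
    "(\<integral>j. complex_of_real ((cmod (a j))\<^sup>2) \<partial>CZ) = (\<Sum>j\<in>J. complex_of_real ((cmod (a j))\<^sup>2))"
    using integral_CZ_finite[OF assms(1), of "\<lambda>j. complex_of_real ((cmod (a j))\<^sup>2)"] assms(2) by auto
  show "a \<in> L2 CZ" by (intro L2I i(1)[unfolded complex_of_real_integrable_eq]) simp
  from i(2) have "complex_of_real (\<integral>j. (cmod (a j))\<^sup>2 \<partial>CZ) = of_real (\<Sum>j\<in>J. (cmod (a j))\<^sup>2)"
    unfolding integral_complex_of_real by simp
  then show "(L2norm CZ a)\<^sup>2 = (\<Sum>j\<in>J. (cmod (a j))\<^sup>2)"
    unfolding L2norm_power2 of_real_eq_iff .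
qed

text \<open>For finitely supported coefficients the symmetric partial sums are eventually constant,
  so the limit supplied by the definition agrees in norm with the explicit finite sum, and both
  bounds transfer to it.\<close>

lemma riesz_basis_finite_sums:
  assumes "riesz_basis M e"
  shows "\<exists>B>0. \<forall>J c. finite J \<longrightarrow>
    inverse B * sqrt (\<Sum>j\<in>J. (cmod (c j))\<^sup>2) \<le> L2norm M (\<lambda>t. \<Sum>j\<in>J. c j * e j t) \<and>
    L2norm M (\<lambda>t. \<Sum>j\<in>J. c j * e j t) \<le> B * sqrt (\<Sum>j\<in>J. (cmod (c j))\<^sup>2)"
proof -
  obtain B where B: "B > 0" "\<And>c. square_summable c \<Longrightarrow>
        \<exists>s. has_L2_sum M (\<lambda>j t. c j * e j t) s \<and>
             inverse B * sqrt (infsum (\<lambda>j. (cmod (c j))\<^sup>2) UNIV) \<le> L2norm M s \<and>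
             L2norm M s \<le> B * sqrt (infsum (\<lambda>j. (cmod (c j))\<^sup>2) UNIV)"
    and e: "\<And>j. e j \<in> L2 M"
    using assms unfolding riesz_basis_def by blast
  have "inverse B * sqrt (\<Sum>j\<in>J. (cmod (c j))\<^sup>2) \<le> L2norm M (\<lambda>t. \<Sum>j\<in>J. c j * e j t) \<and>
    L2norm M (\<lambda>t. \<Sum>j\<in>J. c j * e j t) \<le> B * sqrt (\<Sum>j\<in>J. (cmod (c j))\<^sup>2)" if J: "finite J" for J c
  proof -
    define c' where "c' j = c j * indicator J j" for j
    have c': "c' \<in> L2 CZ" "(L2norm CZ c')\<^sup>2 = (\<Sum>j\<in>J. (cmod (c j))\<^sup>2)"
      using L2_CZ_finite[OF J, of c'] by (auto simp: c'_def)
    define p where "p t = (\<Sum>j\<in>J. c j * e j t)" for t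
    have p: "p \<in> L2 M" unfolding p_def[abs_def] by (intro L2_sum L2_cmult e)
    obtain s where s: "has_L2_sum M (\<lambda>j t. c' j * e j t) s"
      "inverse B * sqrt (\<Sum>j\<in>J. (cmod (c j))\<^sup>2) \<le> L2norm M s" "L2norm M s \<le> B * sqrt (\<Sum>j\<in>J. (cmod (c j))\<^sup>2)"
      using B(2)[of c'] c' infsum_square[OF c'(1)] by (auto simp: square_summable_iff)
    have s2: "s \<in> L2 M" and lim: "(\<lambda>N::nat. L2norm M (\<lambda>t. s t - (\<Sum>j\<in>{- int N..int N}. c' j * e j t))) \<longlonglongrightarrow> 0"
      using s(1) by (auto simp: has_L2_sum_def)
    obtain N0 where N0: "\<And>j. j \<in> J \<Longrightarrow> nat \<bar>j\<bar> \<le> N0"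
      using finite_nat_set_iff_bounded_le[of "(\<lambda>j. nat \<bar>j\<bar>) ` J"] J by auto
    have "(\<Sum>j\<in>{- int N..int N}. c' j * e j t) = p t" if "N \<ge> N0" for N t
    proof -
      have "J \<subseteq> {- int N..int N}" using N0 that by fastforce
      then have "(\<Sum>j\<in>{- int N..int N}. c' j * e j t) = (\<Sum>j\<in>J. c' j * e j t)"
        by (intro sum.mono_neutral_right) (auto simp: c'_def)
      then show ?thesis by (simp add: c'_def p_def)
    qed
    then have "\<forall>\<^sub>F N::nat in sequentially. L2norm M (\<lambda>t. s t - (\<Sum>j\<in>{- int N..int N}. c' j * e j t)) = L2norm M (\<lambda>t. s t - p t)"
      unfolding eventually_sequentially by (intro exI[of _ N0]) auto
    from Lim_transform_eventually[OF lim this] have "L2norm M (\<lambda>t. s t - p t) = 0"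
      by (simp add: LIMSEQ_const_iff)
    then have "L2norm M s = L2norm M p" using L2norm_reverse_triangle[OF s2 p] by simp
    with s show ?thesis by (simp add: p_def[abs_def])
  qed
  with B(1) show ?thesis by blast
qed

text \<open>The inner products with \<open>e\<close> form the adjoint of the synthesis map, so they
  inherit its bound. Pairing \<open>h\<close> with the sum whose coefficients are these inner
  products gives \<open>S \<le> B * L2norm M h * sqrt S\<close> for their sum of squares
  \<open>S\<close>.\<close>

lemma Bessel:
  assumes e: "\<And>j. e j \<in> L2 M" and "B > 0"
    and up: "\<And>J c. finite J \<Longrightarrow> L2norm M (\<lambda>t. \<Sum>j\<in>J. c j * e j t) \<le> B * sqrt (\<Sum>j\<in>J. (cmod (c j))\<^sup>2)"
    and h: "h \<in> L2 M"
  shows "(\<lambda>j. \<integral>t. h t * cnj (e j t) \<partial>M) \<in> L2 CZ"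
    "L2norm CZ (\<lambda>j. \<integral>t. h t * cnj (e j t) \<partial>M) \<le> B * L2norm M h"
proof -
  define c where "c j = (\<integral>t. h t * cnj (e j t) \<partial>M)" for j
  have *: "(\<Sum>j\<in>J. (cmod (c j))\<^sup>2) \<le> (B * L2norm M h)\<^sup>2" if J: "finite J" for J
  proof -
    define S where "S = (\<Sum>j\<in>J. (cmod (c j))\<^sup>2)"
    define p where "p t = (\<Sum>j\<in>J. c j * e j t)" for t
    have p: "p \<in> L2 M" unfolding p_def[abs_def] by (intro L2_sum L2_cmult e)
    have S0: "S \<ge> 0" by (auto simp: S_def intro: sum_nonneg)
    have "(\<integral>t. h t * cnj (p t) \<partial>M) = (\<integral>t. (\<Sum>j\<in>J. cnj (c j) * (h t * cnj (e j t))) \<partial>M)"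
      by (simp add: p_def sum_distrib_left mult_ac)
    also have "\<dots> = (\<Sum>j\<in>J. \<integral>t. cnj (c j) * (h t * cnj (e j t)) \<partial>M)"
      by (intro Bochner_Integration.integral_sum integrable_mult_right L2_mult_integrable(1) h L2_cnj(1) e)
    also have "\<dots> = (\<Sum>j\<in>J. cnj (c j) * c j)"
      unfolding integral_mult_right_zero c_def[symmetric] ..
    also have "\<dots> = of_real S"
      by (simp add: S_def complex_norm_square mult_ac del: of_real_power)
    finally have "S = cmod (\<integral>t. h t * cnj (p t) \<partial>M)" using S0 by simp
    also have "\<dots> \<le> L2norm M h * L2norm M p"
      using L2_Cauchy_Schwarz(2)[OF h L2_cnj(1)[OF p]] by (simp add: L2_cnj)
    also have "\<dots> \<le> L2norm M h * (B * sqrt S)"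
      using up[OF J, of c] unfolding p_def[abs_def] S_def by (intro mult_left_mono) auto
    finally have le: "S \<le> B * L2norm M h * sqrt S" by (simp add: mult_ac)
    have "sqrt S \<le> B * L2norm M h"
    proof (cases "S = 0")
      case False
      then have "0 < sqrt S" "sqrt S * sqrt S \<le> B * L2norm M h * sqrt S" using le S0 by simp_all
      then show ?thesis by (rule mult_right_le_imp_le[rotated])
    qed (use \<open>B > 0\<close> in auto)
    then have "(sqrt S)\<^sup>2 \<le> (B * L2norm M h)\<^sup>2" using S0 by (intro power_mono) auto
    then show ?thesis using S0 by (simp add: S_def[symmetric])
  qed
  have "B * L2norm M h \<ge> 0" using \<open>B > 0\<close> by simp
  from L2_CZ_bounded_sums[OF * this]
  show "(\<lambda>j. \<integral>t. h t * cnj (e j t) \<partial>M) \<in> L2 CZ"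
    "L2norm CZ (\<lambda>j. \<integral>t. h t * cnj (e j t) \<partial>M) \<le> B * L2norm M h"
    by (auto simp: c_def)
qed

lemma L2_const_restrict: "(\<lambda>_. c) \<in> L2 (restrict_space lborel {a..b::real})"
proof (intro L2I)
  have "integrable lborel (indicator {a..b} :: real \<Rightarrow> real)"
    by (intro integrable_real_indicator) (auto simp: emeasure_lborel_Icc_eq)
  then show "integrable (restrict_space lborel {a..b}) (\<lambda>t. (cmod c)\<^sup>2)"
    by (simp add: integrable_restrict_space)
qed simp

lemma cis_dist: "cmod (cis a - cis b) \<le> \<bar>a - b\<bar>"
proof -
  have "cis a - cis b = cis b * (cis (a - b) - 1)" by (simp add: algebra_simps cis_mult)
  then have "cmod (cis a - cis b) = cmod (cis (a - b) - 1)" by (simp add: norm_mult)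
  also have "\<dots> = 2 * \<bar>sin ((a - b) / 2)\<bar>"
    using dist_exp_i_1[of "a - b"] by (simp add: dist_norm cis_conv_exp)
  also have "\<dots> \<le> 2 * \<bar>(a - b) / 2\<bar>" using abs_sin_x_le_abs_x[of "(a - b) / 2"] by simp
  finally show ?thesis by simp
qed

text \<open>Nearby frequencies give nearly equal exponentials on [-pi, pi], while the lower Riesz
  bound keeps the difference of two distinct basis elements away from 0.\<close>

lemma riesz_basis_sequence_separated:
  assumes "riesz_basis_sequence x"
  shows "\<exists>q>0. \<forall>j k. j \<noteq> k \<longrightarrow> q \<le> \<bar>x j - x k\<bar>"
proof -
  define M where "M = restrict_space lborel {-pi..pi}"
  have "riesz_basis M (\<lambda>j t. cis (- (x j * t)))"
    using assms by (simp add: riesz_basis_sequence_def M_def)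
  from riesz_basis_finite_sums[OF this] obtain B where B: "B > 0"
    and "\<forall>J c. finite J \<longrightarrow> inverse B * sqrt (\<Sum>j\<in>J. (cmod (c j))\<^sup>2)
      \<le> L2norm M (\<lambda>t. \<Sum>j\<in>J. c j * cis (- (x j * t))) \<and>
      L2norm M (\<lambda>t. \<Sum>j\<in>J. c j * cis (- (x j * t))) \<le> B * sqrt (\<Sum>j\<in>J. (cmod (c j))\<^sup>2)"
    by (elim exE conjE)
  then have B': "inverse B * sqrt (\<Sum>j\<in>J. (cmod (c j))\<^sup>2)
      \<le> L2norm M (\<lambda>t. \<Sum>j\<in>J. c j * cis (- (x j * t)))" if "finite J" for J c
    using that by simp
  \<comment> \<open>The added 1 makes \<open>W\<close> positive, so that it can be divided by
    without computing the norm.\<close>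
  define W where "W = L2norm M (\<lambda>_. 1) + 1"
  have "W \<ge> 0 + 1" unfolding W_def by (intro add_mono) simp_all
  then have W: "W > 0" by simp
  define q where "q = inverse B / (pi * W)"
  have "q \<le> \<bar>x j - x k\<bar>" if "j \<noteq> k" for j k
  proof -
    define c :: "int \<Rightarrow> complex" where "c i = (if i = j then 1 else -1)" for i
    have "inverse B \<le> inverse B * sqrt 2" using B by simp
    also have "inverse B * sqrt 2 \<le> L2norm M (\<lambda>t. cis (- (x j * t)) - cis (- (x k * t)))"
      using B'[of "{j, k}" c] that by (simp add: c_def)
    also have "\<dots> \<le> (\<bar>x j - x k\<bar> * pi) * L2norm M (\<lambda>_. 1)"
    proof (rule L2_bound(2))
      show "AE t in M. cmod (cis (- (x j * t)) - cis (- (x k * t))) \<le> \<bar>x j - x k\<bar> * pi * cmod 1"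
      proof (intro AE_I2)
        fix t assume "t \<in> space M"
        then have t: "\<bar>t\<bar> \<le> pi" by (auto simp: M_def space_restrict_space)
        have "cmod (cis (- (x j * t)) - cis (- (x k * t))) \<le> \<bar>x j - x k\<bar> * \<bar>t\<bar>"
        proof -
          have "- (x j * t) - - (x k * t) = (x k - x j) * t" by (simp add: algebra_simps)
          then show ?thesis
            using cis_dist[of "- (x j * t)" "- (x k * t)"] by (simp add: abs_mult abs_minus_commute)
        qed
        also have "\<dots> \<le> \<bar>x j - x k\<bar> * pi" by (intro mult_left_mono t) auto
        finally show "cmod (cis (- (x j * t)) - cis (- (x k * t))) \<le> \<bar>x j - x k\<bar> * pi * cmod 1" by simp
      qed
      show "(\<lambda>_. 1) \<in> L2 M" unfolding M_def by (rule L2_const_restrict)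
      show "(\<lambda>t. cis (- (x j * t)) - cis (- (x k * t))) \<in> borel_measurable M"
        unfolding M_def by (intro measurable_restrict_space1) measurable
    qed simp
    also have "\<dots> \<le> (\<bar>x j - x k\<bar> * pi) * W" unfolding W_def by (intro mult_left_mono) auto
    finally have "inverse B \<le> \<bar>x j - x k\<bar> * (pi * W)" by (simp add: mult_ac)
    then show ?thesis using W by (simp add: q_def pos_divide_le_eq)
  qed
  moreover have "q > 0" using B W by (simp add: q_def)
  ultimately show ?thesis by blast
qed

section \<open>Sums of shifted Gaussians\<close>

locale separated =
  fixes x :: "int \<Rightarrow> real" and q :: real
  assumes q: "q > 0" and sep: "\<And>j k. j \<noteq> k \<Longrightarrow> q \<le> \<bar>x j - x k\<bar>"
begin

text \<open>The exponential is the cost of moving the centre by at most \<open>q\<close>, the square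
  root is the integral of the Gaussian with parameter \<open>mu / 2\<close>, and division by
  \<open>q\<close> takes the mean over an interval of that length.\<close>

definition gauss_bound :: "real \<Rightarrow> real" where
  "gauss_bound mu = exp (mu * q\<^sup>2) * sqrt (pi / (mu / 2)) / q"

lemma gauss_bound_pos: "mu > 0 \<Longrightarrow> gauss_bound mu > 0"
  using q by (simp add: gauss_bound_def)

text \<open>Each \<open>gauss mu (t - x j)\<close> is dominated by the mean of a wider Gaussian over
  \<open>{x j..<x j + q}\<close>, and these intervals are disjoint.\<close>

lemma gauss_sum_bound:
  assumes mu: "mu > 0"
  shows "(\<integral>\<^sup>+j. ennreal (gauss mu (t - x j)) \<partial>CZ) \<le> ennreal (gauss_bound mu)"
proof -
  define E where "E = exp (mu * q\<^sup>2)"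
  define I where "I j = {x j..<x j + q}" for j
  have [measurable]: "I j \<in> sets borel" for j by (simp add: I_def)
  have pt: "gauss mu (t - x j) \<le> E * gauss (mu / 2) (s - t)" if "s \<in> I j" for s j
  proof -
    define d where "d = s - x j"
    have d: "0 \<le> d" "d \<le> q" using that by (auto simp: I_def d_def)
    \<comment> \<open>The square of a sum is at most twice the sum of the squares; this factor 2 is
      why the comparison Gaussian has parameter \<open>mu / 2\<close>.\<close>
    have "(s - t)\<^sup>2 \<le> 2 * (t - x j)\<^sup>2 + 2 * d\<^sup>2"
      using zero_le_power2[of "t - x j + d"] unfolding d_def by (simp add: power2_eq_square algebra_simps)
    also have "d\<^sup>2 \<le> q\<^sup>2" using d by (rule power_mono[rotated])
    finally have "mu / 2 * (s - t)\<^sup>2 \<le> mu / 2 * (2 * (t - x j)\<^sup>2 + 2 * q\<^sup>2)"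
      using mu by (intro mult_left_mono) auto
    then have "- mu * (t - x j)\<^sup>2 \<le> mu * q\<^sup>2 + - (mu / 2) * (s - t)\<^sup>2"
      by (simp add: algebra_simps)
    then show ?thesis unfolding gauss_def E_def exp_add[symmetric] by simp
  qed
  have one: "ennreal q * ennreal (gauss mu (t - x j))
      \<le> (\<integral>\<^sup>+s. ennreal (E * gauss (mu / 2) (s - t)) * indicator (I j) s \<partial>lborel)" for j
  proof -
    have "ennreal q * ennreal (gauss mu (t - x j)) = (\<integral>\<^sup>+s. ennreal (gauss mu (t - x j)) * indicator (I j) s \<partial>lborel)"
      using q by (simp add: nn_integral_cmult_indicator I_def mult.commute)
    also have "\<dots> \<le> (\<integral>\<^sup>+s. ennreal (E * gauss (mu / 2) (s - t)) * indicator (I j) s \<partial>lborel)"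
      using pt by (intro nn_integral_mono) (auto simp: indicator_def intro!: ennreal_leI)
    finally show ?thesis .
  qed
  have disj: "(\<integral>\<^sup>+j. indicator (I j) s \<partial>CZ) \<le> 1" for s
  proof -
    \<comment> \<open>Two half-open intervals of length \<open>q\<close> sharing a point would have
      left ends less than \<open>q\<close> apart, so at most one index occurs; \<open>SOME\<close>
      names it whether or not it exists.\<close>
    have "{j. s \<in> I j} \<subseteq> {SOME j. s \<in> I j}"
    proof
      fix j assume "j \<in> {j. s \<in> I j}"
      then have "s \<in> I j" and some: "s \<in> I (SOME j. s \<in> I j)" by (auto intro: someI)
      then have "\<bar>x j - x (SOME j. s \<in> I j)\<bar> < q" by (auto simp: I_def)
      then show "j \<in> {SOME j. s \<in> I j}" using sep[of j "SOME j. s \<in> I j"] by force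
    qed
    then have "emeasure CZ {j. s \<in> I j} \<le> emeasure CZ {SOME j. s \<in> I j}"
      by (intro emeasure_mono) auto
    moreover have "(\<integral>\<^sup>+j. indicator (I j) s \<partial>CZ) = (\<integral>\<^sup>+j. indicator {j. s \<in> I j} j \<partial>CZ)"
      by (intro nn_integral_cong) (auto simp: indicator_def)
    ultimately show ?thesis by simp
  qed
  have "ennreal q * (\<integral>\<^sup>+j. ennreal (gauss mu (t - x j)) \<partial>CZ)
      = (\<integral>\<^sup>+j. ennreal q * ennreal (gauss mu (t - x j)) \<partial>CZ)"
    by (simp add: nn_integral_cmult)
  also have "\<dots> \<le> (\<integral>\<^sup>+j. (\<integral>\<^sup>+s. ennreal (E * gauss (mu / 2) (s - t)) * indicator (I j) s \<partial>lborel) \<partial>CZ)"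
    by (intro nn_integral_mono one)
  also have "\<dots> = (\<integral>\<^sup>+s. (\<integral>\<^sup>+j. ennreal (E * gauss (mu / 2) (s - t)) * indicator (I j) s \<partial>CZ) \<partial>lborel)"
    by (rule nn_integral_count_space_nn_integral[symmetric]) auto
  also have "\<dots> = (\<integral>\<^sup>+s. ennreal (E * gauss (mu / 2) (s - t)) * (\<integral>\<^sup>+j. indicator (I j) s \<partial>CZ) \<partial>lborel)"
    by (simp add: nn_integral_cmult)
  also have "\<dots> \<le> (\<integral>\<^sup>+s. ennreal (E * gauss (mu / 2) (s - t)) * 1 \<partial>lborel)"
    by (intro nn_integral_mono mult_left_mono disj) auto
  also have "\<dots> = ennreal E * ennreal (sqrt (pi / (mu / 2)))"
    using gauss_shift(3)[of "mu / 2" t] mu by (simp add: ennreal_mult E_def nn_integral_cmult)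
  also have "\<dots> = ennreal q * ennreal (gauss_bound mu)"
    using q mu by (simp add: gauss_bound_def E_def flip: ennreal_mult)
  finally show ?thesis
    using q by (simp add: ennreal_mult_le_mult_iff)
qed

text \<open>Written as an integral against counting measure with the kernel in front, which is
  literally the form in the Schur test.\<close>

definition shift_sum :: "real \<Rightarrow> (int \<Rightarrow> complex) \<Rightarrow> real \<Rightarrow> complex" where
  "shift_sum mu a t = (\<integral>j. of_real (gauss mu (t - x j)) * a j \<partial>CZ)"

lemma gauss_CZ:
  assumes mu: "mu > 0"
  shows "(\<lambda>j. complex_of_real (gauss mu (t - x j))) \<in> L2 CZ"
    "L2norm CZ (\<lambda>j. complex_of_real (gauss mu (t - x j))) \<le> sqrt (gauss_bound (2 * mu))"
proof -
  have *: "(\<integral>\<^sup>+j. ennreal ((cmod (complex_of_real (gauss mu (t - x j))))\<^sup>2) \<partial>CZ) \<le> ennreal ((sqrt (gauss_bound (2 * mu)))\<^sup>2)"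
    using gauss_sum_bound[of "2 * mu" t] gauss_bound_pos[of "2 * mu"] mu by (simp add: gauss_power2)
  show "(\<lambda>j. complex_of_real (gauss mu (t - x j))) \<in> L2 CZ"
    "L2norm CZ (\<lambda>j. complex_of_real (gauss mu (t - x j))) \<le> sqrt (gauss_bound (2 * mu))"
    using gauss_bound_pos[of "2 * mu"] mu by (intro L2_nn_integral[OF _ *]; simp)+
qed

lemma shift_sum_integrable:
  "mu > 0 \<Longrightarrow> a \<in> L2 CZ \<Longrightarrow> integrable CZ (\<lambda>j. of_real (gauss mu (t - x j)) * a j)"
  by (rule L2_mult_integrable(1)[OF gauss_CZ(1)])

lemma shift_sum_has_sum:
  assumes "mu > 0" "a \<in> L2 CZ"
  shows "((\<lambda>j. a j * of_real (gauss mu (t - x j))) has_sum shift_sum mu a t) UNIV"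
  using CZ_has_sum[OF shift_sum_integrable[OF assms]] by (simp add: shift_sum_def mult.commute)

text \<open>The bound does not depend on \<open>t\<close>, so convergence of coefficients in norm
  becomes uniform convergence of the series.\<close>

lemma shift_sum_pointwise:
  assumes "mu > 0" "a \<in> L2 CZ"
  shows "cmod (shift_sum mu a t) \<le> sqrt (gauss_bound (2 * mu)) * L2norm CZ a"
  using L2_Cauchy_Schwarz(2)[OF gauss_CZ(1)[OF assms(1)] assms(2)]
    mult_right_mono[OF gauss_CZ(2)[OF assms(1)] L2norm_nonneg]
  unfolding shift_sum_def by (rule order_trans)

lemma shift_sum_linear:
  assumes "mu > 0" "a \<in> L2 CZ" "b \<in> L2 CZ"
  shows "shift_sum mu (\<lambda>j. c * a j + d * b j) t = c * shift_sum mu a t + d * shift_sum mu b t"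
proof -
  have "shift_sum mu (\<lambda>j. c * a j + d * b j) t
     = (\<integral>j. c * (of_real (gauss mu (t - x j)) * a j) + d * (of_real (gauss mu (t - x j)) * b j) \<partial>CZ)"
    unfolding shift_sum_def by (simp add: algebra_simps)
  then show ?thesis using assms by (simp add: shift_sum_integrable shift_sum_def)
qed

lemma shift_sum_diff:
  assumes "mu > 0" "a \<in> L2 CZ" "b \<in> L2 CZ"
  shows "shift_sum mu (\<lambda>j. a j - b j) t = shift_sum mu a t - shift_sum mu b t"
  using shift_sum_linear[OF assms, of 1 "-1"] by simp

lemma shift_sum_cut:
  "shift_sum mu (cut N a) t = (\<Sum>j\<in>{- int N..int N}. a j * of_real (gauss mu (t - x j)))"
  unfolding shift_sum_def
  by (subst integral_CZ_finite(2)[of "{- int N..int N}"]) (auto simp: cut_def mult.commute)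

text \<open>Two uses of the Schur test with the same row bound \<open>gauss_bound mu\<close>. The
  column bound is the integral of one Gaussian when evaluating on the line, and
  \<open>gauss_bound mu\<close> again when evaluating at the points.\<close>

lemma shift_sum_L2:
  assumes mu: "mu > 0" and a: "a \<in> L2 CZ"
  shows "shift_sum mu a \<in> L2 lborel"
    "L2norm lborel (shift_sum mu a) \<le> sqrt (gauss_bound mu * sqrt (pi / mu)) * L2norm CZ a"
    "(\<lambda>k. shift_sum mu a (x k)) \<in> L2 CZ"
    "L2norm CZ (\<lambda>k. shift_sum mu a (x k)) \<le> sqrt (gauss_bound mu * gauss_bound mu) * L2norm CZ a"
proof -
  have m1: "(\<lambda>(t, j). gauss mu (t - x j)) \<in> borel_measurable (lborel \<Otimes>\<^sub>M CZ)"
    unfolding case_prod_beta'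
    by (rule measurable_compose_countable'[where f = "\<lambda>j p. gauss mu (fst p - x j)" and g = snd and I = UNIV]) auto
  have m2: "(\<lambda>(k, j). gauss mu (x k - x j)) \<in> borel_measurable (CZ \<Otimes>\<^sub>M CZ)"
    unfolding case_prod_beta'
    by (rule measurable_compose_countable'[where f = "\<lambda>j p. gauss mu (x (fst p) - x j)" and g = snd and I = UNIV]) auto
  note S1 = Schur_test[OF sigma_finite_lborel sigma_finite_CZ m1 gauss_nonneg gauss_bound_pos[OF mu] _
      gauss_sum_bound[OF mu] _ a, of "sqrt (pi / mu)", folded shift_sum_def]
  show "shift_sum mu a \<in> L2 lborel"
    "L2norm lborel (shift_sum mu a) \<le> sqrt (gauss_bound mu * sqrt (pi / mu)) * L2norm CZ a"
    using S1 gauss_shift(3)[OF mu] mu by auto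
  have "(\<integral>\<^sup>+k. ennreal (gauss mu (x k - x j)) \<partial>CZ) \<le> ennreal (gauss_bound mu)" for j
    using gauss_sum_bound[OF mu, of "x j"] gauss_minus_commute[of mu "x j"] by simp
  note S2 = Schur_test[OF sigma_finite_CZ sigma_finite_CZ m2 gauss_nonneg gauss_bound_pos[OF mu] _
      gauss_sum_bound[OF mu] this a, folded shift_sum_def]
  show "(\<lambda>k. shift_sum mu a (x k)) \<in> L2 CZ"
    "L2norm CZ (\<lambda>k. shift_sum mu a (x k)) \<le> sqrt (gauss_bound mu * gauss_bound mu) * L2norm CZ a"
    using S2 gauss_bound_pos[OF mu] by auto
qed

lemma shift_sum_cut_tendsto:
  assumes mu: "mu > 0" and a: "a \<in> L2 CZ"
  shows "(\<lambda>N. L2norm lborel (\<lambda>t. shift_sum mu (cut N a) t - shift_sum mu a t)) \<longlonglongrightarrow> 0"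
    "(\<lambda>N. L2norm CZ (\<lambda>k. shift_sum mu (cut N a) (x k) - shift_sum mu a (x k))) \<longlonglongrightarrow> 0"
    "uniform_limit UNIV (\<lambda>N. shift_sum mu (cut N a)) (shift_sum mu a) sequentially"
proof -
  note cut = cut_L2[OF a]
  note d = L2_diff(1)[OF cut(1) a]
  note eq = shift_sum_diff[OF mu cut(1) a]
  show "(\<lambda>N. L2norm lborel (\<lambda>t. shift_sum mu (cut N a) t - shift_sum mu a t)) \<longlonglongrightarrow> 0"
    using shift_sum_L2(2)[OF mu d] unfolding eq[symmetric]
    by (rule L2norm_tendsto_0) (intro tendsto_mult_right_zero cut)
  show "(\<lambda>N. L2norm CZ (\<lambda>k. shift_sum mu (cut N a) (x k) - shift_sum mu a (x k))) \<longlonglongrightarrow> 0"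
    using shift_sum_L2(4)[OF mu d] unfolding eq[symmetric]
    by (rule L2norm_tendsto_0) (intro tendsto_mult_right_zero cut)
  have l: "(\<lambda>N. sqrt (gauss_bound (2 * mu)) * L2norm CZ (\<lambda>j. cut N a j - a j)) \<longlonglongrightarrow> 0"
    by (intro tendsto_mult_right_zero cut)
  show "uniform_limit UNIV (\<lambda>N. shift_sum mu (cut N a)) (shift_sum mu a) sequentially"
  proof (rule uniform_limitI)
    fix e :: real assume "e > 0"
    from order_tendstoD(2)[OF l this]
    show "\<forall>\<^sub>F N in sequentially. \<forall>t\<in>UNIV. dist (shift_sum mu (cut N a) t) (shift_sum mu a t) < e"
    proof eventually_elim
      case (elim N)
      then show ?case
        using shift_sum_pointwise[OF mu d[of N]] unfolding dist_norm eq[symmetric] by (auto intro: le_less_trans)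
    qed
  qed
qed

lemma continuous_gauss: "continuous_on A (\<lambda>t. complex_of_real (gauss mu (t - s)))"
  unfolding gauss_def by (intro continuous_intros)

lemma gauss_at_infinity:
  assumes "mu > 0" shows "((\<lambda>t. complex_of_real (gauss mu (t - s))) \<longlongrightarrow> 0) at_infinity"
proof -
  have "((\<lambda>t. gauss mu (t - s)) \<longlongrightarrow> 0) at_top" "((\<lambda>t. gauss mu (t - s)) \<longlongrightarrow> 0) at_bot"
    using assms unfolding gauss_def by real_asymp+
  then have "((\<lambda>t. gauss mu (t - s)) \<longlongrightarrow> 0) at_infinity"
    unfolding at_infinity_eq_at_top_bot by (simp add: filterlim_sup)
  then show ?thesis using tendsto_of_real[of _ 0] by simp
qed

lemma shift_sum_continuous:
  assumes mu: "mu > 0" and a: "a \<in> L2 CZ"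
  shows "continuous_on UNIV (shift_sum mu a)"
proof (rule uniform_limit_theorem[OF _ shift_sum_cut_tendsto(3)[OF mu a]])
  show "\<forall>\<^sub>F N in sequentially. continuous_on UNIV (shift_sum mu (cut N a))"
    unfolding shift_sum_cut[abs_def]
    by (intro always_eventually allI continuous_on_sum continuous_on_mult continuous_on_const continuous_gauss)
qed simp

text \<open>Finite sums of Gaussians vanish at infinity, and uniform convergence permits exchanging
  the two limits.\<close>

lemma shift_sum_at_infinity:
  assumes mu: "mu > 0" and a: "a \<in> L2 CZ"
  shows "(shift_sum mu a \<longlongrightarrow> 0) at_infinity"
proof (rule swap_uniform_limit'[OF _ tendsto_const shift_sum_cut_tendsto(3)[OF mu a]])
  have "((\<lambda>t. \<Sum>j\<in>{- int N..int N}. a j * of_real (gauss mu (t - x j))) \<longlongrightarrow> (\<Sum>j\<in>{- int N..int N}. a j * 0)) at_infinity" for N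
    by (intro tendsto_sum tendsto_mult tendsto_const gauss_at_infinity mu)
  then show "\<forall>\<^sub>F N in sequentially. (shift_sum mu (cut N a) \<longlongrightarrow> 0) at_infinity"
    unfolding shift_sum_cut[abs_def] by simp
qed auto

end

section \<open>Gaussian interpolation\<close>

lemma L2_restrict:
  assumes f: "f \<in> L2 lborel" and A: "A \<in> sets lborel"
  shows "f \<in> L2 (restrict_space lborel A)" "L2norm (restrict_space lborel A) f \<le> L2norm lborel f"
proof -
  have i: "integrable lborel (\<lambda>t. indicator A t *\<^sub>R (cmod (f t))\<^sup>2)"
    using integrable_mult_indicator[OF A L2_integrable[OF f]] .
  show "f \<in> L2 (restrict_space lborel A)"
  proof (rule L2I)
    show "f \<in> borel_measurable (restrict_space lborel A)"
      by (rule measurable_restrict_space1[OF L2_measurable[OF f]])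
    show "integrable (restrict_space lborel A) (\<lambda>t. (cmod (f t))\<^sup>2)"
      using A i by (subst integrable_restrict_space) (auto simp: set_integrable_def)
  qed
  have "(\<integral>t. indicator A t *\<^sub>R (cmod (f t))\<^sup>2 \<partial>lborel) \<le> (\<integral>t. (cmod (f t))\<^sup>2 \<partial>lborel)"
    by (rule integral_mono[OF i L2_integrable[OF f]]) (auto simp: indicator_def)
  then show "L2norm (restrict_space lborel A) f \<le> L2norm lborel f"
    using A unfolding L2norm_def by (subst integral_restrict_space) (auto simp: set_lebesgue_integral_def)
qed

text \<open>Exhibits the Gaussian as a superposition of characters with a positive weight, which is
  what makes its interpolation matrix positive definite.\<close>

lemma gauss_eq_integral:
  assumes "lam > 0"
  shows "complex_of_real (gauss lam y)
    = of_real (1 / sqrt (4 * pi * lam)) * (\<integral>u. of_real (gauss (1 / (4 * lam)) u) * cis (- (y * u)) \<partial>lborel)"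
proof -
  have "(\<integral>u. complex_of_real (gauss (1 / (4 * lam)) u) * cis (- (y * u)) \<partial>lborel)
      = of_real (sqrt (4 * pi * lam) * gauss lam y)"
    using gauss_fourier_scaled(2)[of "1 / (4 * lam)" y] assms by (simp add: gauss_def mult_ac)
  then show ?thesis using assms by simp
qed

lemma gauss_quadratic_form:
  fixes x :: "int \<Rightarrow> real" and a :: "int \<Rightarrow> complex"
  assumes lam: "lam > 0" and J: "finite J"
  defines "P \<equiv> \<lambda>u. \<Sum>j\<in>J. a j * cis (- (x j * u))"
  shows "integrable lborel (\<lambda>u. gauss (1 / (4 * lam)) u * (cmod (P u))\<^sup>2)"
    and "(\<Sum>k\<in>J. (\<Sum>j\<in>J. of_real (gauss lam (x k - x j)) * a j) * cnj (a k))
      = of_real (1 / sqrt (4 * pi * lam) * (\<integral>u. gauss (1 / (4 * lam)) u * (cmod (P u))\<^sup>2 \<partial>lborel))"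
proof -
  define G where "G = gauss (1 / (4 * lam))"
  have eq: "complex_of_real (G u * (cmod (P u))\<^sup>2)
      = (\<Sum>k\<in>J. \<Sum>j\<in>J. a j * cnj (a k) * (of_real (G u) * cis (- ((x j - x k) * u))))" for u
  proof -
    have "complex_of_real (G u * (cmod (P u))\<^sup>2) = of_real (G u) * (cnj (P u) * P u)"
      by (simp add: complex_norm_square mult.commute del: of_real_power)
    also have "\<dots> = of_real (G u) * (\<Sum>k\<in>J. \<Sum>j\<in>J. cnj (a k * cis (- (x k * u))) * (a j * cis (- (x j * u))))"
      by (simp add: P_def sum_product)
    also have "\<dots> = (\<Sum>k\<in>J. \<Sum>j\<in>J. a j * cnj (a k) * (of_real (G u) * (cis (x k * u) * cis (- (x j * u)))))"
      by (simp add: sum_distrib_left cis_cnj mult_ac)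
    also have "\<dots> = (\<Sum>k\<in>J. \<Sum>j\<in>J. a j * cnj (a k) * (of_real (G u) * cis (- ((x j - x k) * u))))"
      by (simp add: cis_mult algebra_simps)
    finally show ?thesis .
  qed
  have Gi: "integrable lborel (\<lambda>u. complex_of_real (G u) * cis (- (y * u)))" for y
    by (rule Bochner_Integration.integrable_bound[OF gauss_fourier_scaled(1)[of "1 / (4 * lam)"]])
       (use lam in \<open>auto simp: G_def norm_mult\<close>)
  have "integrable lborel (\<lambda>u. complex_of_real (G u * (cmod (P u))\<^sup>2))"
    unfolding eq by (intro Bochner_Integration.integrable_sum integrable_mult_right Gi)
  then show "integrable lborel (\<lambda>u. gauss (1 / (4 * lam)) u * (cmod (P u))\<^sup>2)"
    unfolding complex_of_real_integrable_eq G_def .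
  have "(\<Sum>k\<in>J. (\<Sum>j\<in>J. of_real (gauss lam (x k - x j)) * a j) * cnj (a k))
      = (\<Sum>k\<in>J. \<Sum>j\<in>J. a j * cnj (a k) * of_real (gauss lam (x j - x k)))"
    by (simp add: sum_distrib_right sum_distrib_left mult_ac gauss_minus_commute)
  also have "\<dots> = of_real (1 / sqrt (4 * pi * lam)) * (\<Sum>k\<in>J. \<Sum>j\<in>J. \<integral>u. a j * cnj (a k) * (of_real (G u) * cis (- ((x j - x k) * u))) \<partial>lborel)"
    unfolding gauss_eq_integral[OF lam] G_def[symmetric] integral_mult_right_zero
    by (simp only: sum_distrib_left mult.left_commute)
  also have "(\<Sum>k\<in>J. \<Sum>j\<in>J. \<integral>u. a j * cnj (a k) * (of_real (G u) * cis (- ((x j - x k) * u))) \<partial>lborel)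
      = (\<integral>u. complex_of_real (G u * (cmod (P u))\<^sup>2) \<partial>lborel)"
    unfolding eq by (simp add: Bochner_Integration.integral_sum Gi integrable_mult_right Bochner_Integration.integrable_sum del: integral_mult_right_zero)
  finally show "(\<Sum>k\<in>J. (\<Sum>j\<in>J. of_real (gauss lam (x k - x j)) * a j) * cnj (a k))
      = of_real (1 / sqrt (4 * pi * lam) * (\<integral>u. gauss (1 / (4 * lam)) u * (cmod (P u))\<^sup>2 \<partial>lborel))"
    unfolding integral_complex_of_real G_def by (simp only: of_real_mult)
qed

lemma fourier_L1_sum:
  assumes "\<And>j. j \<in> J \<Longrightarrow> integrable lborel (f j)"
  shows "fourier_L1 (\<lambda>t. \<Sum>j\<in>J. a j * f j t) u = (\<Sum>j\<in>J. a j * fourier_L1 (f j) u)"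
proof -
  have "fourier_L1 (\<lambda>t. \<Sum>j\<in>J. a j * f j t) u = (\<integral>t. (\<Sum>j\<in>J. a j * (f j t * cis (- (u * t)))) \<partial>lborel)"
    unfolding fourier_L1_def by (simp add: sum_distrib_right mult.assoc)
  also have "\<dots> = (\<Sum>j\<in>J. a j * fourier_L1 (f j) u)"
    unfolding fourier_L1_def using assms[THEN fourier_L1_integrable]
    by (subst Bochner_Integration.integral_sum) auto
  finally show ?thesis .
qed

section \<open>Invertibility of the interpolation matrix\<close>

locale riesz_points = separated x q for x q +
  fixes B :: real
  assumes B: "B > 0"
    and riesz_lower: "\<And>J c. finite J \<Longrightarrow> inverse B * sqrt (\<Sum>j\<in>J. (cmod (c j))\<^sup>2)
      \<le> L2norm (restrict_space lborel {-pi..pi}) (\<lambda>t. \<Sum>j\<in>J. c j * cis (- (x j * t)))"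
    and riesz_upper: "\<And>J c. finite J \<Longrightarrow> L2norm (restrict_space lborel {-pi..pi}) (\<lambda>t. \<Sum>j\<in>J. c j * cis (- (x j * t)))
      \<le> B * sqrt (\<Sum>j\<in>J. (cmod (c j))\<^sup>2)"
begin

text \<open>The normalisation of the Gaussian integral, times the least value of the Gaussian weight
  on [-pi, pi], times the square of the lower Riesz constant.\<close>

definition lower_const :: "real \<Rightarrow> real" where
  "lower_const lam = 1 / sqrt (4 * pi * lam) * (gauss (1 / (4 * lam)) pi * (inverse B)\<^sup>2)"

lemma lower_const_pos: "lam > 0 \<Longrightarrow> lower_const lam > 0"
  using B by (simp add: lower_const_def)

lemma coercive_finite:
  assumes lam: "lam > 0" and J: "finite J"
  shows "lower_const lam * (\<Sum>j\<in>J. (cmod (a j))\<^sup>2)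
    \<le> Re (\<Sum>k\<in>J. (\<Sum>j\<in>J. of_real (gauss lam (x k - x j)) * a j) * cnj (a k))"
proof -
  define P where "P u = (\<Sum>j\<in>J. a j * cis (- (x j * u)))" for u
  define G where "G = gauss (1 / (4 * lam))"
  note qf = gauss_quadratic_form[OF lam J, where x = x and a = a, folded P_def G_def]
  have [measurable]: "P \<in> borel_measurable borel" unfolding P_def by measurable
  have "(inverse B)\<^sup>2 * (\<Sum>j\<in>J. (cmod (a j))\<^sup>2) = (inverse B * sqrt (\<Sum>j\<in>J. (cmod (a j))\<^sup>2))\<^sup>2"
    by (simp add: power_mult_distrib sum_nonneg)
  also have "\<dots> \<le> (L2norm (restrict_space lborel {-pi..pi}) P)\<^sup>2"
    using riesz_lower[OF J, of a] B by (intro power_mono) (auto simp: P_def[abs_def] sum_nonneg)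
  also have "\<dots> = (\<integral>u. indicator {-pi..pi} u * (cmod (P u))\<^sup>2 \<partial>lborel)"
    unfolding L2norm_power2 by (subst integral_restrict_space) (auto simp: set_lebesgue_integral_def)
  finally have "G pi * ((inverse B)\<^sup>2 * (\<Sum>j\<in>J. (cmod (a j))\<^sup>2)) \<le> G pi * (\<integral>u. indicator {-pi..pi} u * (cmod (P u))\<^sup>2 \<partial>lborel)"
    by (intro mult_left_mono) (auto simp: G_def)
  also have "\<dots> = (\<integral>u. G pi * (indicator {-pi..pi} u * (cmod (P u))\<^sup>2) \<partial>lborel)" by simp
  also have "\<dots> \<le> (\<integral>u. G u * (cmod (P u))\<^sup>2 \<partial>lborel)"
  proof -
    \<comment> \<open>On [-pi, pi] the weight is least at the endpoints; outside, the left-hand side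
      vanishes.\<close>
    have le: "G pi * (indicator {-pi..pi} u * (cmod (P u))\<^sup>2) \<le> G u * (cmod (P u))\<^sup>2" for u
    proof (cases "u \<in> {-pi..pi}")
      case True
      then have "u\<^sup>2 \<le> pi\<^sup>2" by (intro abs_le_square_iff[THEN iffD1]) auto
      then have "G pi \<le> G u" using lam by (auto simp: G_def gauss_def divide_simps)
      then show ?thesis using True by (auto intro: mult_right_mono)
    qed (auto simp: G_def)
    show ?thesis
    proof (rule integral_mono[OF _ qf(1) le])
      show "integrable lborel (\<lambda>u. G pi * (indicator {-pi..pi} u * (cmod (P u))\<^sup>2))"
        by (rule Bochner_Integration.integrable_bound[OF qf(1)]) (use le in \<open>auto simp: abs_mult G_def\<close>)
    qed
  qed
  finally have "1 / sqrt (4 * pi * lam) * (G pi * ((inverse B)\<^sup>2 * (\<Sum>j\<in>J. (cmod (a j))\<^sup>2)))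
      \<le> 1 / sqrt (4 * pi * lam) * (\<integral>u. G u * (cmod (P u))\<^sup>2 \<partial>lborel)"
    using lam by (intro mult_left_mono) auto
  then show ?thesis
    unfolding qf(2) Re_complex_of_real lower_const_def G_def by (simp only: mult.assoc)
qed

text \<open>Both sides are continuous in \<open>a\<close> for the norm of L2, so the estimate for
  finite sums passes to the limit along \<open>cut\<close>.\<close>

lemma coercive:
  assumes lam: "lam > 0" and a: "a \<in> L2 CZ"
  shows "lower_const lam * (L2norm CZ a)\<^sup>2 \<le> Re (\<integral>k. shift_sum lam a (x k) * cnj (a k) \<partial>CZ)"
proof (rule LIMSEQ_le)
  note cut = cut_L2[OF a]
  show "(\<lambda>N. lower_const lam * (L2norm CZ (cut N a))\<^sup>2) \<longlonglongrightarrow> lower_const lam * (L2norm CZ a)\<^sup>2"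
    by (intro tendsto_intros L2_tendsto_norm a cut)
  have "(\<lambda>N. L2norm CZ (\<lambda>k. cnj (cut N a k) - cnj (a k))) \<longlonglongrightarrow> 0"
    using cut(2) by (simp add: L2norm_def flip: complex_cnj_diff)
  then show "(\<lambda>N. Re (\<integral>k. shift_sum lam (cut N a) (x k) * cnj (cut N a k) \<partial>CZ))
      \<longlonglongrightarrow> Re (\<integral>k. shift_sum lam a (x k) * cnj (a k) \<partial>CZ)"
    by (intro tendsto_Re L2_tendsto_integral[OF shift_sum_L2(3)[OF lam a] shift_sum_L2(3)[OF lam cut(1)]
        L2_cnj(1)[OF a] L2_cnj(1)[OF cut(1)] shift_sum_cut_tendsto(2)[OF lam a]])
  have "lower_const lam * (L2norm CZ (cut N a))\<^sup>2 \<le> Re (\<integral>k. shift_sum lam (cut N a) (x k) * cnj (cut N a k) \<partial>CZ)" for N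
  proof -
    let ?J = "{- int N..int N}"
    have "(L2norm CZ (cut N a))\<^sup>2 = (\<Sum>j\<in>?J. (cmod (a j))\<^sup>2)"
      by (subst L2_CZ_finite(2)[of ?J]) (auto simp: cut_def)
    moreover have "(\<integral>k. shift_sum lam (cut N a) (x k) * cnj (cut N a k) \<partial>CZ)
       = (\<Sum>k\<in>?J. (\<Sum>j\<in>?J. of_real (gauss lam (x k - x j)) * a j) * cnj (a k))"
      by (subst integral_CZ_finite(2)[of ?J]) (auto simp: cut_def shift_sum_cut mult.commute)
    ultimately show ?thesis using coercive_finite[OF lam, of ?J a] by simp
  qed
  then show "\<exists>N. \<forall>n\<ge>N. lower_const lam * (L2norm CZ (cut n a))\<^sup>2
      \<le> Re (\<integral>k. shift_sum lam (cut n a) (x k) * cnj (cut n a k) \<partial>CZ)" by blast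
qed

text \<open>Cauchy-Schwarz applied to the coercivity estimate. It gives uniqueness of the
  coefficients as well as the norm bound for the inverse matrix on which boundedness of the
  interpolation operator rests.\<close>

lemma coeff_bound:
  assumes lam: "lam > 0" and a: "a \<in> L2 CZ"
  shows "lower_const lam * L2norm CZ a \<le> L2norm CZ (\<lambda>k. shift_sum lam a (x k))"
proof (cases "L2norm CZ a = 0")
  case False
  then have pos: "L2norm CZ a > 0" using L2norm_nonneg[of CZ a] by linarith
  have "lower_const lam * (L2norm CZ a)\<^sup>2 \<le> cmod (\<integral>k. shift_sum lam a (x k) * cnj (a k) \<partial>CZ)"
    using coercive[OF lam a] complex_Re_le_cmod by (rule order_trans)
  also have "\<dots> \<le> L2norm CZ (\<lambda>k. shift_sum lam a (x k)) * L2norm CZ a"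
    using L2_Cauchy_Schwarz(2)[OF shift_sum_L2(3)[OF lam a] L2_cnj(1)[OF a]] by (simp add: L2_cnj)
  finally have "lower_const lam * L2norm CZ a * L2norm CZ a \<le> L2norm CZ (\<lambda>k. shift_sum lam a (x k)) * L2norm CZ a"
    by (simp add: power2_eq_square mult.assoc)
  then show ?thesis using pos by (rule mult_right_le_imp_le)
qed simp

lemma interpolation_exists:
  assumes lam: "lam > 0" and b: "b \<in> L2 CZ"
  shows "\<exists>a\<in>L2 CZ. \<forall>k. shift_sum lam a (x k) = b k"
proof -
  have "\<exists>a\<in>L2 CZ. AE k in CZ. (\<lambda>k. shift_sum lam a (x k)) k = b k"
    using coercive_surj[of CZ "lower_const lam" "\<lambda>a k. shift_sum lam a (x k)", OF sigma_finite_CZ lower_const_pos[OF lam]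
        shift_sum_L2(3)[OF lam] shift_sum_L2(4)[OF lam] shift_sum_linear[OF lam] coercive[OF lam] b] .
  then show ?thesis by (simp add: AE_count_space)
qed

lemma interpolation_unique:
  assumes lam: "lam > 0" and a: "a \<in> L2 CZ" and b: "b \<in> L2 CZ"
    and eq: "\<And>k. shift_sum lam a (x k) = shift_sum lam b (x k)"
  shows "a = b"
proof
  fix j
  note d = L2_diff(1)[OF a b]
  have "lower_const lam * L2norm CZ (\<lambda>j. a j - b j) \<le> 0"
    using coeff_bound[OF lam d] by (simp add: shift_sum_diff[OF lam a b] eq L2norm_def)
  then have "L2norm CZ (\<lambda>j. a j - b j) = 0"
    using lower_const_pos[OF lam] L2norm_nonneg[of CZ "\<lambda>j. a j - b j"] by (simp add: mult_le_0_iff)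
  from L2_CZ_eq_0[OF d this, of j] show "a j = b j" by simp
qed

text \<open>A square-integrable transform that vanishes almost everywhere off [-pi, pi] is
  integrable, so inversion applies at each \<open>x k\<close>. It shows the sample to be an inner
  product with the k-th exponential divided by \<open>2 * pi\<close>, which is the setting of
  Bessel's inequality.\<close>

lemma PW_samples: "\<exists>C\<ge>0. \<forall>f\<in>PW_pi. (\<lambda>k. f (x k)) \<in> L2 CZ \<and> L2norm CZ (\<lambda>k. f (x k)) \<le> C * L2norm lborel f"
proof -
  obtain C where C: "C \<ge> 0" "\<And>g. g \<in> L2 lborel \<Longrightarrow> L2norm lborel (fourier_L2 g) \<le> C * L2norm lborel g"
    using fourier_L2_bounded by blast
  let ?R = "restrict_space lborel {-pi..pi}"
  have "(\<lambda>k. f (x k)) \<in> L2 CZ \<and> L2norm CZ (\<lambda>k. f (x k)) \<le> (1 / (2 * pi) * B * C) * L2norm lborel f" if f: "f \<in> PW_pi" for f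
  proof -
    from f have f2: "f \<in> L2 lborel" and cont: "continuous_on UNIV f"
      and zero: "AE u in lborel. u \<notin> {-pi..pi} \<longrightarrow> fourier_L2 f u = 0"
      by (auto simp: PW_pi_def)
    define F where "F = fourier_L2 f"
    have F: "F \<in> L2 lborel" unfolding F_def by (rule fourier_L2_in_L2[OF f2])
    note [measurable] = L2_measurable[OF F]
    have ind: "(\<lambda>u. indicator {-pi..pi} u :: complex) \<in> L2 lborel"
    proof (rule L2I)
      have "(\<lambda>t. (cmod (indicator {-pi..pi} t))\<^sup>2) = (indicator {-pi..pi} :: real \<Rightarrow> real)"
        by (auto simp: indicator_def)
      then show "integrable lborel (\<lambda>t. (cmod (indicator {-pi..pi} t))\<^sup>2)" by simp
    qed simp
    have FI: "AE u in lborel. F u = F u * indicator {-pi..pi} u"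
      using zero by eventually_elim (auto simp: F_def indicator_def)
    have int: "integrable lborel F"
      using L2_mult_integrable(1)[OF F ind] integrable_cong_AE[OF _ _ FI] by simp
    have val: "f (x k) = of_real (1 / (2 * pi)) * (\<integral>u. F u * cnj (cis (- (x k * u))) \<partial>?R)" for k
    proof -
      have "(\<integral>u. F u * cnj (cis (- (x k * u))) \<partial>?R) = (\<integral>u. indicator {-pi..pi} u *\<^sub>R (F u * cis (x k * u)) \<partial>lborel)"
        by (subst integral_restrict_space) (auto simp: set_lebesgue_integral_def cis_cnj)
      also have "\<dots> = (\<integral>u. F u * cis (x k * u) \<partial>lborel)"
      proof (rule integral_cong_AE)
        show "AE u in lborel. indicator {-pi..pi} u *\<^sub>R (F u * cis (x k * u)) = F u * cis (x k * u)"
          using FI by eventually_elim (auto simp: indicator_def)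
      qed measurable
      finally show ?thesis
        using fourier_L2_inversion[OF f2 cont int[unfolded F_def], of "x k"] by (simp add: F_def)
    qed
    have e: "(\<lambda>t. cis (- (x j * t))) \<in> L2 ?R" for j
    proof (rule L2_bound(1)[where C = 1, OF _ L2_const_restrict[of 1]])
      show "(\<lambda>t. cis (- (x j * t))) \<in> borel_measurable ?R"
        by (intro measurable_restrict_space1) measurable
    qed auto
    note FR = L2_restrict[OF F, of "{-pi..pi}"]
    define c where "c k = (\<integral>u. F u * cnj (cis (- (x k * u))) \<partial>?R)" for k
    have c: "c \<in> L2 CZ" "L2norm CZ c \<le> B * L2norm ?R F"
      using Bessel[OF e B riesz_upper FR(1)] unfolding c_def[abs_def] by auto
    have fc: "(\<lambda>k. f (x k)) = (\<lambda>k. of_real (1 / (2 * pi)) * c k)" using val by (simp add: c_def)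
    have "L2norm CZ (\<lambda>k. f (x k)) = 1 / (2 * pi) * L2norm CZ c"
      unfolding fc L2_cmult(2)[OF c(1)] norm_of_real by simp
    also have "\<dots> \<le> 1 / (2 * pi) * (B * (C * L2norm lborel f))"
    proof -
      have "L2norm ?R F \<le> C * L2norm lborel f" using FR(2) C(2)[OF f2] by (simp add: F_def)
      then have "L2norm CZ c \<le> B * (C * L2norm lborel f)"
        using c(2) B by (meson less_imp_le mult_left_mono order_trans)
      then show ?thesis by (intro mult_left_mono) auto
    qed
    finally have "L2norm CZ (\<lambda>k. f (x k)) \<le> (1 / (2 * pi) * B * C) * L2norm lborel f" by (simp only: mult.assoc)
    moreover have "(\<lambda>k. f (x k)) \<in> L2 CZ" unfolding fc by (rule L2_cmult(1)[OF c(1)])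
    ultimately show ?thesis by blast
  qed
  then show ?thesis using B C(1) by (intro exI[of _ "1 / (2 * pi) * B * C"]) auto
qed

lemma interpolates_iff:
  assumes "lam > 0"
  shows "square_summable a \<and> interpolates lam x f a \<longleftrightarrow> a \<in> L2 CZ \<and> (\<forall>k. shift_sum lam a (x k) = f (x k))"
  unfolding square_summable_iff interpolates_def
  using shift_sum_has_sum[OF assms, of a] has_sum_unique by metis

lemma interpolates_unique:
  assumes "lam > 0" "square_summable a \<and> interpolates lam x f a" "square_summable b \<and> interpolates lam x f b"
  shows "a = b"
  using assms interpolation_unique[OF assms(1)] unfolding interpolates_iff[OF assms(1)] by metis

lemma gauss_coeff_eq:
  assumes "lam > 0" "square_summable a \<and> interpolates lam x f a"
  shows "gauss_coeff lam x f = a"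
  unfolding gauss_coeff_def using assms(2) interpolates_unique[OF assms(1) _ assms(2)] by (rule the_equality)

lemma gauss_coeff:
  assumes "lam > 0" "f \<in> PW_pi"
  shows "gauss_coeff lam x f \<in> L2 CZ" "shift_sum lam (gauss_coeff lam x f) (x k) = f (x k)"
    "\<exists>!a. square_summable a \<and> interpolates lam x f a"
proof -
  obtain a where "square_summable a \<and> interpolates lam x f a"
    using PW_samples interpolation_exists[OF assms(1)] assms(2) interpolates_iff[OF assms(1)] by metis
  then show "gauss_coeff lam x f \<in> L2 CZ" "shift_sum lam (gauss_coeff lam x f) (x k) = f (x k)"
    "\<exists>!a. square_summable a \<and> interpolates lam x f a"
    using gauss_coeff_eq[OF assms(1)] interpolates_unique[OF assms(1)] interpolates_iff[OF assms(1)] by metis+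
qed

lemma gauss_interpolant_eq:
  assumes "lam > 0" "f \<in> PW_pi"
  shows "gauss_interpolant lam x f = shift_sum lam (gauss_coeff lam x f)"
  using infsumI[OF shift_sum_has_sum[OF assms(1) gauss_coeff(1)[OF assms]]]
  by (auto simp: gauss_interpolant_def)

text \<open>The combined sequence is square-summable and interpolates the combined data at the
  points, so uniqueness identifies it.\<close>

lemma gauss_coeff_linear:
  assumes lam: "lam > 0" and f: "f \<in> PW_pi" and g: "g \<in> PW_pi"
  shows "gauss_coeff lam x (\<lambda>s. c * f s + d * g s) = (\<lambda>j. c * gauss_coeff lam x f j + d * gauss_coeff lam x g j)"
  by (rule gauss_coeff_eq[OF lam], unfold interpolates_iff[OF lam])
     (auto intro!: L2_add L2_cmult simp: shift_sum_linear gauss_coeff f g lam)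

lemma gauss_interpolant_linear:
  assumes lam: "lam > 0" and f: "f \<in> PW_pi" and g: "g \<in> PW_pi"
  shows "gauss_interpolant lam x (\<lambda>s. c * f s + d * g s) t
    = c * gauss_interpolant lam x f t + d * gauss_interpolant lam x g t"
proof -
  have "(\<lambda>j. c * gauss_coeff lam x f j + d * gauss_coeff lam x g j) \<in> L2 CZ"
    by (intro L2_add L2_cmult gauss_coeff f g lam)
  from infsumI[OF shift_sum_has_sum[OF lam this, of t]]
  show ?thesis
    unfolding gauss_interpolant_eq[OF lam f] gauss_interpolant_eq[OF lam g]
    by (simp add: gauss_interpolant_def gauss_coeff_linear[OF lam f g] shift_sum_linear gauss_coeff f g lam)
qed

end

section \<open>The transform of the Gaussian series\<close>

context separated
begin

definition gauss_weight :: "real \<Rightarrow> real \<Rightarrow> real" where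
  "gauss_weight mu u = sqrt (pi / mu) * exp (- u\<^sup>2 / (4 * mu))"

lemma gauss_weight_pos: "mu > 0 \<Longrightarrow> gauss_weight mu u > 0"
  by (simp add: gauss_weight_def)

text \<open>Partial sums of the series are integrable, so their transforms are explicit: a Gaussian
  weight times a finite exponential sum. Continuity of the transform in L2 carries the convergence
  of the series over to these products on the whole line.\<close>

lemma fourier_shift_sum_cut:
  fixes a :: "int \<Rightarrow> complex"
  assumes mu: "mu > 0"
  defines "h \<equiv> \<lambda>N u. of_real (gauss_weight mu u) * (\<Sum>j\<in>{- int N..int N}. a j * cis (- (x j * u)))"
  assumes a: "a \<in> L2 CZ"
  shows "h N \<in> L2 lborel"
    "(\<lambda>N. L2norm lborel (\<lambda>u. h N u - fourier_L2 (shift_sum mu a) u)) \<longlonglongrightarrow> 0"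
proof -
  have gi: "integrable lborel (\<lambda>t. complex_of_real (gauss mu (t - s)))" for s
    using gauss_shift(1)[OF mu] by simp
  have L2: "shift_sum mu (cut N a) \<in> L2 lborel" for N
    by (rule shift_sum_L2(1)[OF mu cut_L2(1)[OF a]])
  have L1: "integrable lborel (shift_sum mu (cut N a))" for N
    unfolding shift_sum_cut[abs_def] by (intro Bochner_Integration.integrable_sum integrable_mult_right gi)
  have h: "fourier_L1 (shift_sum mu (cut N a)) = h N" for N
    unfolding shift_sum_cut[abs_def] h_def fun_eq_iff fourier_L1_sum[OF gi] gauss_shift_fourier[OF mu] gauss_weight_def
    by (simp only: sum_distrib_left mult.left_commute) simp
  show hN: "h N \<in> L2 lborel" for N
    unfolding h[symmetric] by (rule fourier_L1_L2(1)[OF L1 L2])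
  have "L2norm lborel (\<lambda>u. fourier_L2 (shift_sum mu (cut N a)) u - fourier_L2 (shift_sum mu a) u)
    = L2norm lborel (\<lambda>u. h N u - fourier_L2 (shift_sum mu a) u)" for N
  proof (rule L2norm_cong_AE)
    show "AE u in lborel. fourier_L2 (shift_sum mu (cut N a)) u - fourier_L2 (shift_sum mu a) u = h N u - fourier_L2 (shift_sum mu a) u"
      using fourier_L2_eq_L1[OF L2 L1, of N] unfolding h by eventually_elim simp
  qed (intro L2_measurable L2_diff(1) fourier_L2_in_L2 L2 hN shift_sum_L2(1)[OF mu a])+
  then show "(\<lambda>N. L2norm lborel (\<lambda>u. h N u - fourier_L2 (shift_sum mu a) u)) \<longlonglongrightarrow> 0"
    using fourier_L2_tendsto[OF L2 shift_sum_L2(1)[OF mu a] shift_sum_cut_tendsto(1)[OF mu a]] by simp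
qed

text \<open>Dividing the transform by its Gaussian factor yields the exponential sum on all intervals at
  once, since the factor is bounded below on bounded sets.\<close>

lemma fourier_shift_sum:
  assumes mu: "mu > 0" and a: "a \<in> L2 CZ"
  shows "has_exponential_sum x a (\<lambda>u. fourier_L2 (shift_sum mu a) u / of_real (gauss_weight mu u))"
proof -
  define F where "F = fourier_L2 (shift_sum mu a)"
  define S where "S u = F u / of_real (gauss_weight mu u)" for u
  define P where "P N u = (\<Sum>j\<in>{- int N..int N}. a j * cis (- (x j * u)))" for N u
  have F: "F \<in> L2 lborel" unfolding F_def by (rule fourier_L2_in_L2[OF shift_sum_L2(1)[OF mu a]])
  have [measurable]: "F \<in> borel_measurable borel" using L2_measurable[OF F] by simp
  have [measurable]: "gauss_weight mu \<in> borel_measurable borel" unfolding gauss_weight_def[abs_def] by measurable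
  have S [measurable]: "S \<in> borel_measurable borel" unfolding S_def[abs_def] by measurable
  have P [measurable]: "P N \<in> borel_measurable borel" for N unfolding P_def[abs_def] by measurable
  have h: "(\<lambda>u. of_real (gauss_weight mu u) * P N u) \<in> L2 lborel"
    and hlim: "(\<lambda>N. L2norm lborel (\<lambda>u. of_real (gauss_weight mu u) * P N u - F u)) \<longlonglongrightarrow> 0" for N
    using fourier_shift_sum_cut[OF mu a] unfolding P_def F_def by auto
  have "has_L2_sum (restrict_space lborel {b..c}) (\<lambda>j u. a j * cis (- (x j * u))) S" for b c
  proof -
    define M where "M = restrict_space lborel {b..c}"
    \<comment> \<open>A positive lower bound for the weight on the interval, since the weight
      decreases in \<open>\<bar>u\<bar>\<close>.\<close>
    define w where "w = gauss_weight mu (max \<bar>b\<bar> \<bar>c\<bar>)"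
    have w: "w > 0" using gauss_weight_pos[OF mu] by (simp add: w_def)
    have wle: "w \<le> gauss_weight mu u" if "u \<in> space M" for u
    proof -
      have "\<bar>u\<bar> \<le> max \<bar>b\<bar> \<bar>c\<bar>" using that by (auto simp: M_def space_restrict_space)
      then have "u\<^sup>2 \<le> (max \<bar>b\<bar> \<bar>c\<bar>)\<^sup>2" by (intro abs_le_square_iff[THEN iffD1]) auto
      then show ?thesis using mu by (simp add: w_def gauss_weight_def divide_right_mono)
    qed
    have meas: "f \<in> borel_measurable borel \<Longrightarrow> f \<in> borel_measurable M" for f :: "real \<Rightarrow> complex"
      unfolding M_def by (intro measurable_restrict_space1) simp
    have bound: "f \<in> L2 M \<and> L2norm M f \<le> inverse w * L2norm lborel (\<lambda>u. of_real (gauss_weight mu u) * f u)"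
      if f: "f \<in> borel_measurable borel" and fw: "(\<lambda>u. of_real (gauss_weight mu u) * f u) \<in> L2 lborel" for f :: "real \<Rightarrow> complex"
    proof -
      have le: "AE u in M. cmod (f u) \<le> inverse w * cmod (of_real (gauss_weight mu u) * f u)"
      proof (rule AE_I2)
        fix u assume "u \<in> space M"
        from mult_right_mono[OF wle[OF this], of "cmod (f u)"] w
        show "cmod (f u) \<le> inverse w * cmod (of_real (gauss_weight mu u) * f u)"
          using gauss_weight_pos[OF mu, of u] by (simp add: norm_mult field_simps)
      qed
      note R = L2_restrict[OF fw, of "{b..c}", folded M_def]
      have "f \<in> L2 M" "L2norm M f \<le> inverse w * L2norm M (\<lambda>u. of_real (gauss_weight mu u) * f u)"
        using L2_bound[OF meas[OF f] R(1) _ le] w by auto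
      moreover have "inverse w * L2norm M (\<lambda>u. of_real (gauss_weight mu u) * f u)
          \<le> inverse w * L2norm lborel (\<lambda>u. of_real (gauss_weight mu u) * f u)"
        using R(2) w by (intro mult_left_mono) auto
      ultimately show ?thesis by linarith
    qed
    have WS: "of_real (gauss_weight mu u) * S u = F u" for u
      using gauss_weight_pos[OF mu, of u] by (simp add: S_def)
    have S2: "S \<in> L2 M" using bound[OF S] F by (simp add: WS)
    have "L2norm M (\<lambda>u. P N u - S u) \<le> inverse w * L2norm lborel (\<lambda>u. of_real (gauss_weight mu u) * P N u - F u)" for N
      using bound[of "\<lambda>u. P N u - S u"] L2_diff(1)[OF h F, of N] by (simp add: right_diff_distrib WS)
    then have "(\<lambda>N. L2norm M (\<lambda>u. P N u - S u)) \<longlonglongrightarrow> 0"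
      by (rule L2norm_tendsto_0) (intro tendsto_mult_right_zero hlim)
    moreover have "(\<lambda>u. a j * cis (- (x j * u))) \<in> L2 M" for j
      unfolding M_def
    proof (rule L2_bound(1)[where C = "cmod (a j)", OF _ L2_const_restrict[of 1]])
      show "(\<lambda>u. a j * cis (- (x j * u))) \<in> borel_measurable (restrict_space lborel {b..c})"
        by (intro measurable_restrict_space1) measurable
    qed (auto simp: norm_mult)
    ultimately show ?thesis
      using S2 unfolding has_L2_sum_def M_def[symmetric] by (simp add: L2norm_minus_commute[of M S] P_def)
  qed
  then show ?thesis unfolding has_exponential_sum_def S_def[abs_def] F_def by blast
qed

text \<open>The transform is a Gaussian times the transform of a second series, with parameter
  \<open>2 * mu\<close> and the same coefficients; it is a product of two square integrable functions.\<close>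

lemma fourier_shift_sum_integrable:
  assumes mu: "mu > 0" and a: "a \<in> L2 CZ"
  shows "integrable lborel (fourier_L2 (shift_sum mu a))"
proof -
  \<comment> \<open>The quotient of the weights for \<open>mu\<close> and \<open>2 * mu\<close>: the
    square roots leave \<open>sqrt 2\<close>, and the exponents differ by
    \<open>u\<^sup>2 / (8 * mu)\<close>.\<close>
  define V where "V u = complex_of_real (sqrt 2 * gauss (1 / (8 * mu)) u)" for u
  define P where "P N u = (\<Sum>j\<in>{- int N..int N}. a j * cis (- (x j * u)))" for N u
  define F where "F c = fourier_L2 (shift_sum (c * mu) a)" for c
  have mu2: "2 * mu > 0" using mu by simp
  have F: "F 1 \<in> L2 lborel" "F 2 \<in> L2 lborel"
    unfolding F_def using mu by (auto intro!: fourier_L2_in_L2 shift_sum_L2(1) a)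
  have V2: "V \<in> L2 lborel"
    unfolding V_def[abs_def] of_real_mult using gauss_L2[of "1 / (8 * mu)" 0] mu by (intro L2_cmult) auto
  note VF = L2_mult_integrable(1)[OF V2 F(2)]
  have Vb: "cmod (V u) \<le> sqrt 2" for u
    using gauss_le_1[of "1 / (8 * mu)" u] mu by (simp add: V_def norm_mult)
  have VL: "(\<lambda>u. V u * f u) \<in> L2 lborel \<and> L2norm lborel (\<lambda>u. V u * f u) \<le> sqrt 2 * L2norm lborel f" if f: "f \<in> L2 lborel" for f
  proof -
    have "AE u in lborel. cmod (V u * f u) \<le> sqrt 2 * cmod (f u)"
      by (auto simp: norm_mult intro!: AE_I2 mult_right_mono Vb)
    from L2_bound[OF borel_measurable_times[OF L2_measurable[OF V2] L2_measurable[OF f]] f _ this]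
    show ?thesis by simp
  qed
  have VW: "complex_of_real (gauss_weight mu u) = V u * of_real (gauss_weight (2 * mu) u)" for u
  proof -
    have "exp (- u\<^sup>2 / (4 * mu)) = gauss (1 / (8 * mu)) u * exp (- u\<^sup>2 / (4 * (2 * mu)))"
      using mu by (simp add: gauss_def field_simps flip: exp_add)
    moreover have "sqrt (pi / mu) = sqrt 2 * sqrt (pi / (2 * mu))"
      by (simp flip: real_sqrt_mult)
    ultimately show ?thesis by (simp add: V_def gauss_weight_def flip: of_real_mult)
  qed
  note h1 = fourier_shift_sum_cut[OF mu a, folded P_def] and h2 = fourier_shift_sum_cut[OF mu2 a, folded P_def F_def]
  \<comment> \<open>Both sides are limits of the same weighted partial sums; multiplication by the
    bounded \<open>V\<close> preserves convergence in norm.\<close>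
  have "AE u in lborel. F 1 u = V u * F 2 u"
  proof (rule L2_limit_unique[OF F(1) _ h1(1)])
    show "(\<lambda>u. V u * F 2 u) \<in> L2 lborel" using VL[OF F(2)] by blast
    show "(\<lambda>N. L2norm lborel (\<lambda>u. of_real (gauss_weight mu u) * P N u - F 1 u)) \<longlonglongrightarrow> 0"
      using h1(2) by (simp add: F_def)
    have "L2norm lborel (\<lambda>u. of_real (gauss_weight mu u) * P N u - V u * F 2 u)
      \<le> sqrt 2 * L2norm lborel (\<lambda>u. of_real (gauss_weight (2 * mu) u) * P N u - F 2 u)" for N
      using VL[OF L2_diff(1)[OF h2(1) F(2)]] by (simp add: VW right_diff_distrib mult.assoc)
    then show "(\<lambda>N. L2norm lborel (\<lambda>u. of_real (gauss_weight mu u) * P N u - V u * F 2 u)) \<longlonglongrightarrow> 0"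
      by (rule L2norm_tendsto_0) (intro tendsto_mult_right_zero h2)
  qed
  then have "integrable lborel (F 1)"
    using VF F[THEN L2_measurable] L2_measurable[OF V2] by (subst integrable_cong_AE) auto
  then show ?thesis by (simp add: F_def)
qed

end

lemma riesz_basis_sequence_points:
  assumes "riesz_basis_sequence x"
  obtains q B where "riesz_points x q B"
proof -
  obtain q where q: "q > 0" "\<And>j k. j \<noteq> k \<Longrightarrow> q \<le> \<bar>x j - x k\<bar>"
    using riesz_basis_sequence_separated[OF assms] by blast
  have "riesz_basis (restrict_space lborel {-pi..pi}) (\<lambda>j t. cis (- (x j * t)))"
    using assms by (simp add: riesz_basis_sequence_def)
  from riesz_basis_finite_sums[OF this] obtain B where B: "B > 0"
    and bounds: "\<forall>J c. finite J \<longrightarrow> inverse B * sqrt (\<Sum>j\<in>J. (cmod (c j))\<^sup>2)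
      \<le> L2norm (restrict_space lborel {-pi..pi}) (\<lambda>t. \<Sum>j\<in>J. c j * cis (- (x j * t))) \<and>
      L2norm (restrict_space lborel {-pi..pi}) (\<lambda>t. \<Sum>j\<in>J. c j * cis (- (x j * t))) \<le> B * sqrt (\<Sum>j\<in>J. (cmod (c j))\<^sup>2)"
    by (elim exE conjE)
  have "riesz_points x q B"
    by unfold_locales (use q B bounds in auto)
  then show thesis by (rule that)
qed

theorem theorem2p9:
  fixes lam :: real and x :: "int \<Rightarrow> real"
  assumes "lam > 0" and "riesz_basis_sequence x"
  shows
    "(\<forall>f \<in> PW_pi. \<exists>!a. square_summable a \<and> interpolates lam x f a) \<and>
     (\<forall>f \<in> PW_pi.
        (\<forall>t. (\<lambda>j. gauss_coeff lam x f j * of_real (gauss lam (t - x j))) summable_on UNIV) \<and>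
        continuous_on UNIV (gauss_interpolant lam x f) \<and>
        gauss_interpolant lam x f \<in> L2 lborel) \<and>
     (\<forall>f \<in> PW_pi.
        (\<exists>S. has_exponential_sum x (gauss_coeff lam x f) S \<and>
           (AE u in lborel. fourier_L2 (gauss_interpolant lam x f) u =
              of_real (sqrt (pi / lam) * exp (- u\<^sup>2 / (4 * lam))) * S u)) \<and>
        fourier_L2 (gauss_interpolant lam x f) \<in> L2 lborel \<and>
        integrable lborel (fourier_L2 (gauss_interpolant lam x f))) \<and>
     (\<forall>f \<in> PW_pi.
        (\<forall>t. gauss_interpolant lam x f t =
           1 / (2 * pi) * (\<integral>u. fourier_L2 (gauss_interpolant lam x f) u * cis (t * u) \<partial>lborel)) \<and>
        continuous_on UNIV (gauss_interpolant lam x f) \<and>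
        (gauss_interpolant lam x f \<longlongrightarrow> 0) at_infinity) \<and>
     (\<forall>f \<in> PW_pi. \<forall>g \<in> PW_pi. \<forall>c d t.
        gauss_interpolant lam x (\<lambda>s. c * f s + d * g s) t =
          c * gauss_interpolant lam x f t + d * gauss_interpolant lam x g t) \<and>
     (\<exists>D>0. \<forall>f \<in> PW_pi.
        L2norm lborel (gauss_interpolant lam x f) \<le> D * L2norm lborel f)"
proof -
  note lam = assms(1)
  obtain q B where "riesz_points x q B" using riesz_basis_sequence_points[OF assms(2)] .
  then interpret riesz_points x q B .
  have A: "gauss_coeff lam x f \<in> L2 CZ" "gauss_interpolant lam x f = shift_sum lam (gauss_coeff lam x f)"
    if "f \<in> PW_pi" for f
    using gauss_coeff(1)[OF lam that] gauss_interpolant_eq[OF lam that] by auto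
  show ?thesis
  proof (intro conjI ballI allI)
    fix f assume f: "f \<in> PW_pi"
    note a = A(1)[OF f] and I = A(2)[OF f]
    show "\<exists>!a. square_summable a \<and> interpolates lam x f a" by (rule gauss_coeff(3)[OF lam f])
    show "(\<lambda>j. gauss_coeff lam x f j * of_real (gauss lam (t - x j))) summable_on UNIV" for t
      using shift_sum_has_sum[OF lam a] by (rule has_sum_imp_summable)
    show cont: "continuous_on UNIV (gauss_interpolant lam x f)" "continuous_on UNIV (gauss_interpolant lam x f)"
      unfolding I by (rule shift_sum_continuous[OF lam a])+
    show L2: "gauss_interpolant lam x f \<in> L2 lborel" unfolding I by (rule shift_sum_L2(1)[OF lam a])
    show "\<exists>S. has_exponential_sum x (gauss_coeff lam x f) S \<and>
           (AE u in lborel. fourier_L2 (gauss_interpolant lam x f) u =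
              of_real (sqrt (pi / lam) * exp (- u\<^sup>2 / (4 * lam))) * S u)"
      \<comment> \<open>With the quotient of transform and weight as witness, the required equation
        holds at every \<open>u\<close>.\<close>
      by (intro exI[of _ "\<lambda>u. fourier_L2 (shift_sum lam (gauss_coeff lam x f)) u / of_real (gauss_weight lam u)"]
          conjI fourier_shift_sum[OF lam a] AE_I2)
         (use lam in \<open>simp add: I gauss_weight_def\<close>)
    show "fourier_L2 (gauss_interpolant lam x f) \<in> L2 lborel" by (rule fourier_L2_in_L2[OF L2])
    show int: "integrable lborel (fourier_L2 (gauss_interpolant lam x f))"
      unfolding I by (rule fourier_shift_sum_integrable[OF lam a])
    show "gauss_interpolant lam x f t =
           1 / (2 * pi) * (\<integral>u. fourier_L2 (gauss_interpolant lam x f) u * cis (t * u) \<partial>lborel)" for t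
      by (rule fourier_L2_inversion[OF L2 cont(1) int])
    show "(gauss_interpolant lam x f \<longlongrightarrow> 0) at_infinity"
      unfolding I by (rule shift_sum_at_infinity[OF lam a])
  next
    fix f g c d t assume "f \<in> PW_pi" "g \<in> PW_pi"
    then show "gauss_interpolant lam x (\<lambda>s. c * f s + d * g s) t =
          c * gauss_interpolant lam x f t + d * gauss_interpolant lam x g t"
      by (rule gauss_interpolant_linear[OF lam])
  next
    obtain C where C: "C \<ge> 0" "\<And>f. f \<in> PW_pi \<Longrightarrow> L2norm CZ (\<lambda>k. f (x k)) \<le> C * L2norm lborel f"
      using PW_samples by blast
    define K where "K = sqrt (gauss_bound lam * sqrt (pi / lam))"
    define m where "m = lower_const lam"
    have K: "K > 0" and m: "m > 0"
      using gauss_bound_pos[OF lam] lower_const_pos[OF lam] lam by (auto simp: K_def m_def)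
    \<comment> \<open>The constant composes three bounds: sampling (\<open>C\<close>), inverting the
      matrix (\<open>1 / m\<close>) and summing the Gaussians (\<open>K\<close>). Using
      \<open>C + 1\<close> keeps it positive when \<open>C = 0\<close>.\<close>
    have "L2norm lborel (gauss_interpolant lam x f) \<le> K * (C + 1) / m * L2norm lborel f" if f: "f \<in> PW_pi" for f
    proof -
      have "m * L2norm CZ (gauss_coeff lam x f) \<le> C * L2norm lborel f"
        using coeff_bound[OF lam A(1)[OF f]] C(2)[OF f] gauss_coeff(2)[OF lam f] by (simp add: m_def)
      also have "\<dots> \<le> (C + 1) * L2norm lborel f" by (intro mult_right_mono) auto
      finally have "L2norm CZ (gauss_coeff lam x f) \<le> (C + 1) * L2norm lborel f / m"
        using m by (simp add: pos_le_divide_eq mult.commute)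
      then have "K * L2norm CZ (gauss_coeff lam x f) \<le> K * ((C + 1) * L2norm lborel f / m)"
        using K by (intro mult_left_mono) auto
      then show ?thesis
        using shift_sum_L2(2)[OF lam A(1)[OF f]] by (simp add: A(2)[OF f] K_def mult_ac)
    qed
    moreover have "K * (C + 1) / m > 0" using K C(1) m by simp
    ultimately show "\<exists>D>0. \<forall>f \<in> PW_pi. L2norm lborel (gauss_interpolant lam x f) \<le> D * L2norm lborel f"
      by blast
  qed
qed

end
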